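(* Let $m\ge4$ be an integer, let $N=\frac12(m^2+m)+2$, let $X\subset\mathbb{P}^N$ be the (closure of the) image of the rational map $\varphi:\mathbb{P}^2\dashrightarrow\mathbb{P}^N$ defined by a basis of the space of forms of degree $m+2$ vanishing on $Z(F_{m,3})$, consisting of the forms $xyz\lambda$, with $\lambda$ running through all monomials of degree $m-1$ in $x,y,z$, together with $G_x,G_y,G_z$. Let $I=I(X)$ be the homogeneous ideal of $X$. Then: (1) $X\subset\mathbb{P}^N$ is an arithmetically Cohen-Macaulay surface. (2) The ideal $I$ is generated by forms of degree $\le3$. More precisely, $I$ is generated by $3\binom{m+2}{4}$ quadrics and one cubic $C_m$, where for $m$ odd $$C_m:\quad 2H_xH_yH_z+G_xH_yH_z+H_xG_yH_z+H_xH_yG_z-G_xG_yG_z,$$ and for $m$ even $$C_m:\quad G_xH_yH_z+H_xG_yH_z+H_xH_yG_z+G_xG_yG_z.$$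
   Context: We work over $\mathbb{C}$. Let $F_{m,3}=xyz(x^m-y^m)(y^m-z^m)(z^m-x^m)$. $Z(F_{m,3})\subset\mathbb{P}^2$ is the set of $3m+3$ points dual to the linear factors of $F_{m,3}$, where $(p:q:r)$ is dual to the line $px+qy+rz=0$. The forms are $G_x=yz(y^m-(-z)^m)$, $G_y=zx(z^m-(-x)^m)$, $G_z=xy(x^m-(-y)^m)$, and $H_x=x^myz$, $H_y=xy^mz$, $H_z=xyz^m$. In the formulas for $C_m$, the symbols $G_x,G_y,G_z,H_x,H_y,H_z$ denote the homogeneous coordinates of $\mathbb{P}^N$ corresponding to these basis forms. Arithmetically Cohen-Macaulay means that the homogeneous coordinate ring is Cohen-Macaulay. *)

theory Defs
  imports
    Complex_Main
    "HOL-Library.Poly_Mapping"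
    "HOL-Library.Extended_Nat"
    "HOL-Algebra.Ring_Divisibility"
    "HOL-Analysis.Abstract_Topology"
begin

section \<open>Polynomials over the complex numbers\<close>

text \<open>A polynomial in variables indexed by \<open>'i\<close> is a finitely supported map from exponent vectors to
  coefficients; the ring operations and divisibility are those of \<open>Poly_Mapping\<close>.\<close>

type_synonym 'i cpoly = "('i \<Rightarrow>\<^sub>0 nat) \<Rightarrow>\<^sub>0 complex"

definition Const :: "complex \<Rightarrow> 'i cpoly" where
  "Const c = Poly_Mapping.single 0 c"

definition Var :: "'i \<Rightarrow> 'i cpoly" where
  "Var i = Poly_Mapping.single (Poly_Mapping.single i 1) 1"

definition vars :: "'i cpoly \<Rightarrow> 'i set" where
  "vars f = (\<Union>e \<in> Poly_Mapping.keys f. Poly_Mapping.keys e)"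

definition peval :: "('i \<Rightarrow> complex) \<Rightarrow> 'i cpoly \<Rightarrow> complex" where
  "peval v f = (\<Sum>e \<in> Poly_Mapping.keys f. Poly_Mapping.lookup f e *
     (\<Prod>i \<in> Poly_Mapping.keys e. v i ^ Poly_Mapping.lookup e i))"

text \<open>The zero polynomial is a form of every degree.\<close>

definition is_form :: "nat \<Rightarrow> 'i cpoly \<Rightarrow> bool" where
  "is_form d f \<longleftrightarrow> (\<forall>e \<in> Poly_Mapping.keys f.
     (\<Sum>i \<in> Poly_Mapping.keys e. Poly_Mapping.lookup e i) = d)"

definition poly_ring :: "'i set \<Rightarrow> 'i cpoly ring" where
  "poly_ring J = \<lparr>carrier = {f. vars f \<subseteq> J}, mult = (*), one = 1, zero = 0, add = (+)\<rparr>"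

subsection \<open>Evaluation is a ring homomorphism\<close>

lemma peval_superset:
  assumes "finite A" "Poly_Mapping.keys f \<subseteq> A"
  shows "peval v f = (\<Sum>e \<in> A. Poly_Mapping.lookup f e *
           (\<Prod>i \<in> Poly_Mapping.keys e. v i ^ Poly_Mapping.lookup e i))"
  unfolding peval_def
  by (rule sum.mono_neutral_left) (use assms in \<open>auto simp: in_keys_iff\<close>)

lemma peval_0 [simp]: "peval v 0 = 0"
  by (simp add: peval_def)

lemma peval_1 [simp]: "peval v 1 = 1"
  by (simp add: peval_def)

lemma peval_add: "peval v (f + g) = peval v f + peval v g"
proof -
  let ?A = "Poly_Mapping.keys f \<union> Poly_Mapping.keys g"
  have "Poly_Mapping.keys (f + g) \<subseteq> ?A" by (rule keys_add)
  then show ?thesis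
    by (simp add: peval_superset[of ?A] lookup_add distrib_right sum.distrib)
qed

lemma peval_single:
  "peval v (Poly_Mapping.single e c) =
     c * (\<Prod>i \<in> Poly_Mapping.keys e. v i ^ Poly_Mapping.lookup e i)"
  by (simp add: peval_def)

lemma prod_exponent_superset:
  fixes v :: "'i \<Rightarrow> complex"
  assumes "finite A" "Poly_Mapping.keys e \<subseteq> A"
  shows "(\<Prod>i \<in> Poly_Mapping.keys e. v i ^ Poly_Mapping.lookup e i) =
         (\<Prod>i \<in> A. v i ^ Poly_Mapping.lookup e i)"
  by (rule prod.mono_neutral_left) (use assms in \<open>auto simp: in_keys_iff\<close>)

lemma prod_exponent_add:
  fixes v :: "'i \<Rightarrow> complex" and a b :: "'i \<Rightarrow>\<^sub>0 nat"
  shows "(\<Prod>i \<in> Poly_Mapping.keys (a + b). v i ^ Poly_Mapping.lookup (a + b) i) =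
    (\<Prod>i \<in> Poly_Mapping.keys a. v i ^ Poly_Mapping.lookup a i) *
    (\<Prod>i \<in> Poly_Mapping.keys b. v i ^ Poly_Mapping.lookup b i)"
proof -
  let ?A = "Poly_Mapping.keys a \<union> Poly_Mapping.keys b"
  have "Poly_Mapping.keys (a + b) \<subseteq> ?A" by (rule keys_add)
  then show ?thesis
    by (simp add: prod_exponent_superset[of ?A "a + b"] prod_exponent_superset[of ?A a]
        prod_exponent_superset[of ?A b])
      (simp add: lookup_add power_add prod.distrib)
qed

lemma cpoly_induct [case_names zero add]:
  fixes f :: "'i cpoly"
  assumes "P 0" "\<And>e c g. P g \<Longrightarrow> P (Poly_Mapping.single e c + g)"
  shows "P f"
proof (induction f rule: update_induct)
  case const
  show ?case by (rule assms)
next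
  case (update f a b)
  have "Poly_Mapping.update a b f = Poly_Mapping.single a b + f"
    using update by (intro poly_mapping_eqI)
      (auto simp: lookup_update lookup_add lookup_single in_keys_iff when_def)
  then show ?case using assms(2) update by metis
qed

lemma peval_mult: "peval v (f * g) = peval v f * peval v g"
proof (induction f rule: cpoly_induct)
  case zero
  show ?case by simp
next
  case (add e c f)
  have "peval v (Poly_Mapping.single e c * g) = peval v (Poly_Mapping.single e c) * peval v g"
    by (induction g rule: cpoly_induct)
      (simp_all add: distrib_left peval_add mult_single peval_single prod_exponent_add)
  with add show ?case
    by (simp add: distrib_right peval_add)
qed

lemma vars_mult: "vars (f * g) \<subseteq> vars f \<union> vars g"
proof
  fix i assume "i \<in> vars (f * g)"
  then obtain e where e: "e \<in> Poly_Mapping.keys (f * g)" "i \<in> Poly_Mapping.keys e"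
    by (auto simp: vars_def)
  then obtain a b where "a \<in> Poly_Mapping.keys f" "b \<in> Poly_Mapping.keys g" "e = a + b"
    using keys_mult[of f g] by auto
  moreover have "i \<in> Poly_Mapping.keys a \<union> Poly_Mapping.keys b"
    using e(2) \<open>e = a + b\<close> keys_add[of a b] by auto
  ultimately show "i \<in> vars f \<union> vars g"
    by (auto simp: vars_def)
qed

lemma is_form_mult:
  assumes "is_form d f" "is_form d' g"
  shows "is_form (d + d') (f * g)"
  unfolding is_form_def
proof
  fix e assume "e \<in> Poly_Mapping.keys (f * g)"
  then obtain a b where ab: "a \<in> Poly_Mapping.keys f" "b \<in> Poly_Mapping.keys g" "e = a + b"
    using keys_mult[of f g] by auto
  let ?A = "Poly_Mapping.keys a \<union> Poly_Mapping.keys b"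
  have deg: "(\<Sum>i \<in> Poly_Mapping.keys c. Poly_Mapping.lookup c i) =
      (\<Sum>i \<in> ?A. Poly_Mapping.lookup c i)" if "Poly_Mapping.keys c \<subseteq> ?A" for c :: "'a \<Rightarrow>\<^sub>0 nat"
    by (rule sum.mono_neutral_left) (use that in \<open>auto simp: in_keys_iff\<close>)
  have "(\<Sum>i \<in> Poly_Mapping.keys e. Poly_Mapping.lookup e i) =
      (\<Sum>i \<in> ?A. Poly_Mapping.lookup a i) + (\<Sum>i \<in> ?A. Poly_Mapping.lookup b i)"
    using deg[OF keys_add[of a b]] by (simp add: ab(3)) (simp add: lookup_add sum.distrib)
  also have "\<dots> = d + d'"
    using assms ab(1,2) deg[of a] deg[of b] by (simp add: is_form_def)
  finally show "(\<Sum>i \<in> Poly_Mapping.keys e. Poly_Mapping.lookup e i) = d + d'" .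
qed


section \<open>Projective space and its Zariski topology\<close>

text \<open>The projective space with homogeneous coordinates indexed by \<open>J\<close>, of dimension \<open>card J - 1\<close>.
  Coordinate vectors are functions vanishing outside \<open>J\<close>; points are proportionality classes.\<close>

definition nonzero_vecs :: "'i set \<Rightarrow> ('i \<Rightarrow> complex) set" where
  "nonzero_vecs J = {v. (\<forall>i. i \<notin> J \<longrightarrow> v i = 0) \<and> (\<exists>i. v i \<noteq> 0)}"

definition proportional :: "'i set \<Rightarrow> (('i \<Rightarrow> complex) \<times> ('i \<Rightarrow> complex)) set" where
  "proportional J = {(u, v). u \<in> nonzero_vecs J \<and> v \<in> nonzero_vecs J \<and>
     (\<exists>c. c \<noteq> 0 \<and> v = (\<lambda>i. c * u i))}"

lemma equiv_proportional: "equiv (nonzero_vecs J) (proportional J)"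
proof (rule equivI)
  show "refl_on (nonzero_vecs J) (proportional J)"
    unfolding refl_on_def proportional_def by (auto intro!: exI[of _ 1])
  show "sym (proportional J)"
  proof (rule symI)
    fix u v assume "(u, v) \<in> proportional J"
    then obtain c where "u \<in> nonzero_vecs J" "v \<in> nonzero_vecs J" "c \<noteq> 0" "v = (\<lambda>i. c * u i)"
      by (auto simp: proportional_def)
    then show "(v, u) \<in> proportional J"
      by (auto simp: proportional_def intro!: exI[of _ "inverse c"])
  qed
  show "trans (proportional J)"
  proof (rule transI)
    fix u v w assume "(u, v) \<in> proportional J" "(v, w) \<in> proportional J"
    then obtain c d where "u \<in> nonzero_vecs J" "w \<in> nonzero_vecs J" "c \<noteq> 0" "d \<noteq> 0"
        "v = (\<lambda>i. c * u i)" "w = (\<lambda>i. d * v i)"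
      by (auto simp: proportional_def)
    then show "(u, w) \<in> proportional J"
      by (auto simp: proportional_def intro!: exI[of _ "d * c"])
  qed
qed (auto simp: proportional_def)

definition proj_space :: "'i set \<Rightarrow> ('i \<Rightarrow> complex) set set" where
  "proj_space J = nonzero_vecs J // proportional J"

definition proj_point :: "'i set \<Rightarrow> ('i \<Rightarrow> complex) \<Rightarrow> ('i \<Rightarrow> complex) set" where
  "proj_point J v = proportional J `` {v}"

definition vanishes_at :: "'i cpoly \<Rightarrow> ('i \<Rightarrow> complex) set \<Rightarrow> bool" where
  "vanishes_at f P \<longleftrightarrow> (\<forall>v \<in> P. peval v f = 0)"

definition forms :: "'i set \<Rightarrow> 'i cpoly set" where
  "forms J = {f \<in> carrier (poly_ring J). \<exists>d. is_form d f}"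

definition zero_locus :: "'i set \<Rightarrow> 'i cpoly set \<Rightarrow> ('i \<Rightarrow> complex) set set" where
  "zero_locus J T = {P \<in> proj_space J. \<forall>f \<in> T. vanishes_at f P}"

definition zariski :: "'i set \<Rightarrow> ('i \<Rightarrow> complex) set topology" where
  "zariski J = topology (\<lambda>U. \<exists>T \<subseteq> forms J. U = proj_space J - zero_locus J T)"

lemma peval_scale_form:
  assumes "is_form d f"
  shows "peval (\<lambda>i. c * v i) f = c ^ d * peval v f"
proof -
  have "(\<Prod>i \<in> Poly_Mapping.keys e. (c * v i) ^ Poly_Mapping.lookup e i) =
      c ^ d * (\<Prod>i \<in> Poly_Mapping.keys e. v i ^ Poly_Mapping.lookup e i)"
    if "e \<in> Poly_Mapping.keys f" for e
  proof -
    have "(\<Prod>i \<in> Poly_Mapping.keys e. c ^ Poly_Mapping.lookup e i) = c ^ d"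
      using assms that by (simp add: is_form_def flip: power_sum)
    then show ?thesis by (simp add: power_mult_distrib prod.distrib)
  qed
  then show ?thesis
    by (simp add: peval_def sum_distrib_left mult.left_commute)
qed

lemma vanishes_at_form_iff:
  assumes "f \<in> forms J" "P \<in> proj_space J" "v \<in> P"
  shows "vanishes_at f P \<longleftrightarrow> peval v f = 0"
proof -
  obtain d where d: "is_form d f" using assms(1) by (auto simp: forms_def)
  have "peval w f = 0" if "w \<in> P" "peval v f = 0" for w
  proof -
    have "(v, w) \<in> proportional J"
      using assms that unfolding proj_space_def
      by (metis quotient_eq_iff[OF equiv_proportional])
    then obtain c where "w = (\<lambda>i. c * v i)" by (auto simp: proportional_def)
    then show ?thesis using peval_scale_form[OF d] that by simp
  qed
  then show ?thesis using assms(3) by (auto simp: vanishes_at_def)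
qed

lemma proj_space_nonempty: "P \<in> proj_space J \<Longrightarrow> \<exists>v. v \<in> P"
  unfolding proj_space_def using in_quotient_imp_non_empty[OF equiv_proportional] by blast

lemma forms_mult:
  assumes "f \<in> forms J" "g \<in> forms J"
  shows "f * g \<in> forms J"
proof -
  obtain d d' where "is_form d f" "is_form d' g" using assms by (auto simp: forms_def)
  then have "is_form (d + d') (f * g)" by (rule is_form_mult)
  moreover have "vars (f * g) \<subseteq> J"
    using assms vars_mult[of f g] by (auto simp: forms_def poly_ring_def)
  ultimately show ?thesis by (auto simp: forms_def poly_ring_def)
qed

lemma istopology_zariski:
  "istopology (\<lambda>U. \<exists>T \<subseteq> forms J. U = proj_space J - zero_locus J T)"
  unfolding istopology_def
proof (intro conjI allI impI)
  fix U V
  assume "\<exists>T \<subseteq> forms J. U = proj_space J - zero_locus J T"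
    and "\<exists>T \<subseteq> forms J. V = proj_space J - zero_locus J T"
  then obtain S T where ST: "S \<subseteq> forms J" "T \<subseteq> forms J"
      "U = proj_space J - zero_locus J S" "V = proj_space J - zero_locus J T"
    by auto
  let ?R = "{f * g | f g. f \<in> S \<and> g \<in> T}"
  have van: "vanishes_at (f * g) P \<longleftrightarrow> vanishes_at f P \<or> vanishes_at g P"
    if fg: "f \<in> S" "g \<in> T" and P: "P \<in> proj_space J" for f g P
  proof -
    obtain v where v: "v \<in> P" using P proj_space_nonempty by blast
    have *: "vanishes_at h P \<longleftrightarrow> peval v h = 0" if "h \<in> forms J" for h
      using vanishes_at_form_iff[OF that P v] .
    have "f \<in> forms J" "g \<in> forms J" using fg ST by auto
    then show ?thesis by (simp add: * forms_mult peval_mult)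
  qed
  have "zero_locus J ?R = zero_locus J S \<union> zero_locus J T"
  proof (intro equalityI subsetI)
    fix P assume P: "P \<in> zero_locus J ?R"
    then have PJ: "P \<in> proj_space J" by (simp add: zero_locus_def)
    have "vanishes_at f P \<or> vanishes_at g P" if "f \<in> S" "g \<in> T" for f g
    proof -
      have "f * g \<in> ?R" using that by blast
      then have "vanishes_at (f * g) P" using P unfolding zero_locus_def by blast
      then show ?thesis using van[OF that PJ] by simp
    qed
    then show "P \<in> zero_locus J S \<union> zero_locus J T"
      using PJ unfolding zero_locus_def by blast
  next
    fix P assume P: "P \<in> zero_locus J S \<union> zero_locus J T"
    then show "P \<in> zero_locus J ?R"
      unfolding zero_locus_def using van by blast
  qed
  then have "U \<inter> V = proj_space J - zero_locus J ?R" using ST by auto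
  moreover have "?R \<subseteq> forms J" using ST forms_mult by blast
  ultimately show "\<exists>T \<subseteq> forms J. U \<inter> V = proj_space J - zero_locus J T" by blast
next
  fix \<U> assume "\<forall>U \<in> \<U>. \<exists>T \<subseteq> forms J. U = proj_space J - zero_locus J T"
  then obtain T where T: "\<And>U. U \<in> \<U> \<Longrightarrow> T U \<subseteq> forms J \<and> U = proj_space J - zero_locus J (T U)"
    by metis
  have "\<Union>\<U> = (\<Union>U \<in> \<U>. proj_space J - zero_locus J (T U))" using T by blast
  also have "\<dots> = proj_space J - zero_locus J (\<Union>U \<in> \<U>. T U)"
    by (auto simp: zero_locus_def)
  finally show "\<exists>T \<subseteq> forms J. \<Union>\<U> = proj_space J - zero_locus J T"
    using T by (intro exI[of _ "\<Union>U \<in> \<U>. T U"]) blast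
qed

lemma openin_zariski:
  "openin (zariski J) U \<longleftrightarrow> (\<exists>T \<subseteq> forms J. U = proj_space J - zero_locus J T)"
  by (simp add: zariski_def topology_inverse'[OF istopology_zariski])

lemma topspace_zariski: "topspace (zariski J) = proj_space J"
proof -
  have "1 \<in> forms J"
    by (auto simp: forms_def poly_ring_def vars_def is_form_def)
  moreover have "proj_space J = proj_space J - zero_locus J {1}"
    using proj_space_nonempty by (fastforce simp: zero_locus_def vanishes_at_def)
  ultimately have "openin (zariski J) (proj_space J)"
    unfolding openin_zariski by (intro exI[of _ "{1}"]) auto
  then show ?thesis
    by (metis Diff_subset openin_subset openin_topspace openin_zariski subset_antisym)
qed

lemma closedin_zariski:
  "closedin (zariski J) A \<longleftrightarrow> (\<exists>T \<subseteq> forms J. A = zero_locus J T)"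
proof -
  have "zero_locus J T \<subseteq> proj_space J" for T by (auto simp: zero_locus_def)
  then show ?thesis
    unfolding closedin_def topspace_zariski openin_zariski by (metis double_diff order_refl)
qed

definition irreducible_space :: "'a topology \<Rightarrow> bool" where
  "irreducible_space T \<longleftrightarrow> topspace T \<noteq> {} \<and>
     (\<forall>A B. closedin T A \<and> closedin T B \<and> topspace T = A \<union> B \<longrightarrow>
        A = topspace T \<or> B = topspace T)"

definition krull_dim_space :: "'a topology \<Rightarrow> enat" where
  "krull_dim_space T = Sup {enat n | n. \<exists>c :: nat \<Rightarrow> 'a set.
     (\<forall>i \<le> n. closedin T (c i) \<and> irreducible_space (subtopology T (c i))) \<and>
     (\<forall>i < n. c i \<subset> c (Suc i))}"

definition projective_surface :: "'i set \<Rightarrow> ('i \<Rightarrow> complex) set set \<Rightarrow> bool" where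
  "projective_surface J X \<longleftrightarrow> closedin (zariski J) X \<and>
     irreducible_space (subtopology (zariski J) X) \<and>
     krull_dim_space (subtopology (zariski J) X) = 2"

definition homogeneous_ideal :: "'i set \<Rightarrow> ('i \<Rightarrow> complex) set set \<Rightarrow> 'i cpoly set" where
  "homogeneous_ideal J X = genideal (poly_ring J) {f \<in> forms J. \<forall>P \<in> X. vanishes_at f P}"

definition homogeneous_coordinate_ring ::
    "'i set \<Rightarrow> ('i \<Rightarrow> complex) set set \<Rightarrow> 'i cpoly set ring" where
  "homogeneous_coordinate_ring J X = poly_ring J Quot homogeneous_ideal J X"


section \<open>Cohen-Macaulay rings\<close>

text \<open>Eisenbud, Commutative Algebra, Section 18.2: a Noetherian ring is Cohen-Macaulay if
  \<open>depth P = codim P\<close> for every maximal ideal \<open>P\<close>, where \<open>depth P\<close> is the maximal length of a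
  regular sequence contained in \<open>P\<close>.\<close>

definition regular_sequence :: "('a, 'b) ring_scheme \<Rightarrow> 'a list \<Rightarrow> bool" where
  "regular_sequence R xs \<longleftrightarrow> set xs \<subseteq> carrier R \<and> genideal R (set xs) \<noteq> carrier R \<and>
     (\<forall>i < length xs. \<forall>a \<in> carrier R.
        a \<otimes>\<^bsub>R\<^esub> (xs ! i) \<in> genideal R (set (take i xs)) \<longrightarrow> a \<in> genideal R (set (take i xs)))"

definition ideal_depth :: "('a, 'b) ring_scheme \<Rightarrow> 'a set \<Rightarrow> enat" where
  "ideal_depth R P = Sup {enat (length xs) | xs. regular_sequence R xs \<and> set xs \<subseteq> P}"

definition prime_codim :: "('a, 'b) ring_scheme \<Rightarrow> 'a set \<Rightarrow> enat" where
  "prime_codim R P = Sup {enat n | n. \<exists>c :: nat \<Rightarrow> 'a set.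
     (\<forall>i \<le> n. primeideal (c i) R) \<and> (\<forall>i < n. c i \<subset> c (Suc i)) \<and> c n = P}"

definition cohen_macaulay :: "('a, 'b) ring_scheme \<Rightarrow> bool" where
  "cohen_macaulay R \<longleftrightarrow> cring R \<and> noetherian_ring R \<and>
     (\<forall>P. maximalideal P R \<longrightarrow> ideal_depth R P = prime_codim R P)"

definition arithmetically_cohen_macaulay ::
    "'i set \<Rightarrow> ('i \<Rightarrow> complex) set set \<Rightarrow> bool" where
  "arithmetically_cohen_macaulay J X \<longleftrightarrow> cohen_macaulay (homogeneous_coordinate_ring J X)"


section \<open>The surface\<close>

datatype xyz = IX | IY | IZ

abbreviation xv :: "xyz cpoly" where "xv \<equiv> Var IX"
abbreviation yv :: "xyz cpoly" where "yv \<equiv> Var IY"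
abbreviation zv :: "xyz cpoly" where "zv \<equiv> Var IZ"

definition F3 :: "nat \<Rightarrow> xyz cpoly" where
  "F3 m = xv * yv * zv * (xv ^ m - yv ^ m) * (yv ^ m - zv ^ m) * (zv ^ m - xv ^ m)"

definition dual_points :: "xyz cpoly \<Rightarrow> (xyz \<Rightarrow> complex) set set" where
  "dual_points F = {P \<in> proj_space UNIV.
     \<forall>v \<in> P. (Const (v IX) * xv + Const (v IY) * yv + Const (v IZ) * zv) dvd F}"

definition forms_vanishing_on :: "nat \<Rightarrow> (xyz \<Rightarrow> complex) set set \<Rightarrow> xyz cpoly set" where
  "forms_vanishing_on d S = {f. is_form d f \<and> (\<forall>P \<in> S. vanishes_at f P)}"

text \<open>\<open>Lam a b c\<close> is the coordinate belonging to the basis form \<open>x y z \<lambda>\<close> with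
  \<open>\<lambda> = x\<^sup>a y\<^sup>b z\<^sup>c\<close>.\<close>

datatype coordinate = Lam nat nat nat | Gx | Gy | Gz

definition coords :: "nat \<Rightarrow> coordinate set" where
  "coords m = {Lam a b c | a b c. a + b + c = m - 1} \<union> {Gx, Gy, Gz}"

fun basis_form :: "nat \<Rightarrow> coordinate \<Rightarrow> xyz cpoly" where
  "basis_form m (Lam a b c) = xv * yv * zv * (xv ^ a * yv ^ b * zv ^ c)"
| "basis_form m Gx = yv * zv * (yv ^ m - (- zv) ^ m)"
| "basis_form m Gy = zv * xv * (zv ^ m - (- xv) ^ m)"
| "basis_form m Gz = xv * yv * (xv ^ m - (- yv) ^ m)"

definition is_family_basis :: "('k \<Rightarrow> 'i cpoly) \<Rightarrow> 'k set \<Rightarrow> 'i cpoly set \<Rightarrow> bool" where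
  "is_family_basis b K V \<longleftrightarrow> inj_on b K \<and>
     \<not> module.dependent (\<lambda>c f. Const c * f) (b ` K) \<and>
     module.span (\<lambda>c f. Const c * f) (b ` K) = V"

definition phi :: "nat \<Rightarrow> (xyz \<Rightarrow> complex) \<Rightarrow> coordinate \<Rightarrow> complex" where
  "phi m v = (\<lambda>k. if k \<in> coords m then peval v (basis_form m k) else 0)"

text \<open>The rational map is evaluated where not all basis forms vanish.\<close>

definition phi_image :: "nat \<Rightarrow> (coordinate \<Rightarrow> complex) set set" where
  "phi_image m = {proj_point (coords m) (phi m v) | v P.
     P \<in> proj_space UNIV \<and> v \<in> P \<and> phi m v \<in> nonzero_vecs (coords m)}"

definition surface_X :: "nat \<Rightarrow> (coordinate \<Rightarrow> complex) set set" where
  "surface_X m = zariski (coords m) closure_of phi_image m"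

text \<open>The forms \<open>H\<^sub>x = x\<^sup>m y z\<close>, \<open>H\<^sub>y = x y\<^sup>m z\<close>, \<open>H\<^sub>z = x y z\<^sup>m\<close> are the basis forms
  \<open>x y z \<lambda>\<close> with \<open>\<lambda>\<close> a pure power.\<close>

definition cubic_C :: "nat \<Rightarrow> coordinate cpoly" where
  "cubic_C m =
    (let Hx = Var (Lam (m - 1) 0 0); Hy = Var (Lam 0 (m - 1) 0); Hz = Var (Lam 0 0 (m - 1));
         gx = Var Gx; gy = Var Gy; gz = Var Gz
     in if odd m
        then 2 * Hx * Hy * Hz + gx * Hy * Hz + Hx * gy * Hz + Hx * Hy * gz - gx * gy * gz
        else gx * Hy * Hz + Hx * gy * Hz + Hx * Hy * gz + gx * gy * gz)"

lemma vector_space_cpoly: "vector_space (\<lambda>c (f :: 'i cpoly). Const c * f)"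
  by unfold_locales
    (simp_all add: Const_def distrib_left distrib_right single_add mult_single
      mult.assoc[symmetric])

lemma basis_form_H:
  assumes "m \<ge> 1"
  shows "basis_form m (Lam (m - 1) 0 0) = xv ^ m * yv * zv"
    and "basis_form m (Lam 0 (m - 1) 0) = xv * yv ^ m * zv"
    and "basis_form m (Lam 0 0 (m - 1)) = xv * yv * zv ^ m"
  using assms by (cases m; simp add: algebra_simps)+

end

theory Submission
  imports Defs "HOL-Computational_Algebra.Fundamental_Theorem_Algebra" "HOL-Computational_Algebra.Primes" "HOL-Analysis.Continuum_Not_Denumerable"
begin

text \<open>
  The coordinate ring is the algebra \<open>S\<close> of functions on \<open>\<complex>\<^sup>3\<close> generated by the basis forms, and the
  ideal of \<open>X\<close> is the kernel of the map from the polynomial ring onto \<open>S\<close>. Modulo quadrics and the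
  cubic every monomial reduces to normal forms \<open>G\<^sup>e (x y z)\<^sup>k v\<^sup>\<sigma>\<close> with \<open>e\<^sub>i \<sigma>\<^sub>i = 0\<close> for all \<open>i\<close> and
  some \<open>e\<^sub>i = 0\<close>. The normal forms are linearly independent, because their orders of vanishing along
  \<open>v\<^sub>i = 0\<close> differ; so quadrics and cubic generate the ideal.

  Modulo the linear forms \<open>l\<^sub>i = G\<^sub>i - H\<^sub>i\<close> the ring \<open>S\<close> is finite-dimensional. Comparing the resulting
  generators of \<open>S\<close> over \<open>\<complex>[l\<^sub>x, l\<^sub>y, l\<^sub>z]\<close> with the normal forms, which are equally many in each degree,
  shows that \<open>S\<close> is free over this ring, so that \<open>l\<^sub>x - a\<^sub>x, l\<^sub>y - a\<^sub>y, l\<^sub>z - a\<^sub>z\<close> is a regular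
  sequence for all complex \<open>a\<close>. Every maximal ideal contains such a sequence, as residue fields
  are \<open>\<complex>\<close>. Conversely, a regular sequence in a prime yields a chain of primes of the same length, and
  no chain is longer than \<open>3\<close>, because the degree filtration of \<open>S\<close> grows cubically. The same bound,
  applied to the cones over irreducible closed subsets, gives \<open>dim X \<le> 2\<close>.
\<close>

section \<open>Chains of primes and regular sequences\<close>

text \<open>The linear forms come from the identity v_i (G_i - H_i) = V (v_{i+1}^m - s v_{i+2}^m -
  v_i^m), where V = x y z and s = (-1)^m. Its coefficient matrix in the m-th powers is invertible,
  so killing the three forms kills every V v_j^m. The Cohen-Macaulay condition is imposed at every
  maximal ideal, not only at the vertex of the cone; hence the shifts by constants a_i. A shifted
  form is not homogeneous, so spanning is stated for the filtration by degree at most d and not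
  degree by degree. Independence of the shifted products is not attacked directly. If finitely many
  functions span a space that contains equally many independent ones, they are independent
  themselves; so it is enough to know independence for normal forms, which are products of basis
  forms without any shift. The ideal of X is handled as the kernel of evaluation on all of affine
  3-space, so membership in it is an identity between functions. The finitely many points where the
  map is undefined enter only when forms vanishing on X are compared with this kernel.\<close>

lemma (in cring) prime_avoiding:
  assumes J: "ideal J R" and S: "S \<subseteq> carrier R" "\<one> \<in> S"
    and mult: "\<And>s t. s \<in> S \<Longrightarrow> t \<in> S \<Longrightarrow> s \<otimes> t \<in> S" and disj: "J \<inter> S = {}"
  shows "\<exists>Q. primeideal Q R \<and> J \<subseteq> Q \<and> Q \<inter> S = {}"
proof -
  let ?A = "{Q. ideal Q R \<and> J \<subseteq> Q \<and> Q \<inter> S = {}}"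
  have "\<exists>M\<in>?A. \<forall>X\<in>?A. M \<subseteq> X \<longrightarrow> X = M"
  proof (rule subset_Zorn_nonempty)
    show "?A \<noteq> {}" using J disj by blast
  next
    fix C assume C: "C \<noteq> {}" "subset.chain ?A C"
    then have CA: "C \<subseteq> ?A" by (simp add: pred_on.chain_def)
    have "subset.chain {I. ideal I R} C" using C(2) by (auto simp: pred_on.chain_def)
    from chain_Union_is_ideal[OF this] C(1) have "ideal (\<Union>C) R" by simp
    moreover have "J \<subseteq> \<Union>C" using CA C(1) by blast
    moreover have "\<Union>C \<inter> S = {}" using CA by blast
    ultimately show "\<Union>C \<in> ?A" by blast
  qed
  then obtain Q where "Q \<in> ?A" and max0: "\<forall>X\<in>?A. Q \<subseteq> X \<longrightarrow> X = Q" by (rule bexE)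
  then have Q: "ideal Q R" "J \<subseteq> Q" "Q \<inter> S = {}" by simp_all
  have max: "X = Q" if "ideal X R" "J \<subseteq> X" "X \<inter> S = {}" "Q \<subseteq> X" for X
    using max0 that by simp
  interpret Q: ideal Q R by (rule Q(1))
  \<comment> \<open>Maximality enters here: an element outside \<open>Q\<close> generates with
    \<open>Q\<close> an ideal that must meet \<open>S\<close>. The product of two such elements, for
    \<open>a\<close> and \<open>b\<close> with product in \<open>Q\<close>, lies in both
    \<open>S\<close> and \<open>Q\<close>.\<close>
  have meet: "\<exists>q r. q \<in> Q \<and> r \<in> carrier R \<and> q \<oplus> r \<otimes> a \<in> S" if a: "a \<in> carrier R" "a \<notin> Q" for a
  proof -
    let ?X = "Q <+>\<^bsub>R\<^esub> PIdl a"
    have X: "ideal ?X R" by (intro add_ideals Q(1) cgenideal_ideal a)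
    have aX: "\<zero> \<oplus> a \<in> ?X" unfolding set_add_def'
      using Q.zero_closed cgenideal_self[OF a(1)] by blast
    then have "a \<in> ?X" using a by simp
    have QX: "Q \<subseteq> ?X"
    proof
      fix q assume q: "q \<in> Q"
      have "\<zero> \<otimes> a \<in> PIdl a" by (auto simp: cgenideal_def)
      then have "\<zero> \<in> PIdl a" using a by simp
      then have "q \<oplus> \<zero> \<in> ?X" unfolding set_add_def' using q by blast
      then show "q \<in> ?X" using q Q.a_Hcarr by simp
    qed
    have "?X \<inter> S \<noteq> {}" using max[OF X] QX Q(2) \<open>a \<in> ?X\<close> a(2) by blast
    then show ?thesis unfolding set_add_def' cgenideal_def by blast
  qed
  have "primeideal Q R"
  proof (rule primeidealI[OF Q(1)])
    show "cring R" by (rule is_cring)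
    show "carrier R \<noteq> Q" using Q(3) S by blast
  next
    fix a b assume ab: "a \<in> carrier R" "b \<in> carrier R" "a \<otimes> b \<in> Q"
    show "a \<in> Q \<or> b \<in> Q"
    proof (rule ccontr)
      assume "\<not> ?thesis"
      then obtain q r q' r' where q: "q \<in> Q" "r \<in> carrier R" "q \<oplus> r \<otimes> a \<in> S"
        and q': "q' \<in> Q" "r' \<in> carrier R" "q' \<oplus> r' \<otimes> b \<in> S"
        using meet ab by meson
      have c: "q \<in> carrier R" "q' \<in> carrier R" using q q' Q.a_Hcarr by auto
      have "(q \<oplus> r \<otimes> a) \<otimes> (q' \<oplus> r' \<otimes> b) =
        q \<otimes> (q' \<oplus> r' \<otimes> b) \<oplus> (r \<otimes> a \<otimes> q' \<oplus> (r \<otimes> r') \<otimes> (a \<otimes> b))"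
        using c q q' ab by algebra
      also have "\<dots> \<in> Q"
        by (intro Q.a_closed Q.I_r_closed[OF q(1)] Q.I_l_closed[OF q'(1)] Q.I_l_closed[OF ab(3)])
          (use q q' ab c in simp_all)
      finally show False using mult[OF q(3) q'(3)] Q(3) by blast
    qed
  qed
  then show ?thesis using Q by blast
qed

text \<open>Induction on the last element \<open>x\<close>. Let \<open>J\<close> be generated by the
  other elements. The set \<open>S\<close> of all s x^n with s outside \<open>P\<close> misses
  \<open>J\<close>, because \<open>x\<close> is a nonzerodivisor modulo \<open>J\<close> and
  \<open>J\<close> lies in \<open>P\<close>. A prime \<open>Q\<close> above \<open>J\<close> that
  misses \<open>S\<close> lies in \<open>P\<close>, since \<open>S\<close> contains the complement
  of \<open>P\<close>, and it does not contain \<open>x\<close>. So \<open>Q\<close> is strictly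
  below \<open>P\<close>, and the shorter sequence lies in \<open>Q\<close>.\<close>

lemma (in cring) regular_sequence_chain:
  assumes "regular_sequence R xs" "set xs \<subseteq> P" "primeideal P R"
  shows "\<exists>c. (\<forall>i\<le>length xs. primeideal (c i) R) \<and> (\<forall>i<length xs. c i \<subset> c (Suc i)) \<and>
    c (length xs) = P"
  using assms
proof (induction xs arbitrary: P rule: rev_induct)
  case Nil
  then show ?case by (intro exI[of _ "\<lambda>_. P"]) auto
next
  case (snoc x xs)
  interpret P: primeideal P R by (rule snoc.prems)
  have xc: "x \<in> carrier R" "set xs \<subseteq> carrier R"
    using snoc.prems(1) by (auto simp: regular_sequence_def)
  let ?J = "genideal R (set xs)"
  have J: "ideal ?J R" using xc by (intro genideal_ideal)
  interpret J: ideal ?J R by (rule J)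
  have JP: "?J \<subseteq> P" using snoc.prems(2) by (intro genideal_minimal) (auto intro: P.is_ideal)
  have Pne: "P \<noteq> carrier R" using P.I_notcarr by blast
  have reg: "a \<in> ?J" if "a \<in> carrier R" "a \<otimes> x \<in> ?J" for a
    using snoc.prems(1) that unfolding regular_sequence_def
    by (auto dest!: spec[of _ "length xs"])
  have regn: "a \<in> ?J" if "a \<in> carrier R" "a \<otimes> (x [^] (n::nat)) \<in> ?J" for a n
    using that
  proof (induction n arbitrary: a)
    case (Suc n)
    have "a \<otimes> (x [^] n) \<otimes> x \<in> ?J" using Suc.prems xc by (simp add: m_assoc)
    then have "a \<otimes> (x [^] n) \<in> ?J" by (rule reg[rotated]) (use Suc.prems(1) xc(1) in simp)
    then show ?case using Suc by blast
  qed simp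
  define S where "S = {s \<otimes> (x [^] (n::nat)) | s n. s \<in> carrier R - P}"
  have one: "\<one> \<notin> P" using P.one_imp_carrier Pne by blast
  have memS: "s \<in> S" if "s \<in> carrier R - P" for s
  proof -
    have "s = s \<otimes> (x [^] (0::nat))" using that by simp
    then show ?thesis unfolding S_def using that by blast
  qed
  have xS: "x \<in> S"
  proof -
    have "x = \<one> \<otimes> (x [^] (1::nat))" using xc by simp
    then show ?thesis unfolding S_def using one by blast
  qed
  have "\<exists>Q. primeideal Q R \<and> ?J \<subseteq> Q \<and> Q \<inter> S = {}"
  proof (rule prime_avoiding[OF J])
    show "S \<subseteq> carrier R" using xc by (auto simp: S_def)
    show "\<one> \<in> S" using one memS by blast
    show "?J \<inter> S = {}" using regn JP by (auto simp: S_def)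
  next
    fix s t assume "s \<in> S" "t \<in> S"
    then obtain a b n k where *: "s = a \<otimes> (x [^] (n::nat))" "t = b \<otimes> (x [^] (k::nat))"
      "a \<in> carrier R - P" "b \<in> carrier R - P" by (auto simp: S_def)
    have "s \<otimes> t = (a \<otimes> b) \<otimes> ((x [^] n) \<otimes> (x [^] k))"
      using * xc by (simp add: m_ac)
    also have "(x [^] n) \<otimes> (x [^] k) = x [^] (n + k)" using xc by (simp add: nat_pow_mult)
    finally have "s \<otimes> t = (a \<otimes> b) \<otimes> (x [^] (n + k))" .
    moreover have "a \<otimes> b \<in> carrier R - P" using * P.I_prime by blast
    ultimately show "s \<otimes> t \<in> S" unfolding S_def
      by (intro CollectI exI[of _ "a \<otimes> b"] exI[of _ "n + k"] conjI)
  qed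
  then obtain Q where Q: "primeideal Q R" "?J \<subseteq> Q" "Q \<inter> S = {}" by blast
  interpret Q: primeideal Q R by (rule Q)
  have QP: "Q \<subseteq> P" using Q(3) memS Q.Icarr by blast
  have xsQ: "set xs \<subseteq> Q" using Q(2) genideal_self[of "set xs"] xc by blast
  have "regular_sequence R xs"
    unfolding regular_sequence_def
  proof (intro conjI allI impI ballI)
    show "set xs \<subseteq> carrier R" by (rule xc)
    show "?J \<noteq> carrier R" using JP Pne P.Icarr by blast
  next
    fix i a assume "i < length xs" "a \<in> carrier R" "a \<otimes> xs ! i \<in> genideal R (set (take i xs))"
    then show "a \<in> genideal R (set (take i xs))"
      using snoc.prems(1) unfolding regular_sequence_def
      by (auto simp: nth_append dest!: spec[of _ i])
  qed
  from snoc.IH[OF this xsQ Q(1)] obtain c where c: "\<forall>i\<le>length xs. primeideal (c i) R"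
    "\<forall>i<length xs. c i \<subset> c (Suc i)" "c (length xs) = Q" by blast
  have "Q \<subset> P" using QP xS Q(3) snoc.prems(2) by auto
  then show ?case
    using c snoc.prems(3) by (intro exI[of _ "c(Suc (length xs) := P)"])
      (auto simp: less_Suc_eq le_Suc_eq)
qed

text \<open>Depth and codimension are both squeezed to \<open>d\<close>: a regular sequence of
  length \<open>d\<close> in \<open>P\<close> produces a chain of the same length ending in
  \<open>P\<close>, and no chain is longer than \<open>d\<close>.\<close>

lemma (in cring) cohen_macaulayI:
  assumes "noetherian_ring R"
    and dim: "\<And>c n. \<forall>i\<le>n. primeideal (c i) R \<Longrightarrow> \<forall>i<n. c i \<subset> c (Suc i) \<Longrightarrow> n \<le> d"
    and reg: "\<And>P. maximalideal P R \<Longrightarrow> \<exists>xs. length xs = d \<and> regular_sequence R xs \<and> set xs \<subseteq> P"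
  shows "cohen_macaulay R"
  unfolding cohen_macaulay_def
proof (intro conjI allI impI)
  show "cring R" by (rule is_cring)
  show "noetherian_ring R" by fact
next
  fix P assume P: "maximalideal P R"
  then have pP: "primeideal P R" by (rule maximalideal_prime)
  from reg[OF P] obtain xs where xs: "length xs = d" "regular_sequence R xs" "set xs \<subseteq> P" by blast
  from regular_sequence_chain[OF xs(2,3) pP] xs(1)
  have chain: "\<exists>c. (\<forall>i\<le>d. primeideal (c i) R) \<and> (\<forall>i<d. c i \<subset> c (Suc i)) \<and> c d = P"
    by simp
  have "ideal_depth R P = enat d"
    unfolding ideal_depth_def
  proof (rule antisym)
    show "Sup {enat (length xs) |xs. regular_sequence R xs \<and> set xs \<subseteq> P} \<le> enat d"
    proof (rule Sup_least)
      fix y assume "y \<in> {enat (length xs) |xs. regular_sequence R xs \<and> set xs \<subseteq> P}"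
      then obtain ys where ys: "y = enat (length ys)" "regular_sequence R ys" "set ys \<subseteq> P" by blast
      from regular_sequence_chain[OF ys(2,3) pP] dim show "y \<le> enat d"
        by (metis enat_ord_simps(1) ys(1))
    qed
    show "enat d \<le> Sup {enat (length xs) |xs. regular_sequence R xs \<and> set xs \<subseteq> P}"
      using xs by (intro Sup_upper) blast
  qed
  moreover have "prime_codim R P = enat d"
    unfolding prime_codim_def
  proof (rule antisym)
    show "Sup {enat n |n. \<exists>c. (\<forall>i\<le>n. primeideal (c i) R) \<and> (\<forall>i<n. c i \<subset> c (Suc i)) \<and> c n = P} \<le> enat d"
      using dim by (intro Sup_least) auto
    show "enat d \<le> Sup {enat n |n. \<exists>c. (\<forall>i\<le>n. primeideal (c i) R) \<and> (\<forall>i<n. c i \<subset> c (Suc i)) \<and> c n = P}"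
      using chain by (intro Sup_upper) blast
  qed
  ultimately show "ideal_depth R P = prime_codim R P" by simp
qed

text \<open>Lombardi's elementary characterisation of Krull dimension: a ring has dimension less than
  \<open>n\<close> as soon as, for all \<open>x\<^sub>1, \<dots>, x\<^sub>n\<close>, the following set contains \<open>0\<close>.\<close>

fun lombardi :: "('a, 'b) ring_scheme \<Rightarrow> 'a list \<Rightarrow> 'a set" where
  "lombardi R [] = {\<one>\<^bsub>R\<^esub>}"
| "lombardi R (x # xs) = {x [^]\<^bsub>R\<^esub> (a::nat) \<otimes>\<^bsub>R\<^esub> (u \<oplus>\<^bsub>R\<^esub> x \<otimes>\<^bsub>R\<^esub> g) | a u g. u \<in> lombardi R xs \<and> g \<in> carrier R}"

lemma (in cring) lombardi_closed: "set xs \<subseteq> carrier R \<Longrightarrow> lombardi R xs \<subseteq> carrier R"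
proof (induction xs)
  case (Cons x xs)
  show ?case
  proof
    fix w assume "w \<in> lombardi R (x # xs)"
    then obtain a u g where "w = x [^] (a::nat) \<otimes> (u \<oplus> x \<otimes> g)" "u \<in> lombardi R xs" "g \<in> carrier R"
      by auto
    moreover have "u \<in> carrier R" using Cons calculation(2) by auto
    ultimately show "w \<in> carrier R" using Cons.prems by auto
  qed
qed simp

lemma (in cring) primeideal_pow:
  assumes "primeideal P R" "x \<in> carrier R" "x [^] (n::nat) \<in> P"
  shows "x \<in> P"
  using assms(3)
proof (induction n)
  case 0
  interpret primeideal P R by fact
  show ?case using 0 one_imp_carrier assms(2) by simp
next
  case (Suc n)
  interpret primeideal P R by fact
  show ?case using Suc I_prime[of "x [^] n" x] assms(2) by auto
qed

text \<open>Write u = x^a (v + x g). By induction \<open>v\<close> is outside \<open>p 1\<close>,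
  hence so is v + x g, because \<open>x\<close> lies in \<open>p 1\<close>. Neither this factor nor
  \<open>x\<close> lies in the prime \<open>p 0\<close>, so \<open>u\<close> does not
  either.\<close>

lemma (in cring) lombardi_chain:
  assumes "\<forall>i\<le>length xs. primeideal (p i) R" "\<forall>i<length xs. p i \<subset> p (Suc i)"
    "\<forall>i<length xs. xs ! i \<in> p (Suc i) - p i" "u \<in> lombardi R xs"
  shows "u \<notin> p 0"
  using assms
proof (induction xs arbitrary: p u)
  case Nil
  then interpret primeideal "p 0" R by auto
  show ?case using Nil I_notcarr one_imp_carrier by auto
next
  case (Cons x xs)
  interpret P0: primeideal "p 0" R using Cons.prems(1) by auto
  interpret P1: primeideal "p 1" R using Cons.prems(1) by auto
  have x: "x \<in> p 1" "x \<notin> p 0" using Cons.prems(3) by auto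
  have xc: "x \<in> carrier R" using x(1) P1.Icarr by blast
  have sub: "set xs \<subseteq> carrier R"
  proof
    fix y assume "y \<in> set xs"
    then obtain i where i: "i < length xs" "y = xs ! i" by (auto simp: in_set_conv_nth)
    interpret Pi: primeideal "p (Suc (Suc i))" R using Cons.prems(1) i by auto
    show "y \<in> carrier R" using Cons.prems(3)[rule_format, of "Suc i"] i Pi.Icarr by auto
  qed
  from Cons.prems(4) obtain a v g where u: "u = x [^] (a::nat) \<otimes> (v \<oplus> x \<otimes> g)"
    "v \<in> lombardi R xs" "g \<in> carrier R" by auto
  have vc: "v \<in> carrier R" using u(2) lombardi_closed[OF sub] by blast
  have v: "v \<notin> p 1"
  proof -
    have "\<forall>i\<le>length xs. primeideal (p (Suc i)) R" "\<forall>i<length xs. p (Suc i) \<subset> p (Suc (Suc i))"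
      "\<forall>i<length xs. xs ! i \<in> p (Suc (Suc i)) - p (Suc i)"
      using Cons.prems(1-3) by (auto dest: spec[of _ "Suc _"])
    from Cons.IH[OF this u(2)] show ?thesis by simp
  qed
  show ?case
  proof
    assume "u \<in> p 0"
    then have "x [^] a \<in> p 0 \<or> v \<oplus> x \<otimes> g \<in> p 0" using P0.I_prime u xc vc by auto
    then have "v \<oplus> x \<otimes> g \<in> p 0" using primeideal_pow[OF P0.primeideal_axioms xc] x(2) by blast
    then have *: "v \<oplus> x \<otimes> g \<in> p 1" using Cons.prems(2) by auto
    have xg: "x \<otimes> g \<in> p 1" using x(1) u(3) by (rule P1.I_r_closed)
    have "(v \<oplus> x \<otimes> g) \<ominus> x \<otimes> g \<in> p 1" unfolding a_minus_def
      by (rule P1.a_closed[OF * P1.a_inv_closed[OF xg]])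
    moreover have "(v \<oplus> x \<otimes> g) \<ominus> x \<otimes> g = v" using vc xc u(3) by algebra
    ultimately show False using v by simp
  qed
qed

text \<open>Elements picked from the first \<open>k\<close> gaps of a longer chain would contradict
  \<open>lombardi_chain\<close>. Chains above an ideal \<open>I\<close> stand in for chains in the
  quotient by \<open>I\<close>, so dimension bounds for the coordinate ring can be read in the
  polynomial ring.\<close>

lemma (in cring) chain_length_less:
  assumes lombardi: "\<And>xs. set xs \<subseteq> carrier R \<Longrightarrow> length xs = k \<Longrightarrow> lombardi R xs \<inter> I \<noteq> {}"
    and p: "\<forall>i\<le>n. primeideal (p i) R" "\<forall>i<n. p i \<subset> p (Suc i)" and I: "I \<subseteq> p 0"
  shows "n < k"
proof (rule ccontr)
  assume "\<not> n < k"
  then have k: "k \<le> n" by simp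
  define x where "x i = (SOME x. x \<in> p (Suc i) - p i)" for i
  have x: "x i \<in> p (Suc i) - p i" if "i < k" for i
  proof -
    have "p i \<subset> p (Suc i)" using p(2) k that by simp
    then have "\<exists>y. y \<in> p (Suc i) - p i" by blast
    then show ?thesis unfolding x_def by (rule someI_ex)
  qed
  have "x i \<in> carrier R" if "i < k" for i
  proof -
    interpret primeideal "p (Suc i)" R using p(1) that k by auto
    show ?thesis using x[OF that] Icarr by blast
  qed
  then have "set (map x [0..<k]) \<subseteq> carrier R" by auto
  from lombardi[OF this] obtain u where "u \<in> lombardi R (map x [0..<k])" "u \<in> I" by auto
  with lombardi_chain[of "map x [0..<k]" p u] p k I x show False by auto
qed

section \<open>Preimages of primes and Noetherian quotients\<close>

lemma (in ring_hom_cring) primeideal_vimage: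
  assumes "primeideal Q S"
  shows "primeideal {r \<in> carrier R. h r \<in> Q} R"
proof -
  interpret Q: primeideal Q S by fact
  show ?thesis
  proof (rule primeidealI)
    show "ideal {r \<in> carrier R. h r \<in> Q} R" 
      by (rule ring_hom_ring.ideal_vimage[OF ring_hom_ringI2[OF R.ring_axioms S.ring_axioms homh]
          Q.is_ideal])
    show "cring R" by (rule R.is_cring)
    show "carrier R \<noteq> {r \<in> carrier R. h r \<in> Q}"
    proof
      assume "carrier R = {r \<in> carrier R. h r \<in> Q}"
      then have "h \<one>\<^bsub>R\<^esub> \<in> Q" using R.one_closed by blast
      then show False using Q.I_notcarr Q.one_imp_carrier hom_one by simp
    qed
  next
    fix a b assume "a \<in> carrier R" "b \<in> carrier R" "a \<otimes>\<^bsub>R\<^esub> b \<in> {r \<in> carrier R. h r \<in> Q}"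
    then show "a \<in> {r \<in> carrier R. h r \<in> Q} \<or> b \<in> {r \<in> carrier R. h r \<in> Q}"
      using Q.I_prime[of "h a" "h b"] by auto
  qed
qed

lemma (in noetherian_ring) noetherian_quotient:
  assumes "ideal I R"
  shows "noetherian_ring (R Quot I)"
proof -
  interpret I: ideal I R by fact
  interpret h: ring_hom_ring R "R Quot I" "(+>) I" by (rule I.rcos_ring_hom_ring)
  show ?thesis
  proof (rule h.S.noetherian_ringI)
    fix J assume J: "ideal J (R Quot I)"
    interpret J: ideal J "R Quot I" by (rule J)
    let ?K = "{r \<in> carrier R. I +> r \<in> J}"
    have "ideal ?K R" by (rule h.ideal_vimage[OF J])
    then obtain A where A: "A \<subseteq> carrier R" "finite A" "?K = Idl A" using finetely_gen by blast
    have AK: "A \<subseteq> ?K" using A genideal_self by blast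
    have sub: "(+>) I ` A \<subseteq> carrier (R Quot I)" using A h.hom_closed by blast
    have "J = Idl\<^bsub>R Quot I\<^esub> ((+>) I ` A)"
    proof
      show "Idl\<^bsub>R Quot I\<^esub> ((+>) I ` A) \<subseteq> J" using AK by (intro h.S.genideal_minimal J) blast
      have "ideal {r \<in> carrier R. I +> r \<in> Idl\<^bsub>R Quot I\<^esub> ((+>) I ` A)} R"
        by (intro h.ideal_vimage h.S.genideal_ideal sub)
      moreover have "A \<subseteq> {r \<in> carrier R. I +> r \<in> Idl\<^bsub>R Quot I\<^esub> ((+>) I ` A)}"
        using A(1) h.S.genideal_self[OF sub] by blast
      ultimately have *: "?K \<subseteq> {r \<in> carrier R. I +> r \<in> Idl\<^bsub>R Quot I\<^esub> ((+>) I ` A)}"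
        unfolding A(3) by (rule genideal_minimal)
      show "J \<subseteq> Idl\<^bsub>R Quot I\<^esub> ((+>) I ` A)"
      proof
        fix j assume j: "j \<in> J"
        then have "j \<in> carrier (R Quot I)" by (rule J.Icarr)
        then obtain r where "r \<in> carrier R" "j = I +> r"
          unfolding FactRing_def A_RCOSETS_def'[of R I] by auto
        then show "j \<in> Idl\<^bsub>R Quot I\<^esub> ((+>) I ` A)" using * j by blast
      qed
    qed
    then show "\<exists>A\<subseteq>carrier (R Quot I). finite A \<and> J = Idl\<^bsub>R Quot I\<^esub> A"
      using sub A(2) by blast
  qed
qed

section \<open>Linear algebra and the polynomial ring\<close>

text \<open>Elimination of one equation \<open>b\<close> at a time: an unknown \<open>z\<close> with
  nonzero coefficient in it is expressed by the others, \<open>?M\<close> holds the coefficients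
  that remain, and \<open>?c\<close> restores the value at \<open>z\<close>.\<close>

lemma underdetermined_system:
  fixes M :: "'a \<Rightarrow> 'b \<Rightarrow> 'k::field"
  assumes "finite B" "finite A" "card B < card A"
  shows "\<exists>c. (\<exists>a\<in>A. c a \<noteq> 0) \<and> (\<forall>b\<in>B. (\<Sum>a\<in>A. c a * M a b) = 0)"
  using assms
proof (induction B arbitrary: A M rule: finite_induct)
  case empty
  then have "A \<noteq> {}" by auto
  then show ?case by (intro exI[of _ "\<lambda>_. 1"]) auto
next
  case (insert b B)
  show ?case
  proof (cases "\<forall>a\<in>A. M a b = 0")
    case True
    have "card B < card A" using insert by simp
    from insert.IH[OF insert.prems(1) this, of M] True show ?thesis by auto
  next
    case False
    then obtain z where z: "z \<in> A" "M z b \<noteq> 0" by blast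
    let ?M = "\<lambda>a k. M a k - M a b / M z b * M z k"
    have "card B < card (A - {z})" using insert z by simp
    from insert.IH[OF _ this, of ?M] insert.prems obtain c where
      c: "\<exists>a\<in>A - {z}. c a \<noteq> 0" "\<forall>k\<in>B. (\<Sum>a\<in>A - {z}. c a * ?M a k) = 0" by auto
    let ?c = "c(z := - (\<Sum>a\<in>A - {z}. c a * (M a b / M z b)))"
    have split: "(\<Sum>a\<in>A. ?c a * M a k) = (\<Sum>a\<in>A - {z}. c a * ?M a k)" for k
    proof -
      have "(\<Sum>a\<in>A. ?c a * M a k) = ?c z * M z k + (\<Sum>a\<in>A - {z}. ?c a * M a k)"
        by (rule sum.remove[OF insert.prems(1) z(1)])
      also have "(\<Sum>a\<in>A - {z}. ?c a * M a k) = (\<Sum>a\<in>A - {z}. c a * M a k)"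
        by (rule sum.cong) auto
      finally have "(\<Sum>a\<in>A. ?c a * M a k) = (\<Sum>a\<in>A - {z}. c a * M a k) -
          (\<Sum>a\<in>A - {z}. c a * (M a b / M z b)) * M z k" by simp
      also have "\<dots> = (\<Sum>a\<in>A - {z}. c a * ?M a k)"
        unfolding sum_distrib_right sum_subtractf[symmetric] by (simp add: right_diff_distrib mult.assoc)
      finally show ?thesis .
    qed
    have "(\<Sum>a\<in>A. ?c a * M a b) = 0" unfolding split using z by simp
    then have "\<forall>k\<in>insert b B. (\<Sum>a\<in>A. ?c a * M a k) = 0"
      using c(2) unfolding split by auto
    moreover have "\<exists>a\<in>A. ?c a \<noteq> 0" using c(1) by auto
    ultimately show ?thesis by blast
  qed
qed

section \<open>Variables, evaluation and ideals of polynomial rings\<close>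

lemma vars_zero [simp]: "vars 0 = {}" by (simp add: vars_def)
lemma vars_one [simp]: "vars 1 = {}" by (simp add: vars_def)
lemma vars_single: "vars (Poly_Mapping.single e c) \<subseteq> Poly_Mapping.keys e"
  by (auto simp: vars_def split: if_splits)
lemma vars_Const [simp]: "vars (Const c) = {}" using vars_single[of 0 c] by (simp add: Const_def)
lemma vars_Var [simp]: "vars (Var i) = {i}" by (simp add: vars_def Var_def)
lemma vars_add: "vars (f + g) \<subseteq> vars f \<union> vars g"
  using keys_add[of f g] by (fastforce simp: vars_def)
lemma vars_uminus [simp]: "vars (- f) = vars f" by (simp add: vars_def)
lemma vars_diff: "vars (f - g) \<subseteq> vars f \<union> vars g"
  using vars_add[of f "- g"] by simp
lemma vars_sum: "(\<And>x. x \<in> A \<Longrightarrow> vars (f x) \<subseteq> J) \<Longrightarrow> vars (sum f A) \<subseteq> J"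
proof (induction A rule: infinite_finite_induct)
  case (insert x F)
  then show ?case using vars_add[of "f x" "sum f F"] by auto
qed auto
lemma vars_power: "vars (f ^ n) \<subseteq> vars f"
proof (induction n)
  case (Suc n)
  then show ?case using vars_mult[of f "f ^ n"] by auto
qed auto
lemma vars_prod_list: "(\<And>x. x \<in> set xs \<Longrightarrow> vars x \<subseteq> J) \<Longrightarrow> vars (prod_list xs) \<subseteq> J"
proof (induction xs)
  case (Cons x xs)
  then show ?case using vars_mult[of x "prod_list xs"] by auto
qed auto
lemma vars_prod: "(\<And>x. x \<in> A \<Longrightarrow> vars (f x) \<subseteq> J) \<Longrightarrow> vars (prod f A) \<subseteq> J"
proof (induction A rule: infinite_finite_induct)
  case (insert x F)
  then show ?case using vars_mult[of "f x" "prod f F"] by auto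
qed auto

lemma Const_0 [simp]: "Const 0 = 0" by (simp add: Const_def)
lemma Const_1 [simp]: "Const 1 = 1" by (simp add: Const_def)
lemma Const_add: "Const (a + b) = Const a + Const b" by (simp add: Const_def single_add)
lemma Const_uminus: "Const (- a) = - Const a" by (simp add: Const_def single_uminus)
lemma Const_mult: "Const (a * b) = Const a * Const b" by (simp add: Const_def mult_single)
lemma peval_Const [simp]: "peval v (Const c) = c" by (simp add: Const_def peval_single)
lemma peval_Var [simp]: "peval v (Var i) = v i" by (simp add: Var_def peval_single)
lemma peval_uminus: "peval v (- f) = - peval v f"
  using peval_add[of v f "- f"] by (simp add: add_eq_0_iff)
lemma peval_diff: "peval v (f - g) = peval v f - peval v g"
  using peval_add[of v f "- g"] by (simp add: peval_uminus)
lemma peval_sum: "peval v (sum f A) = (\<Sum>x\<in>A. peval v (f x))"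
  by (induction A rule: infinite_finite_induct) (auto simp: peval_add)
lemma peval_prod: "peval v (prod f A) = (\<Prod>x\<in>A. peval v (f x))"
  by (induction A rule: infinite_finite_induct) (auto simp: peval_mult)
lemma peval_power: "peval v (f ^ n) = peval v f ^ n"
  by (induction n) (auto simp: peval_mult)
lemma poly_ring_simps [simp]:
  "carrier (poly_ring J) = {f. vars f \<subseteq> J}" "mult (poly_ring J) = (*)"
  "add (poly_ring J) = (+)" "one (poly_ring J) = 1" "zero (poly_ring J) = 0"
  by (simp_all add: poly_ring_def)

lemma cring_poly_ring: "cring (poly_ring J)"
proof (rule cringI)
  have add: "vars (f + g) \<subseteq> J" if "vars f \<subseteq> J" "vars g \<subseteq> J" for f g :: "'a cpoly"
    using vars_add[of f g] that by blast
  have mult: "vars (f * g) \<subseteq> J" if "vars f \<subseteq> J" "vars g \<subseteq> J" for f g :: "'a cpoly"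
    using vars_mult[of f g] that by blast
  show "abelian_group (poly_ring J)"
  proof (rule abelian_groupI)
    fix x assume "x \<in> carrier (poly_ring J)"
    then show "\<exists>y\<in>carrier (poly_ring J). y \<oplus>\<^bsub>poly_ring J\<^esub> x = \<zero>\<^bsub>poly_ring J\<^esub>"
      by (intro bexI[of _ "- x"]) auto
  qed (simp_all add: add algebra_simps)
  show "Group.comm_monoid (poly_ring J)"
    by (rule comm_monoidI) (simp_all add: mult algebra_simps)
qed (simp add: distrib_right)

interpretation PR: cring "poly_ring J" for J by (rule cring_poly_ring)

lemma poly_ring_pow [simp]: "f [^]\<^bsub>poly_ring J\<^esub> (n::nat) = f ^ n"
  by (induction n) (simp_all add: mult.commute nat_pow_def)

lemma poly_ring_uminus: "vars f \<subseteq> J \<Longrightarrow> \<ominus>\<^bsub>poly_ring J\<^esub> f = - f"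
  by (rule PR.minus_equality) auto

lemma poly_ideal:
  assumes "ideal I (poly_ring J)"
  shows "0 \<in> I" and "f \<in> I \<Longrightarrow> vars f \<subseteq> J"
    and "f \<in> I \<Longrightarrow> g \<in> I \<Longrightarrow> f + g \<in> I"
    and "f \<in> I \<Longrightarrow> vars g \<subseteq> J \<Longrightarrow> g * f \<in> I"
    and "f \<in> I \<Longrightarrow> - f \<in> I"
    and "f \<in> I \<Longrightarrow> g \<in> I \<Longrightarrow> f - g \<in> I"
proof -
  interpret ideal I "poly_ring J" by fact
  show "0 \<in> I" using zero_closed by simp
  show c: "vars f \<subseteq> J" if "f \<in> I" for f using Icarr[OF that] by simp
  show "f + g \<in> I" if "f \<in> I" "g \<in> I" for f g using a_closed[OF that] by simp
  show "g * f \<in> I" if "f \<in> I" "vars g \<subseteq> J" for f g using I_l_closed[OF that(1), of g] that by simp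
  show m: "- f \<in> I" if "f \<in> I" for f
    using a_inv_closed[OF that] c[OF that] poly_ring_uminus by metis
  show "f - g \<in> I" if "f \<in> I" "g \<in> I" for f g using a_closed[OF that(1) m[OF that(2)]] by simp
qed

lemma poly_ideal_sum:
  assumes "ideal I (poly_ring J)" "\<And>x. x \<in> A \<Longrightarrow> f x \<in> I"
  shows "sum f A \<in> I"
  using assms(2) by (induction A rule: infinite_finite_induct) (auto intro: poly_ideal[OF assms(1)])

lemma poly_idealI:
  assumes "\<And>f. f \<in> I \<Longrightarrow> vars f \<subseteq> J" "0 \<in> I"
    "\<And>f g. f \<in> I \<Longrightarrow> g \<in> I \<Longrightarrow> f + g \<in> I" "\<And>f g. f \<in> I \<Longrightarrow> vars g \<subseteq> J \<Longrightarrow> g * f \<in> I"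
  shows "ideal I (poly_ring J)"
proof (rule idealI)
  show "ring (poly_ring J)" by (rule PR.ring_axioms)
  show "subgroup I (add_monoid (poly_ring J))"
  proof (rule subgroup.intro)
    fix x assume x: "x \<in> I"
    have "inv\<^bsub>add_monoid (poly_ring J)\<^esub> x = - x"
      using poly_ring_uminus[of x J] assms(1)[OF x] by (simp add: a_inv_def)
    then show "inv\<^bsub>add_monoid (poly_ring J)\<^esub> x \<in> I" using assms(4)[OF x, of "- 1"] by simp
  qed (use assms in auto)
qed (use assms in \<open>auto simp: mult.commute\<close>)

text \<open>A monotone subsequence exists. If it is not nondecreasing it is nonincreasing, and then
  it is constant from the place \<open>N\<close> of its least value on.\<close>

lemma nat_mono_subseq:
  fixes s :: "nat \<Rightarrow> nat"
  shows "\<exists>r::nat \<Rightarrow> nat. strict_mono r \<and> mono (\<lambda>n. s (r n))"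
proof -
  obtain f where f: "strict_mono f" "monoseq (\<lambda>n. s (f n))" using seq_monosub[of s] by blast
  show ?thesis
  proof (cases "mono (\<lambda>n. s (f n))")
    case False
    then have dec: "s (f n) \<le> s (f k)" if "k \<le> n" for k n
      using f(2) that by (auto simp: monoseq_def mono_def)
    obtain N where N: "\<And>n. s (f N) \<le> s (f n)"
      using ex_has_least_nat[of "\<lambda>_. True" 0 "\<lambda>n. s (f n)"] by auto
    have c: "s (f (N + n)) = s (f N)" for n using N dec[of N "N + n"] by (simp add: antisym)
    have "strict_mono (\<lambda>n. f (N + n))" using f(1) by (simp add: strict_mono_def)
    then show ?thesis using c by (intro exI[of _ "\<lambda>n. f (N + n)"]) (auto simp: mono_def)
  qed (use f in blast)
qed

text \<open>Dickson's lemma in sequence form: the subsequence is refined once for each variable,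
  which keeps the coordinates already treated monotone. It will supply two leading monomials of
  which one divides the other.\<close>

lemma dickson:
  fixes e :: "nat \<Rightarrow> 'i \<Rightarrow> nat"
  assumes "finite J"
  shows "\<exists>r::nat \<Rightarrow> nat. strict_mono r \<and> (\<forall>i\<in>J. mono (\<lambda>n. e (r n) i))"
  using assms
proof (induction J)
  case empty
  show ?case by (intro exI[of _ id]) (auto simp: strict_mono_def)
next
  case (insert j J)
  then obtain r :: "nat \<Rightarrow> nat" where r: "strict_mono r" "\<forall>i\<in>J. mono (\<lambda>n. e (r n) i)" by blast
  obtain q :: "nat \<Rightarrow> nat" where q: "strict_mono q" "mono (\<lambda>n. e (r (q n)) j)"
    using nat_mono_subseq[of "\<lambda>n. e (r n) j"] by blast
  have "strict_mono (\<lambda>n. r (q n))" using r q by (simp add: strict_mono_def)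
  moreover have "mono (\<lambda>n. e (r (q n)) i)" if "i \<in> J" for i
    using r(2) that strict_mono_mono[OF q(1)] by (auto simp: mono_def)
  ultimately show ?case using q(2) by (intro exI[of _ "\<lambda>n. r (q n)"]) auto
qed

lemma inj_into_primes:
  assumes "finite J"
  shows "\<exists>p :: 'i \<Rightarrow> nat. inj_on p J \<and> (\<forall>i\<in>J. prime (p i))"
proof -
  obtain B where B: "finite B" "card B = card J" "B \<subseteq> {p::nat. prime p}"
    using infinite_arbitrarily_large[OF primes_infinite] by blast
  obtain p where "bij_betw p J B" using finite_same_card_bij[OF assms B(1)] B(2) by metis
  then show ?thesis using B(3) by (intro exI[of _ p]) (auto simp: bij_betw_def)
qed

lemma lookup_single_mult_add:
  "Poly_Mapping.lookup (Poly_Mapping.single a c * f) (a + k) = c * Poly_Mapping.lookup f k"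
  for f :: "'i cpoly"
proof (induction f rule: cpoly_induct)
  case (add e d g)
  then show ?case
    by (simp add: distrib_left lookup_add mult_single lookup_single when_def)
qed simp

text \<open>Sending the variables to distinct primes embeds the monomials into the positive integers;
  this gives a multiplicative well-order of the monomials.\<close>

lemma noetherian_poly_ring:
  fixes J :: "'i set"
  assumes J: "finite J"
  shows "noetherian_ring (poly_ring J)"
proof (rule PR.noetherian_ringI, rule ccontr)
  fix I assume I: "ideal I (poly_ring J)"
  assume nfg: "\<nexists>A. A \<subseteq> carrier (poly_ring J) \<and> finite A \<and> I = genideal (poly_ring J) A"
  obtain p :: "'i \<Rightarrow> nat" where p: "inj_on p J" "\<And>i. i \<in> J \<Longrightarrow> prime (p i)"
    using inj_into_primes[OF J] by blast
  define N where "N e = (\<Prod>i\<in>J. p i ^ Poly_Mapping.lookup e i)" for e :: "'i \<Rightarrow>\<^sub>0 nat"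
  have N_add: "N (a + b) = N a * N b" for a b
    by (simp add: N_def lookup_add power_add prod.distrib)
  have N_pos: "N a > 0" for a
    unfolding N_def using p(2) by (intro prod_pos) (auto simp: prime_gt_0_nat)
  have N_inj: "a = b" if "N a = N b" "Poly_Mapping.keys a \<subseteq> J" "Poly_Mapping.keys b \<subseteq> J" for a b
  proof (rule poly_mapping_eqI)
    fix i
    have mult: "multiplicity (p i) (N e) = Poly_Mapping.lookup e i" if "i \<in> J" for e
    proof -
      have "N e = (\<Prod>q\<in>p ` J. q ^ Poly_Mapping.lookup e (the_inv_into J p q))"
        unfolding N_def using p(1) by (subst prod.reindex) (auto simp: the_inv_into_f_f)
      moreover have "multiplicity (p i) \<dots> = Poly_Mapping.lookup e (the_inv_into J p (p i))"
        using that p J by (subst multiplicity_prod_prime_powers) auto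
      ultimately show ?thesis using that p(1) by (simp add: the_inv_into_f_f)
    qed
    show "Poly_Mapping.lookup a i = Poly_Mapping.lookup b i"
    proof (cases "i \<in> J")
      case True
      then show ?thesis using mult[of a] mult[of b] that(1) by simp
    next
      case False
      then show ?thesis using that(2,3) by (metis in_keys_iff subsetD)
    qed
  qed
  \<comment> \<open>The code of the leading monomial. \<open>Max\<close> of the empty set is
    unspecified, so \<open>L 0\<close> carries no information; 0 lies in every ideal and therefore
    never satisfies \<open>good\<close>.\<close>
  define L where "L f = Max (N ` Poly_Mapping.keys f)" for f :: "'i cpoly"
  define good where "good S f \<longleftrightarrow> f \<in> I - genideal (poly_ring J) S \<and>
    (\<forall>g\<in>I - genideal (poly_ring J) S. L f \<le> L g)" for S f
  define pick where "pick S = (SOME f. good S f)" for S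
  \<comment> \<open>As \<open>I\<close> is not finitely generated, an element outside the ideal
    generated so far can always be added; the one taken has the least possible leading code.\<close>
  define F where "F = rec_nat [] (\<lambda>_ S. pick (set S) # S)"
  have F_simps: "F 0 = []" "F (Suc n) = pick (set (F n)) # F n" for n by (simp_all add: F_def)
  have good: "good S (pick S)" if "finite S" "S \<subseteq> I" for S
  proof -
    have SC: "S \<subseteq> carrier (poly_ring J)" using that poly_ideal(2)[OF I] by auto
    have "genideal (poly_ring J) S \<subseteq> I" using that I by (intro PR.genideal_minimal)
    moreover have "I \<noteq> genideal (poly_ring J) S" using nfg that SC by blast
    ultimately have "\<exists>f. f \<in> I - genideal (poly_ring J) S" by blast
    then obtain f where "f \<in> I - genideal (poly_ring J) S \<and>
      (\<forall>g. g \<in> I - genideal (poly_ring J) S \<longrightarrow> L f \<le> L g)"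
      using ex_has_least_nat[of "\<lambda>f. f \<in> I - genideal (poly_ring J) S" _ L] by blast
    then have "good S f" by (auto simp: good_def)
    then show ?thesis unfolding pick_def by (rule someI)
  qed
  have FI: "set (F n) \<subseteq> I" for n
  proof (induction n)
    case (Suc n)
    have "pick (set (F n)) \<in> I" using good[of "set (F n)"] Suc by (simp add: good_def)
    then show ?case using Suc by (simp add: F_simps)
  qed (simp add: F_simps)
  define f where "f n = pick (set (F n))" for n
  have f: "good (set (F n)) (f n)" for n unfolding f_def using FI by (intro good) auto
  have fF: "f i \<in> set (F n)" if "i < n" for i n
    using that by (induction n) (auto simp: F_simps f_def less_Suc_eq)
  have f0: "f n \<noteq> 0" for n
  proof
    assume "f n = 0"
    moreover have "ideal (genideal (poly_ring J) (set (F n))) (poly_ring J)"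
      using FI[of n] poly_ideal(2)[OF I] by (intro PR.genideal_ideal) auto
    ultimately show False using f[of n] poly_ideal(1) by (auto simp: good_def)
  qed
  have "\<exists>e\<in>Poly_Mapping.keys (f n). N e = L (f n)" for n
  proof -
    have "L (f n) \<in> N ` Poly_Mapping.keys (f n)" unfolding L_def
      using f0[of n] by (intro Max_in) auto
    then show ?thesis by auto
  qed
  then obtain e where e: "\<And>n. e n \<in> Poly_Mapping.keys (f n)" "\<And>n. N (e n) = L (f n)" by metis
  obtain r :: "nat \<Rightarrow> nat" where r: "strict_mono r" "\<forall>i\<in>J. mono (\<lambda>n. Poly_Mapping.lookup (e (r n)) i)"
    using dickson[OF J, of "\<lambda>n. Poly_Mapping.lookup (e n)"] by blast
  define i j where "i = r 0" and "j = r (Suc 0)"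
  have ij: "i < j" unfolding i_def j_def using r(1) by (simp add: strict_mono_def)
  have vf: "vars (f n) \<subseteq> J" for n using f[of n] poly_ideal(2)[OF I] by (auto simp: good_def)
  have keJ: "Poly_Mapping.keys k \<subseteq> J" if "k \<in> Poly_Mapping.keys (f n)" for k n
    using vf[of n] that by (auto simp: vars_def)
  have le: "Poly_Mapping.lookup (e i) k \<le> Poly_Mapping.lookup (e j) k" for k
  proof (cases "k \<in> J")
    case True
    then show ?thesis using r(2) unfolding i_def j_def by (auto simp: mono_def)
  next
    case False
    then show ?thesis using keJ[OF e(1)[of i]] by (metis in_keys_iff le0 subsetD)
  qed
  define a where "a = e j - e i"
  have a: "e j = a + e i" unfolding a_def
    using le by (intro poly_mapping_eqI) (simp add: lookup_add lookup_minus)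
  have aJ: "Poly_Mapping.keys a \<subseteq> J"
  proof
    fix k assume "k \<in> Poly_Mapping.keys a"
    then have "k \<in> Poly_Mapping.keys (e j)" unfolding a by (simp add: in_keys_iff lookup_add)
    then show "k \<in> J" using keJ[OF e(1)[of j]] by blast
  qed
  \<comment> \<open>The coefficient \<open>c\<close> on the monomial \<open>a\<close> makes the
    leading term of \<open>f i\<close> match that of \<open>f j\<close>. The difference
    \<open>g\<close> is still outside the ideal generated before \<open>f j\<close>, but its leading
    code is smaller, against the choice of \<open>f j\<close>.\<close>
  define c where "c = Poly_Mapping.lookup (f j) (e j) / Poly_Mapping.lookup (f i) (e i)"
  define x where "x = Poly_Mapping.single a c"
  define g where "g = f j - x * f i"
  have vx: "vars x \<subseteq> J" using vars_single[of a c] aJ by (auto simp: x_def)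
  let ?G = "genideal (poly_ring J) (set (F j))"
  have GI: "ideal ?G (poly_ring J)" using FI[of j] poly_ideal(2)[OF I] by (intro PR.genideal_ideal) auto
  have fiG: "f i \<in> ?G"
    using PR.genideal_self[of "set (F j)" J] FI[of j] poly_ideal(2)[OF I] fF[OF ij] by auto
  have fj: "f j \<in> I" "f j \<notin> ?G" using f[of j] by (auto simp: good_def)
  have gI: "g \<in> I" unfolding g_def
    using fj f[of i] vx by (intro poly_ideal(6)[OF I] poly_ideal(4)[OF I]) (auto simp: good_def)
  have gG: "g \<notin> ?G"
  proof
    assume "g \<in> ?G"
    then have "g + x * f i \<in> ?G" by (intro poly_ideal(3)[OF GI] poly_ideal(4)[OF GI] fiG vx)
    then show False using fj by (simp add: g_def)
  qed
  have "L (f j) \<le> L g" using f[of j] gI gG by (auto simp: good_def)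
  moreover have "L g < L (f j)"
  proof -
    have "g \<noteq> 0" using gG poly_ideal(1)[OF GI] by auto
    then have ne: "N ` Poly_Mapping.keys g \<noteq> {}" by simp
    have look: "Poly_Mapping.lookup (x * f i) (a + k) = c * Poly_Mapping.lookup (f i) k" for k
      unfolding x_def by (simp add: lookup_single_mult_add)
    have "N k < L (f j)" if k: "k \<in> Poly_Mapping.keys g" for k
    proof -
      have "k \<in> Poly_Mapping.keys (f j) \<or> k \<in> Poly_Mapping.keys (x * f i)"
        using k keys_diff[of "f j" "x * f i"] unfolding g_def by blast
      then have kN: "N k \<le> L (f j) \<and> Poly_Mapping.keys k \<subseteq> J"
      proof
        assume "k \<in> Poly_Mapping.keys (f j)"
        then show ?thesis using keJ by (auto simp: L_def)
      next
        assume kx: "k \<in> Poly_Mapping.keys (x * f i)"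
        then obtain l where l: "l \<in> Poly_Mapping.keys (f i)" "k = a + l"
          using keys_mult[of x "f i"] unfolding x_def by (auto split: if_splits)
        have "N l \<le> N (e i)" using l(1) e(2)[of i] by (simp add: L_def)
        then have "N k \<le> N a * N (e i)" by (simp add: l N_add)
        also have "\<dots> = L (f j)" using e(2)[of j] by (simp add: a N_add)
        finally have "N k \<le> L (f j)" .
        moreover have "Poly_Mapping.keys k \<subseteq> J"
          using keys_add[of a l] aJ keJ[OF l(1)] by (auto simp: l)
        ultimately show ?thesis by simp
      qed
      moreover have "N k \<noteq> L (f j)"
      proof
        assume "N k = L (f j)"
        then have "k = e j" using kN e(2)[of j] keJ[OF e(1)[of j]] N_inj by metis
        then have "Poly_Mapping.lookup g k = 0"
          using e(1)[of i] by (simp add: g_def lookup_minus a[symmetric])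
            (simp add: a look c_def in_keys_iff)
        then show False using k by (simp add: in_keys_iff)
      qed
      ultimately show ?thesis by simp
    qed
    then show ?thesis unfolding L_def[of g] using ne by (subst Max_less_iff) auto
  qed
  ultimately show False by simp
qed

section \<open>Polynomial growth\<close>

definition deg_le :: "nat \<Rightarrow> 'i cpoly \<Rightarrow> bool" where
  "deg_le d f \<longleftrightarrow> (\<forall>e\<in>Poly_Mapping.keys f. (\<Sum>i\<in>Poly_Mapping.keys e. Poly_Mapping.lookup e i) \<le> d)"

lemma exponent_sum_add:
  fixes a b :: "'i \<Rightarrow>\<^sub>0 nat"
  shows "(\<Sum>i\<in>Poly_Mapping.keys (a + b). Poly_Mapping.lookup (a + b) i) =
    (\<Sum>i\<in>Poly_Mapping.keys a. Poly_Mapping.lookup a i) + (\<Sum>i\<in>Poly_Mapping.keys b. Poly_Mapping.lookup b i)"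
proof -
  let ?A = "Poly_Mapping.keys a \<union> Poly_Mapping.keys b"
  have deg: "(\<Sum>i \<in> Poly_Mapping.keys c. Poly_Mapping.lookup c i) =
      (\<Sum>i \<in> ?A. Poly_Mapping.lookup c i)" if "Poly_Mapping.keys c \<subseteq> ?A" for c :: "'i \<Rightarrow>\<^sub>0 nat"
    by (rule sum.mono_neutral_left) (use that in \<open>auto simp: in_keys_iff\<close>)
  show ?thesis
    using deg[OF keys_add[of a b]] deg[of a] deg[of b] by (simp add: lookup_add sum.distrib)
qed

lemma deg_le_mono: "deg_le d f \<Longrightarrow> d \<le> d' \<Longrightarrow> deg_le d' f" by (force simp: deg_le_def)
lemma deg_le_add: "deg_le d f \<Longrightarrow> deg_le d g \<Longrightarrow> deg_le d (f + g)"
  using keys_add[of f g] by (auto simp: deg_le_def)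
lemma deg_le_Const [simp]: "deg_le d (Const c)" by (auto simp: deg_le_def Const_def split: if_splits)
lemma deg_le_0 [simp]: "deg_le d 0" by (simp add: deg_le_def)
lemma deg_le_1 [simp]: "deg_le d 1" using deg_le_Const[of d 1] by simp
lemma deg_le_mult: "deg_le d f \<Longrightarrow> deg_le d' g \<Longrightarrow> deg_le (d + d') (f * g)"
  unfolding deg_le_def
proof
  fix e assume *: "\<forall>e\<in>Poly_Mapping.keys f. (\<Sum>i\<in>Poly_Mapping.keys e. Poly_Mapping.lookup e i) \<le> d"
    "\<forall>e\<in>Poly_Mapping.keys g. (\<Sum>i\<in>Poly_Mapping.keys e. Poly_Mapping.lookup e i) \<le> d'"
    "e \<in> Poly_Mapping.keys (f * g)"
  then obtain a b where "a \<in> Poly_Mapping.keys f" "b \<in> Poly_Mapping.keys g" "e = a + b"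
    using keys_mult[of f g] by auto
  with * show "(\<Sum>i\<in>Poly_Mapping.keys e. Poly_Mapping.lookup e i) \<le> d + d'"
    by (auto simp: exponent_sum_add intro!: add_mono)
qed
lemma deg_le_power: "deg_le d f \<Longrightarrow> deg_le (n * d) (f ^ n)"
  by (induction n) (auto intro: deg_le_mult)
lemma deg_le_ex: "\<exists>d. deg_le d f"
proof -
  have "finite ((\<lambda>e. \<Sum>i\<in>Poly_Mapping.keys e. Poly_Mapping.lookup e i) ` Poly_Mapping.keys f)" by simp
  then show ?thesis unfolding deg_le_def
    by (intro exI[of _ "Max ((\<lambda>e. \<Sum>i\<in>Poly_Mapping.keys e. Poly_Mapping.lookup e i) ` Poly_Mapping.keys f)"]) auto
qed

text \<open>A definition cannot quantify over types, so families are indexed by complex lists here;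
  \<open>growth_boundD\<close> passes to other index types.\<close>

definition growth_bound :: "'i set \<Rightarrow> 'i cpoly set \<Rightarrow> nat \<Rightarrow> bool" where
  "growth_bound J I K \<longleftrightarrow> (\<forall>d A. \<forall>f :: complex list \<Rightarrow> 'i cpoly. finite A \<longrightarrow>
     (\<forall>a\<in>A. vars (f a) \<subseteq> J \<and> deg_le d (f a)) \<longrightarrow> card A > K * (d + 1) ^ 3 \<longrightarrow>
     (\<exists>c. (\<exists>a\<in>A. c a \<noteq> 0) \<and> (\<Sum>a\<in>A. Const (c a) * f a) \<in> I))"

lemma growth_boundD:
  fixes f :: "'a \<Rightarrow> 'i cpoly" and h :: "'a \<Rightarrow> complex list"
  assumes K: "growth_bound J I K"
    and A: "finite A" "inj_on h A" "\<And>a. a \<in> A \<Longrightarrow> vars (f a) \<subseteq> J \<and> deg_le d (f a)"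
      "card A > K * (d + 1) ^ 3"
  shows "\<exists>c. (\<exists>a\<in>A. c a \<noteq> 0) \<and> (\<Sum>a\<in>A. Const (c a) * f a) \<in> I"
proof -
  have "\<exists>c. (\<exists>a\<in>h ` A. c a \<noteq> 0) \<and> (\<Sum>a\<in>h ` A. Const (c a) * f (the_inv_into A h a)) \<in> I"
  proof (rule K[unfolded growth_bound_def, rule_format, where d = d])
    show "\<And>a. a \<in> h ` A \<Longrightarrow> vars (f (the_inv_into A h a)) \<subseteq> J \<and> deg_le d (f (the_inv_into A h a))"
      using A(2,3) the_inv_into_f_f by fastforce
  qed (use A in \<open>auto simp: card_image\<close>)
  then obtain c where c: "\<exists>a\<in>h ` A. c a \<noteq> 0" "(\<Sum>a\<in>h ` A. Const (c a) * f (the_inv_into A h a)) \<in> I"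
    by blast
  have "(\<Sum>a\<in>h ` A. Const (c a) * f (the_inv_into A h a)) = (\<Sum>a\<in>A. Const (c (h a)) * f a)"
    using A(2) by (simp add: sum.reindex the_inv_into_f_f)
  with c show ?thesis by (intro exI[of _ "\<lambda>a. c (h a)"]) auto
qed

lemma growth_bound_mono:
  assumes "growth_bound J I K" "I \<subseteq> I'"
  shows "growth_bound J I' K"
  unfolding growth_bound_def
proof (intro allI impI)
  fix d A and f :: "complex list \<Rightarrow> 'a cpoly"
  assume "finite A" "\<forall>a\<in>A. vars (f a) \<subseteq> J \<and> deg_le d (f a)" "card A > K * (d + 1) ^ 3"
  then have "\<exists>c. (\<exists>a\<in>A. c a \<noteq> 0) \<and> (\<Sum>a\<in>A. Const (c a) * f a) \<in> I"
    by (intro assms(1)[unfolded growth_bound_def, rule_format]) auto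
  then show "\<exists>c. (\<exists>a\<in>A. c a \<noteq> 0) \<and> (\<Sum>a\<in>A. Const (c a) * f a) \<in> I'"
    using assms(2) by blast
qed

definition monl :: "'i cpoly list \<Rightarrow> nat list \<Rightarrow> 'i cpoly" where
  "monl xs l = prod_list (map2 (^) xs l)"

lemma monl_Nil [simp]: "monl [] l = 1" by (simp add: monl_def)
lemma monl_Cons [simp]: "monl (x # xs) (n # l) = x ^ n * monl xs l" by (simp add: monl_def)

lemma monl_bounds:
  assumes "\<And>x. x \<in> set xs \<Longrightarrow> vars x \<subseteq> J \<and> deg_le K x" "length l = length xs" "set l \<subseteq> {..D}"
  shows "vars (monl xs l) \<subseteq> J \<and> deg_le (length xs * (D * K)) (monl xs l)"
  using assms(2,1,3)
proof (induction l xs rule: list_induct2)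
  case (Cons n l x xs)
  then have IH: "vars (monl xs l) \<subseteq> J" "deg_le (length xs * (D * K)) (monl xs l)" by auto
  have x: "vars x \<subseteq> J" "deg_le K x" using Cons.prems by auto
  have "deg_le (D * K) (x ^ n)" using deg_le_mono[OF deg_le_power[OF x(2), of n], of "D * K"] Cons.prems by auto
  then have "deg_le (D * K + length xs * (D * K)) (x ^ n * monl xs l)" using IH by (intro deg_le_mult)
  moreover have "vars (x ^ n * monl xs l) \<subseteq> J"
    using vars_mult[of "x ^ n" "monl xs l"] vars_power[of x n] x IH by blast
  ultimately show ?case by simp
qed simp

text \<open>The least power x^a is split off. The terms with exactly this exponent give, by
  induction, an element of the set for \<open>xs\<close>; all others are divisible by x^(a+1) and
  form x^a (x g). The constant \<open>k\<close> normalises the coefficient of the lexicographically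
  least exponent, because the recursion ends in \<open>{1}\<close>.\<close>

lemma lombardi_of_dependence:
  assumes "set xs \<subseteq> carrier (poly_ring J)" "finite A" "A \<noteq> {}" "\<And>l. l \<in> A \<Longrightarrow> length l = length xs \<and> c l \<noteq> 0"
  shows "\<exists>k. Const k * (\<Sum>l\<in>A. Const (c l) * monl xs l) \<in> lombardi (poly_ring J) xs"
  using assms
proof (induction xs arbitrary: A c)
  case Nil
  then have "A = {[]}" by auto
  with Nil(4) show ?case
    by (intro exI[of _ "inverse (c [])"]) (auto simp flip: Const_mult)
next
  case (Cons x xs)
  define a where "a = Min (hd ` A)"
  have a: "a \<in> hd ` A" "\<And>l. l \<in> A \<Longrightarrow> a \<le> hd l" unfolding a_def using Cons.prems by (auto intro!: Min_in)
  define A0 where "A0 = {l\<in>A. hd l = a}"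
  have A0: "A0 \<subseteq> A" "A0 \<noteq> {}" "finite A0" using a(1) Cons.prems by (auto simp: A0_def)
  have form: "l = hd l # tl l" "length (tl l) = length xs" if "l \<in> A" for l
    using Cons.prems(4)[OF that] by (cases l; simp)+
  have inj: "inj_on tl A0" using form by (intro inj_onI) (metis (mono_tags, lifting) A0_def mem_Collect_eq)
  have "\<exists>k. Const k * (\<Sum>l\<in>tl ` A0. Const (c (a # l)) * monl xs l) \<in> lombardi (poly_ring J) xs"
  proof (rule Cons.IH)
    show "set xs \<subseteq> carrier (poly_ring J)" using Cons.prems by auto
    show "finite (tl ` A0)" "tl ` A0 \<noteq> {}" using A0 by auto
  next
    fix l assume "l \<in> tl ` A0"
    then obtain l' where l': "l' \<in> A" "hd l' = a" "l = tl l'" by (auto simp: A0_def)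
    then have "l' = a # l" using form by metis
    then show "length l = length xs \<and> c (a # l) \<noteq> 0" using Cons.prems(4)[OF l'(1)] by auto
  qed
  then obtain k where k: "Const k * (\<Sum>l\<in>tl ` A0. Const (c (a # l)) * monl xs l) \<in> lombardi (poly_ring J) xs" (is "?u \<in> _")
    by blast
  define g where "g = Const k * (\<Sum>l\<in>A - A0. Const (c l) * (x ^ (hd l - a - 1) * monl xs (tl l)))"
  have vx: "vars x \<subseteq> J" "\<And>y. y \<in> set xs \<Longrightarrow> vars y \<subseteq> J" using Cons.prems by auto
  have vm: "vars (monl xs l) \<subseteq> J" for l unfolding monl_def
  proof (rule vars_prod_list)
    fix y assume "y \<in> set (map2 (^) xs l)"
    then obtain z n where "y = z ^ n" "z \<in> set xs" by (auto dest: set_zip_leftD)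
    then show "vars y \<subseteq> J" using vx(2)[of z] vars_power[of z n] by blast
  qed
  have vg: "vars g \<subseteq> J"
  proof -
    have "vars (Const (c l) * (x ^ (hd l - a - 1) * monl xs (tl l))) \<subseteq> J" for l
    proof -
      have "vars (x ^ (hd l - a - 1)) \<subseteq> J" using vars_power vx(1) by (rule order_trans)
      then have "vars (x ^ (hd l - a - 1) * monl xs (tl l)) \<subseteq> J"
        by (intro order_trans[OF vars_mult] Un_least vm)
      then show ?thesis by (intro order_trans[OF vars_mult[of "Const (c l)"]]) simp
    qed
    then have "vars (\<Sum>l\<in>A - A0. Const (c l) * (x ^ (hd l - a - 1) * monl xs (tl l))) \<subseteq> J" by (intro vars_sum)
    then show ?thesis unfolding g_def using vars_mult by fastforce
  qed
  have 1: "(\<Sum>l\<in>tl ` A0. Const (c (a # l)) * monl xs l) * x ^ a = (\<Sum>l\<in>A0. Const (c l) * monl (x # xs) l)"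
  proof -
    have "Const (c (a # tl l)) * monl xs (tl l) * x ^ a = Const (c l) * monl (x # xs) l" if "l \<in> A0" for l
    proof -
      have "l = a # tl l" using that form[of l] by (auto simp: A0_def)
      then obtain l' where "l = a # l'" by blast
      then show ?thesis by (simp add: mult_ac)
    qed
    then show ?thesis by (simp add: sum.reindex[OF inj] sum_distrib_right)
  qed
  have 2: "x ^ a * (x * g) = Const k * (\<Sum>l\<in>A - A0. Const (c l) * monl (x # xs) l)"
  proof -
    have "x ^ a * x * (Const (c l) * (x ^ (hd l - a - 1) * monl xs (tl l))) = Const (c l) * monl (x # xs) l"
      if "l \<in> A - A0" for l
    proof -
      have "hd l > a" using that a(2)[of l] by (auto simp: A0_def)
      then have "hd l = a + 1 + (hd l - a - 1)" by simp
      then have "x ^ hd l = x ^ a * x * x ^ (hd l - a - 1)" by (metis power_add power_one_right)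
      moreover have "\<exists>n l'. l = n # l'" using form(1)[of l] that by (metis DiffD1)
      then obtain n l' where "l = n # l'" by blast
      ultimately show ?thesis by (simp add: mult_ac)
    qed
    then have "(\<Sum>l\<in>A - A0. Const (c l) * monl (x # xs) l) =
      (\<Sum>l\<in>A - A0. x ^ a * x * (Const (c l) * (x ^ (hd l - a - 1) * monl xs (tl l))))" by simp
    then have "(\<Sum>l\<in>A - A0. Const (c l) * monl (x # xs) l) =
      x ^ a * x * (\<Sum>l\<in>A - A0. Const (c l) * (x ^ (hd l - a - 1) * monl xs (tl l)))"
      unfolding sum_distrib_left .
    then show ?thesis unfolding g_def by (simp only: mult_ac)
  qed
  have "Const k * (\<Sum>l\<in>A. Const (c l) * monl (x # xs) l) = x ^ a * (?u + x * g)"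
    using sum.subset_diff[OF A0(1) Cons.prems(2), of "\<lambda>l. Const (c l) * monl (x # xs) l"] 1 2
    by (simp add: distrib_left mult_ac)
  then have "Const k * (\<Sum>l\<in>A. Const (c l) * monl (x # xs) l) \<in> lombardi (poly_ring J) (x # xs)"
    using k vg by auto
  then show ?case by blast
qed

lemma lombardi_meets:
  assumes I: "ideal I (poly_ring J)" and gr: "growth_bound J I C"
    and xs: "set xs \<subseteq> carrier (poly_ring J)" "length xs = 4"
  shows "lombardi (poly_ring J) xs \<inter> I \<noteq> {}"
proof -
  have "\<exists>K. \<forall>x\<in>set xs. deg_le K x"
  proof -
    obtain D where D: "\<And>x :: 'a cpoly. deg_le (D x) x" using deg_le_ex by metis
    have "\<forall>x\<in>set xs. deg_le (Max (D ` set xs)) x" using D deg_le_mono[OF D] by auto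
    then show ?thesis by blast
  qed
  then obtain K where K: "\<And>x. x \<in> set xs \<Longrightarrow> vars x \<subseteq> J \<and> deg_le K x" using xs by auto
  \<comment> \<open>There are (D+1)^4 monomials in the four elements with exponents at most D, all
    of degree at most 4 D K, while relations are guaranteed beyond C (4 D K + 1)^3, which is at most
    C (4 (K+1))^3 (D+1)^3. The choice makes the constant factor equal to D, so the fourth power
    wins.\<close>
  define D where "D = C * (4 * (K + 1)) ^ 3"
  define A where "A = {l. set l \<subseteq> {..D} \<and> length l = 4}"
  have cA: "card A = (D + 1) ^ 4" and fA: "finite A"
    unfolding A_def using finite_lists_length_eq[of "{..D}" 4] by (auto simp: card_lists_length_eq)
  have "C * (4 * (D * K) + 1) ^ 3 \<le> C * ((4 * (K + 1)) * (D + 1)) ^ 3"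
    by (intro mult_left_mono power_mono) (auto simp: algebra_simps)
  also have "\<dots> = D * (D + 1) ^ 3" 
    by (simp only: D_def power_mult_distrib[of "4 * (K + 1)"] mult.assoc[of C])
  also have "\<dots> < (D + 1) * (D + 1) ^ 3" by simp
  also have "\<dots> = card A" unfolding cA by (simp add: eval_nat_numeral)
  finally have big: "C * (4 * (D * K) + 1) ^ 3 < card A" .
  have "\<exists>c. (\<exists>a\<in>A. c a \<noteq> 0) \<and> (\<Sum>a\<in>A. Const (c a) * monl xs a) \<in> I"
  proof (rule growth_boundD[OF gr, where h = "map of_nat", OF fA _ _ big])
    show "inj_on (map of_nat :: nat list \<Rightarrow> complex list) A"
      by (rule inj_on_subset[of _ UNIV]) (auto intro!: inj_mapI inj_of_nat)
  next
    fix l assume "l \<in> A"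
    then show "vars (monl xs l) \<subseteq> J \<and> deg_le (4 * (D * K)) (monl xs l)"
      using monl_bounds[of xs J K l D] K xs(2) by (auto simp: A_def)
  qed
  then obtain c where c: "\<exists>a\<in>A. c a \<noteq> 0" "(\<Sum>a\<in>A. Const (c a) * monl xs a) \<in> I" by blast
  let ?A = "{a\<in>A. c a \<noteq> 0}"
  have "(\<Sum>a\<in>A. Const (c a) * monl xs a) = (\<Sum>a\<in>?A. Const (c a) * monl xs a)"
    by (rule sum.mono_neutral_right) (use fA in auto)
  then have S: "(\<Sum>a\<in>?A. Const (c a) * monl xs a) \<in> I" using c(2) by simp
  have "\<exists>k. Const k * (\<Sum>l\<in>?A. Const (c l) * monl xs l) \<in> lombardi (poly_ring J) xs"
    using c(1) fA xs by (intro lombardi_of_dependence finite_subset[OF _ fA]) (auto simp: A_def)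
  then obtain k where "Const k * (\<Sum>l\<in>?A. Const (c l) * monl xs l) \<in> lombardi (poly_ring J) xs" by blast
  moreover have "Const k * (\<Sum>l\<in>?A. Const (c l) * monl xs l) \<in> I" by (rule poly_ideal(4)[OF I S]) simp
  ultimately show ?thesis by blast
qed

section \<open>Residue fields\<close>

text \<open>Substituting a fixed \<open>f\<close> into univariate complex polynomials is a ring
  homomorphism, written here with \<open>map_poly Const\<close>. This and the following lemmas
  collect its rules.\<close>

lemma ev_pCons: "poly (map_poly Const (pCons a p)) f = Const a + f * poly (map_poly Const p) f"
  by (simp add: map_poly_pCons)

lemma ev_add: "poly (map_poly Const (p + q)) f = poly (map_poly Const p) f + poly (map_poly Const q) f"
  by (induction p q rule: poly_induct2) (simp_all add: ev_pCons Const_add distrib_left)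

lemma ev_smult: "poly (map_poly Const (Polynomial.smult a p)) f = Const a * poly (map_poly Const p) f"
  by (induction p) (simp_all add: ev_pCons Const_mult distrib_left mult_ac)

lemma ev_mult: "poly (map_poly Const (p * q)) f = poly (map_poly Const p) f * poly (map_poly Const q) f"
  by (induction p) (simp_all add: ev_pCons ev_add ev_smult algebra_simps)

lemma ev_prod: "poly (map_poly Const (prod g A)) f = (\<Prod>a\<in>A. poly (map_poly Const (g a)) f)"
  by (induction A rule: infinite_finite_induct) (simp_all add: ev_mult map_poly_1')

lemma ev_sum: "poly (map_poly Const (sum g A)) f = (\<Sum>a\<in>A. poly (map_poly Const (g a)) f)"
  by (induction A rule: infinite_finite_induct) (simp_all add: ev_add)

lemma ev_linear: "poly (map_poly Const [:- r, 1:]) f = f - Const r"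
  by (simp add: ev_pCons Const_uminus)

lemma ev_vars: "vars f \<subseteq> J \<Longrightarrow> vars (poly (map_poly Const p) f) \<subseteq> J"
proof (induction p)
  case (pCons a p)
  then show ?case
    using vars_add[of "Const a" "f * poly (map_poly Const p) f"] vars_mult[of f "poly (map_poly Const p) f"]
    by (auto simp: ev_pCons)
qed simp

text \<open>Over the complex numbers \<open>q\<close> splits into linear factors, and a prime
  containing q(f) contains one of the f - r. A nonzero constant is a unit and cannot lie in
  \<open>P\<close>.\<close>

lemma linear_factor_in_prime:
  assumes P: "ideal P (poly_ring J)" "1 \<notin> P"
    and prime: "\<And>f g. vars f \<subseteq> J \<Longrightarrow> vars g \<subseteq> J \<Longrightarrow> f * g \<in> P \<Longrightarrow> f \<in> P \<or> g \<in> P"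
    and f: "vars f \<subseteq> J" and q: "q \<noteq> 0" "poly (map_poly Const q) f \<in> P"
  shows "\<exists>r. f - Const r \<in> P"
  using q
proof (induction "degree q" arbitrary: q)
  case 0
  then obtain k where "q = [:k:]" "k \<noteq> 0" by (metis degree_eq_zeroE pCons_0_0)
  then have "Const k \<in> P" using 0 by (simp add: ev_pCons)
  from poly_ideal(4)[OF P(1) this, of "Const (inverse k)"] \<open>k \<noteq> 0\<close> P(2)
  show ?case by (simp flip: Const_mult)
next
  case (Suc n)
  then have "\<not> constant (poly q)" by (simp add: constant_degree)
  then obtain r where "poly q r = 0" using fundamental_theorem_of_algebra by blast
  then obtain q' where q': "q = [:- r, 1:] * q'" by (metis dvdE poly_eq_0_iff_dvd)
  then have "q' \<noteq> 0" using Suc by auto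
  then have deg: "n = degree q'" using Suc(2) by (simp add: q' degree_mult_eq del: mult_pCons_left)
  have "(f - Const r) * poly (map_poly Const q') f \<in> P"
    using Suc(4) unfolding q' ev_mult ev_linear .
  moreover have "vars (f - Const r) \<subseteq> J" using vars_diff[of f "Const r"] f by auto
  ultimately have "f - Const r \<in> P \<or> poly (map_poly Const q') f \<in> P"
    using ev_vars[OF f] by (intro prime)
  then show ?case using Suc(1)[OF deg \<open>q' \<noteq> 0\<close>] by blast
qed

text \<open>If no \<open>f - r\<close> lies in \<open>P\<close>, the inverses of the \<open>f - r\<close> modulo \<open>P\<close> are uncountably many elements,
  so infinitely many of them have bounded degree; a linear relation among them
  gives a nonzero polynomial \<open>q\<close> with \<open>q(f)\<close> in \<open>P\<close>.\<close>

lemma residue_field_complex: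
  assumes P: "ideal P (poly_ring J)" "1 \<notin> P"
    and prime: "\<And>f g. vars f \<subseteq> J \<Longrightarrow> vars g \<subseteq> J \<Longrightarrow> f * g \<in> P \<Longrightarrow> f \<in> P \<or> g \<in> P"
    and max: "\<And>f. vars f \<subseteq> J \<Longrightarrow> f \<notin> P \<Longrightarrow> \<exists>g. vars g \<subseteq> J \<and> f * g - 1 \<in> P"
    and gr: "growth_bound J P C" and f: "vars f \<subseteq> J"
  shows "\<exists>r. f - Const r \<in> P"
proof (rule ccontr)
  assume no: "\<nexists>r. f - Const r \<in> P"
  have vfr: "vars (f - Const r) \<subseteq> J" for r using vars_diff[of f "Const r"] f by auto
  have "\<forall>r. \<exists>g. vars g \<subseteq> J \<and> (f - Const r) * g - 1 \<in> P" using max[OF vfr] no by blast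
  then obtain u where u: "\<And>r. vars (u r) \<subseteq> J" "\<And>r. (f - Const r) * u r - 1 \<in> P" by metis
  have "\<exists>d. infinite {r. deg_le d (u r)}"
  proof (rule ccontr)
    assume "\<nexists>d. infinite {r. deg_le d (u r)}"
    then have "countable (\<Union>d. {r. deg_le d (u r)})" by (intro countable_UN) (auto intro: countable_finite)
    moreover have "(\<Union>d. {r. deg_le d (u r)}) = UNIV" using deg_le_ex by auto
    ultimately have "countable (UNIV :: complex set)" by simp
    then have "countable (complex_of_real ` UNIV)" by (rule countable_subset[rotated]) simp
    then have "countable (UNIV :: real set)" by (rule countable_image_inj_on) (simp add: inj_on_def)
    then show False using uncountable_UNIV_real by blast
  qed
  then obtain d where d: "infinite {r. deg_le d (u r)}" by blast
  obtain A where A: "finite A" "card A = C * (d + 1) ^ 3 + 1" "A \<subseteq> {r. deg_le d (u r)}"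
    using infinite_arbitrarily_large[OF d] by blast
  have "\<exists>c. (\<exists>a\<in>A. c a \<noteq> 0) \<and> (\<Sum>a\<in>A. Const (c a) * u a) \<in> P"
    using A u by (intro growth_boundD[OF gr, where d = d and h = "\<lambda>a. [a]"]) (auto simp: inj_on_def)
  then obtain c z where c: "z \<in> A" "c z \<noteq> 0" "(\<Sum>a\<in>A. Const (c a) * u a) \<in> P" by blast
  \<comment> \<open>The numerator of the sum of c_a / (t - a). At \<open>z\<close> only the term of
    \<open>z\<close> survives, so q(z) is nonzero.\<close>
  define q where "q = (\<Sum>a\<in>A. Polynomial.smult (c a) (\<Prod>b\<in>A - {a}. [:- b, 1:]))"
  define w where "w a = (\<Prod>b\<in>A - {a}. f - Const b)" for a
  have vw: "vars (w a) \<subseteq> J" for a unfolding w_def by (intro vars_prod vfr)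
  have ev: "poly (map_poly Const q) f = (\<Sum>a\<in>A. Const (c a) * w a)"
    unfolding q_def w_def ev_sum ev_smult ev_prod ev_linear ..
  have "poly q z = (\<Sum>a\<in>A. c a * (\<Prod>b\<in>A - {a}. z - b))"
    by (simp add: q_def poly_sum poly_prod)
  also have "\<dots> = (\<Sum>a\<in>A. if a = z then c z * (\<Prod>b\<in>A - {z}. z - b) else 0)"
  proof (rule sum.cong)
    fix a assume "a \<in> A"
    have "(\<Prod>b\<in>A - {a}. z - b) = 0" if "a \<noteq> z" using that c(1) A(1) by (intro prod_zero) auto
    then show "c a * (\<Prod>b\<in>A - {a}. z - b) = (if a = z then c z * (\<Prod>b\<in>A - {z}. z - b) else 0)" by auto
  qed simp
  also have "\<dots> = c z * (\<Prod>b\<in>A - {z}. z - b)" using c(1) A(1) by simp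
  also have "\<dots> \<noteq> 0" using c(2) A(1) by (auto simp: prod_zero_iff)
  finally have q0: "q \<noteq> 0" by auto
  \<comment> \<open>Modulo \<open>P\<close> the product (f - a) u_a is 1, so w_a may be replaced by
    w_a (f - a) u_a. There w_a (f - a) is the product over all of \<open>A\<close>; it comes out of
    the sum and leaves the relation between the u_a.\<close>
  have "w a - w a * ((f - Const a) * u a) \<in> P" for a
    using poly_ideal(5)[OF P(1) poly_ideal(4)[OF P(1) u(2)[of a] vw[of a]]] by (simp add: algebra_simps)
  then have "(\<Sum>a\<in>A. Const (c a) * (w a - w a * ((f - Const a) * u a))) \<in> P"
    by (intro poly_ideal_sum[OF P(1)] poly_ideal(4)[OF P(1)]) auto
  moreover have "(\<Sum>a\<in>A. Const (c a) * (w a * ((f - Const a) * u a))) \<in> P"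
  proof -
    have "w a * (f - Const a) = (\<Prod>b\<in>A. f - Const b)" if "a \<in> A" for a
      unfolding w_def using prod.remove[OF A(1) that, of "\<lambda>b. f - Const b"] by (simp add: mult.commute)
    then have "(\<Sum>a\<in>A. Const (c a) * (w a * ((f - Const a) * u a))) =
      (\<Prod>b\<in>A. f - Const b) * (\<Sum>a\<in>A. Const (c a) * u a)"
      by (simp add: sum_distrib_left mult.assoc[symmetric] mult.commute[of _ "Const _"] cong: sum.cong)
    then show ?thesis 
      using poly_ideal(4)[OF P(1) c(3), of "\<Prod>b\<in>A. f - Const b"] vars_prod[of A "\<lambda>b. f - Const b", OF vfr]
      by simp
  qed
  ultimately have "(\<Sum>a\<in>A. Const (c a) * w a) \<in> P"
    using poly_ideal(3)[OF P(1)] by (fastforce simp: right_diff_distrib sum_subtractf)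
  then have "\<exists>r. f - Const r \<in> P"
    using q0 by (intro linear_factor_in_prime[OF P prime f q0]) (auto simp: ev)
  then show False using no by blast
qed

section \<open>The parametrisation and a basis of the coordinate ring\<close>

lemma UNIV_xyz: "(UNIV :: xyz set) = {IX, IY, IZ}"
  using xyz.exhaust by blast

instance xyz :: finite
  by standard (simp add: UNIV_xyz)

text \<open>The three forms \<open>G\<close> are permuted by the cycle x, y, z, so one formula in
  \<open>i\<close>, \<open>nxt i\<close>, \<open>nxt (nxt i)\<close> covers them all. The cyclic
  lemmas expand sums and products starting from whichever index is in focus.\<close>

fun nxt :: "xyz \<Rightarrow> xyz" where
  "nxt IX = IY" | "nxt IY = IZ" | "nxt IZ = IX"

lemma nxt_simps [simp]: "nxt (nxt (nxt i)) = i" "nxt i \<noteq> i" "i \<noteq> nxt i" "nxt (nxt i) \<noteq> i"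
  "i \<noteq> nxt (nxt i)"
  by (cases i; simp)+

lemma UNIV_cyc: "(UNIV :: xyz set) = {i, nxt i, nxt (nxt i)}"
  by (cases i) (auto simp: UNIV_xyz)

lemma sum_cyc: "(\<Sum>j\<in>UNIV. f j) = f i + f (nxt i) + f (nxt (nxt i))" for f :: "xyz \<Rightarrow> 'a::comm_monoid_add"
  by (subst UNIV_cyc[of i]) (simp add: add.assoc)

lemma prod_cyc: "(\<Prod>j\<in>UNIV. f j) = f i * f (nxt i) * f (nxt (nxt i))" for f :: "xyz \<Rightarrow> 'a::comm_monoid_mult"
  by (subst UNIV_cyc[of i]) (simp add: mult.assoc)

lemma all_cyc: "(\<forall>j. P j) \<longleftrightarrow> P i \<and> P (nxt i) \<and> P (nxt (nxt i))"
  using UNIV_cyc[of i] by (metis UNIV_I insertE singletonD)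

definition sz :: "(xyz \<Rightarrow> nat) \<Rightarrow> nat" where "sz e = (\<Sum>i\<in>UNIV. e i)"
definition mn :: "(xyz \<Rightarrow> complex) \<Rightarrow> (xyz \<Rightarrow> nat) \<Rightarrow> complex" where "mn v e = (\<Prod>i\<in>UNIV. v i ^ e i)"
definition V :: "(xyz \<Rightarrow> complex) \<Rightarrow> complex" where "V v = (\<Prod>i\<in>UNIV. v i)"

lemma sz_upd: "sz (e(i := e i + n)) = sz e + n"
  by (simp add: sz_def sum_cyc[of _ i])

lemma sz_eq_0: "sz e = 0 \<longleftrightarrow> e = (\<lambda>_. 0)"
  by (auto simp: sz_def fun_eq_iff)

lemma sz_add: "sz (\<lambda>i. a i + b i) = sz a + sz b" by (simp add: sz_def sum.distrib)
lemma sz_mult: "sz (\<lambda>i. n * a i) = n * sz a" by (simp add: sz_def sum_distrib_left)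

lemma mn_upd: "mn v (e(i := e i + n)) = v i ^ n * mn v e"
  by (simp add: mn_def prod_cyc[of _ i] power_add)

lemma mn_add: "mn v (\<lambda>i. a i + b i) = mn v a * mn v b"
  by (simp add: mn_def power_add prod.distrib)

lemma upd_decr: "e i > 0 \<Longrightarrow> e = (e(i := e i - 1))(i := (e(i := e i - 1)) i + 1)" for e :: "xyz \<Rightarrow> nat"
  by (simp add: fun_eq_iff)

locale surf =
  fixes m :: nat
  assumes m: "m \<ge> 4"
begin

definition G :: "xyz \<Rightarrow> (xyz \<Rightarrow> complex) \<Rightarrow> complex" where
  "G i v = v (nxt i) * v (nxt (nxt i)) * (v (nxt i) ^ m - (- v (nxt (nxt i))) ^ m)"

definition H :: "xyz \<Rightarrow> (xyz \<Rightarrow> complex) \<Rightarrow> complex" where "H i v = V v * v i ^ (m - 1)"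

text \<open>\<open>mf e \<sigma>\<close> is the product of the \<open>G\<^sub>i\<^bsup>e i\<^esup>\<close> and of \<open>k\<close> basis forms \<open>x y z \<lambda>\<close> whose monomials
  \<open>\<lambda>\<close> have product \<open>v\<^sup>\<sigma>\<close>; this forces \<open>sz \<sigma> = k (m - 1)\<close>, and the division by \<open>m - 1\<close> is
  only meaningful then.\<close>

definition mf :: "(xyz \<Rightarrow> nat) \<Rightarrow> (xyz \<Rightarrow> nat) \<Rightarrow> (xyz \<Rightarrow> complex) \<Rightarrow> complex" where
  "mf e \<sigma> v = (\<Prod>i\<in>UNIV. G i v ^ e i) * V v ^ (sz \<sigma> div (m - 1)) * mn v \<sigma>"

lemma mf_G: "mf (e(i := e i + 1)) \<sigma> v = G i v * mf e \<sigma> v"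
  by (simp add: mf_def prod_cyc[of _ i] power_add mult_ac)

lemma mf_H: "mf e (\<sigma>(i := \<sigma> i + (m - 1))) v = H i v * mf e \<sigma> v"
proof -
  have "(sz \<sigma> + (m - 1)) div (m - 1) = Suc (sz \<sigma> div (m - 1))"
    using div_add_self2[of "m - 1" "sz \<sigma>"] m by linarith
  then show ?thesis by (simp add: mf_def sz_upd mn_upd H_def mult_ac)
qed

text \<open>The pairs in \<open>core\<close> index a basis of the coordinate ring modulo the linear forms \<open>G\<^sub>i - H\<^sub>i\<close>,
  and hence a basis of the coordinate ring over the polynomial ring in the \<open>G\<^sub>i - H\<^sub>i - a\<^sub>i\<close>.\<close>

definition core :: "(xyz set \<times> (xyz \<Rightarrow> nat)) set" where
  "core = {(p, \<alpha>). p \<noteq> UNIV \<and> (\<forall>i. \<alpha> i < m - 1) \<and> (\<forall>i\<in>p. \<alpha> i = 0) \<and> (m - 1) dvd sz \<alpha>}"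

definition dg :: "xyz set \<times> (xyz \<Rightarrow> nat) \<Rightarrow> nat" where
  "dg c = sz (snd c) div (m - 1) + card (fst c)"

definition Idx :: "nat \<Rightarrow> ((xyz set \<times> (xyz \<Rightarrow> nat)) \<times> (xyz \<Rightarrow> nat)) set" where
  "Idx d = {(c, \<epsilon>). c \<in> core \<and> dg c + sz \<epsilon> \<le> d}"

definition sl :: "(xyz \<Rightarrow> complex) \<Rightarrow> xyz \<Rightarrow> (xyz \<Rightarrow> complex) \<Rightarrow> complex" where
  "sl a i v = G i v - H i v - a i"

definition Bf :: "(xyz \<Rightarrow> complex) \<Rightarrow> (xyz set \<times> (xyz \<Rightarrow> nat)) \<times> (xyz \<Rightarrow> nat) \<Rightarrow> (xyz \<Rightarrow> complex) \<Rightarrow> complex" where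
  "Bf a j v = mf (\<lambda>i. if i \<in> fst (fst j) then 1 else 0) (snd (fst j)) v * (\<Prod>i\<in>UNIV. sl a i v ^ snd j i)"

lemma Bf_upd: "Bf a (c, \<epsilon>(i := \<epsilon> i + 1)) v = sl a i v * Bf a (c, \<epsilon>) v"
  by (simp add: Bf_def prod_cyc[of _ i] power_add mult_ac)

lemma bounded_funs: "{\<epsilon> :: xyz \<Rightarrow> nat. \<forall>i. \<epsilon> i \<le> d} =
    (\<lambda>(a, b, c) i. case i of IX \<Rightarrow> a | IY \<Rightarrow> b | IZ \<Rightarrow> c) ` ({..d} \<times> {..d} \<times> {..d})" (is "?L = ?f ` ?T")
proof
  show "?L \<subseteq> ?f ` ?T"
  proof
    fix \<epsilon> :: "xyz \<Rightarrow> nat" assume \<epsilon>: "\<epsilon> \<in> ?L"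
    have "\<epsilon> = ?f (\<epsilon> IX, \<epsilon> IY, \<epsilon> IZ)" by (rule ext) (simp split: xyz.split)
    then show "\<epsilon> \<in> ?f ` ?T" using \<epsilon> by blast
  qed
qed (auto split: xyz.split)

lemma finite_bounded_funs: "finite {\<epsilon> :: xyz \<Rightarrow> nat. \<forall>i. \<epsilon> i \<le> d}"
  unfolding bounded_funs by (intro finite_imageI finite_cartesian_product) auto

lemma card_bounded_funs: "card {\<epsilon> :: xyz \<Rightarrow> nat. \<forall>i. \<epsilon> i \<le> d} \<le> (d + 1) ^ 3"
proof -
  have "card {\<epsilon> :: xyz \<Rightarrow> nat. \<forall>i. \<epsilon> i \<le> d} \<le> card ({..d} \<times> {..d} \<times> {..d})"
    unfolding bounded_funs by (intro card_image_le finite_cartesian_product) auto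
  then show ?thesis 
    by (simp only: card_cartesian_product card_atMost power3_eq_cube Suc_eq_plus1 mult.assoc)
qed

lemma le_sz: "e i \<le> sz e" unfolding sz_def by (rule member_le_sum) auto

lemma finite_core: "finite core"
proof (rule finite_subset)
  show "core \<subseteq> UNIV \<times> {\<epsilon> :: xyz \<Rightarrow> nat. \<forall>i. \<epsilon> i \<le> m}" by (auto simp: core_def intro: less_imp_le) (meson diff_le_self less_imp_le order.trans)
  show "finite ((UNIV :: xyz set set) \<times> {\<epsilon> :: xyz \<Rightarrow> nat. \<forall>i. \<epsilon> i \<le> m})"
    by (intro finite_cartesian_product finite_bounded_funs) simp
qed

lemma Idx_subset: "Idx d \<subseteq> core \<times> {\<epsilon>. \<forall>i. \<epsilon> i \<le> d}"
proof (clarsimp simp: Idx_def)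
  fix p \<alpha> \<epsilon> i assume "dg (p, \<alpha>) + sz \<epsilon> \<le> d"
  then show "\<epsilon> i \<le> d" using le_sz[of \<epsilon> i] by linarith
qed

lemma finite_Idx: "finite (Idx d)"
  using Idx_subset by (rule finite_subset) (intro finite_cartesian_product finite_core finite_bounded_funs)

text \<open>Three exponents of size at most \<open>d\<close>, times a finite set: this count is the
  source of the exponent 3 in every growth bound below.\<close>

lemma card_Idx: "card (Idx d) \<le> card core * (d + 1) ^ 3"
proof -
  have "card (Idx d) \<le> card (core \<times> {\<epsilon> :: xyz \<Rightarrow> nat. \<forall>i. \<epsilon> i \<le> d})"
    by (intro card_mono Idx_subset finite_cartesian_product finite_core finite_bounded_funs)
  also have "\<dots> \<le> card core * (d + 1) ^ 3"
    unfolding card_cartesian_product by (intro mult_left_mono card_bounded_funs) simp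
  finally show ?thesis .
qed

section \<open>Closure properties of the filtered span\<close>

definition spanned :: "(xyz \<Rightarrow> complex) \<Rightarrow> nat \<Rightarrow> ((xyz \<Rightarrow> complex) \<Rightarrow> complex) \<Rightarrow> bool" where
  "spanned a d g \<longleftrightarrow> (\<exists>c. \<forall>v. g v = (\<Sum>j\<in>Idx d. c j * Bf a j v))"

lemma sp_cong: "spanned a d f \<Longrightarrow> (\<And>v. g v = f v) \<Longrightarrow> spanned a d g"
  by (simp add: spanned_def)

lemma sp_0: "spanned a d (\<lambda>v. 0)"
  unfolding spanned_def by (intro exI[of _ "\<lambda>_. 0"]) simp

lemma sp_add: "spanned a d f \<Longrightarrow> spanned a d g \<Longrightarrow> spanned a d (\<lambda>v. f v + g v)"
  unfolding spanned_def
proof (elim exE)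
  fix c c' assume "\<forall>v. f v = (\<Sum>j\<in>Idx d. c j * Bf a j v)" "\<forall>v. g v = (\<Sum>j\<in>Idx d. c' j * Bf a j v)"
  then show "\<exists>c. \<forall>v. f v + g v = (\<Sum>j\<in>Idx d. c j * Bf a j v)"
    by (intro exI[of _ "\<lambda>j. c j + c' j"]) (simp add: distrib_right sum.distrib)
qed

lemma sp_scale: "spanned a d f \<Longrightarrow> spanned a d (\<lambda>v. k * f v)"
  unfolding spanned_def
proof (elim exE)
  fix c assume "\<forall>v. f v = (\<Sum>j\<in>Idx d. c j * Bf a j v)"
  then show "\<exists>c. \<forall>v. k * f v = (\<Sum>j\<in>Idx d. c j * Bf a j v)"
    by (intro exI[of _ "\<lambda>j. k * c j"]) (simp add: sum_distrib_left mult.assoc)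
qed

lemma sp_diff: "spanned a d f \<Longrightarrow> spanned a d g \<Longrightarrow> spanned a d (\<lambda>v. f v - g v)"
  using sp_add[OF _ sp_scale[of a d g "-1"], of f] by simp

lemma sp_sum: "(\<And>x. x \<in> A \<Longrightarrow> spanned a d (f x)) \<Longrightarrow> spanned a d (\<lambda>v. \<Sum>x\<in>A. f x v)"
proof (induction A rule: infinite_finite_induct)
  case (insert x F)
  then show ?case by (simp add: sp_add)
qed (simp_all add: sp_0)

lemma sp_B: "j \<in> Idx d \<Longrightarrow> spanned a d (Bf a j)"
  unfolding spanned_def
proof (intro exI[of _ "\<lambda>i. if i = j then 1 else 0"] allI)
  fix v assume "j \<in> Idx d"
  then show "Bf a j v = (\<Sum>i\<in>Idx d. (if i = j then 1 else 0) * Bf a i v)"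
    by (simp add: if_distrib[of "\<lambda>x. x * _"] finite_Idx cong: if_cong)
qed

lemma spannedE:
  assumes "spanned a d g"
  obtains c where "\<And>v. g v = (\<Sum>j\<in>Idx d. c j * Bf a j v)"
  using assms by (auto simp: spanned_def)

lemma sp_mono: "spanned a d g \<Longrightarrow> d \<le> d' \<Longrightarrow> spanned a d' g"
proof (erule spannedE)
  fix c assume "d \<le> d'" and g: "\<And>v. g v = (\<Sum>j\<in>Idx d. c j * Bf a j v)"
  then have "Idx d \<subseteq> Idx d'" by (auto simp: Idx_def)
  then have "spanned a d' (\<lambda>v. \<Sum>j\<in>Idx d. c j * Bf a j v)"
    by (intro sp_sum sp_scale sp_B) auto
  then show "spanned a d' g" by (rule sp_cong) (rule g)
qed

lemma sp_shift: "spanned a d g \<Longrightarrow> spanned a (Suc d) (\<lambda>v. sl a i v * g v)"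
proof (erule spannedE)
  fix c assume g: "\<And>v. g v = (\<Sum>j\<in>Idx d. c j * Bf a j v)"
  have "spanned a (Suc d) (\<lambda>v. \<Sum>j\<in>Idx d. c j * Bf a (fst j, (snd j)(i := snd j i + 1)) v)"
    by (intro sp_sum sp_scale sp_B) (auto simp: Idx_def sz_upd[where n = 1, simplified])
  then show ?thesis
    by (rule sp_cong) (simp only: g Bf_upd prod.collapse sum_distrib_left mult.left_commute)
qed

text \<open>With a = x^m, b = y^m, c = z^m and m odd, x G_x = V (b + c) and x H_x = V a, and
  cyclically. After multiplication by x y z the relation is the expansion of (a+b)(b+c)(c+a). For m
  even the sums become the differences b - c, c - a, a - b, and the expansion is that of their
  product.\<close>

lemma cubic_relation:
  assumes "odd m"
  shows "2 * H IX v * H IY v * H IZ v + G IX v * H IY v * H IZ v + H IX v * G IY v * H IZ v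
    + H IX v * H IY v * G IZ v = G IX v * G IY v * G IZ v"
proof -
  obtain k where k: "m = Suc k" using m by (cases m) auto
  show ?thesis using assms unfolding G_def H_def V_def prod_cyc[of _ IX]
    by (simp add: power_minus_odd) (simp add: k algebra_simps)
qed

lemma cubic_relation_even:
  assumes "even m"
  shows "G IX v * H IY v * H IZ v + H IX v * G IY v * H IZ v
    + H IX v * H IY v * G IZ v + G IX v * G IY v * G IZ v = 0"
proof -
  obtain k where k: "m = Suc k" using m by (cases m) auto
  show ?thesis using assms unfolding G_def H_def V_def prod_cyc[of _ IX]
    by (simp add: power_minus_even) (simp add: k algebra_simps)
qed

lemma mf_00: "mf (\<lambda>_. 0) (\<lambda>_. 0) v = 1"
  by (simp add: mf_def sz_def mn_def)

text \<open>Modulo the linear forms \<open>G\<^sub>i - H\<^sub>i\<close> every \<open>G\<^sub>i\<close> becomes \<open>H\<^sub>i\<close>. The three relations between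
  the \<open>V\<^sup>k v\<^sup>\<mu> v\<^sub>j\<^sup>m\<close> for fixed \<open>\<mu>\<close> are then a nonsingular linear system,
  and the cubic becomes \<open>4 H\<^sub>x H\<^sub>y H\<^sub>z\<close>.\<close>

lemma spanned_mf:
  assumes "(m - 1) dvd sz \<sigma>" "sz e + sz \<sigma> div (m - 1) = D"
  shows "spanned a D (mf e \<sigma>)"
  using assms
proof (induction D arbitrary: e \<sigma> rule: less_induct)
  case (less D)
  have m1: "m - 1 > 0" using m by simp
  have divS: "(n + (m - 1)) div (m - 1) = Suc (n div (m - 1))" for n
    using div_add_self2[of "m - 1" n] m1 by linarith
  \<comment> \<open>As G_i = sl_i + H_i + a_i, exchanging one factor G_i for H_i costs sl_i times,
    and a_i times, a function of degree D - 1. Both are spanned by the outer induction.\<close>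
  have red: "spanned a D (\<lambda>v. mf e \<sigma> v - mf (\<lambda>_. 0) (\<lambda>i. \<sigma> i + (m - 1) * e i) v)"
    if "(m - 1) dvd sz \<sigma>" "sz e + sz \<sigma> div (m - 1) = D" for e \<sigma>
    using that
  proof (induction "sz e" arbitrary: e \<sigma>)
    case 0
    then have "e = (\<lambda>_. 0)" by (simp add: sz_eq_0)
    then show ?case by (simp add: sp_0)
  next
    case (Suc n)
    have "\<exists>i. e i > 0"
    proof (rule ccontr)
      assume "\<nexists>i. e i > 0"
      then have "e = (\<lambda>_. 0)" by (auto simp: fun_eq_iff)
      then show False using Suc(2) by (simp add: sz_def)
    qed
    then obtain i where i: "e i > 0" by blast
    define e' where "e' = e(i := e i - 1)"
    have e: "e = e'(i := e' i + 1)" unfolding e'_def using i by (rule upd_decr)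
    have sze: "sz e = sz e' + 1" using e sz_upd[of e' i 1] by metis
    define \<sigma>' where "\<sigma>' = \<sigma>(i := \<sigma> i + (m - 1))"
    have sz\<sigma>: "sz \<sigma>' = sz \<sigma> + (m - 1)" unfolding \<sigma>'_def by (rule sz_upd)
    have D: "D = Suc (D - 1)" "sz e' + sz \<sigma> div (m - 1) = D - 1" using Suc(4) sze by auto
    have X: "spanned a (D - 1) (mf e' \<sigma>)" using less.IH[of "D - 1" \<sigma> e'] D Suc(3) by simp
    have "spanned a D (\<lambda>v. sl a i v * mf e' \<sigma> v + a i * mf e' \<sigma> v)"
    proof (rule sp_add)
      show "spanned a D (\<lambda>v. sl a i v * mf e' \<sigma> v)" using sp_shift[OF X, of i] D(1) by simp
      show "spanned a D (\<lambda>v. a i * mf e' \<sigma> v)" by (intro sp_scale sp_mono[OF X]) simp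
    qed
    moreover have "spanned a D (\<lambda>v. mf e' \<sigma>' v - mf (\<lambda>_. 0) (\<lambda>i. \<sigma>' i + (m - 1) * e' i) v)"
    proof (rule Suc.hyps(1))
      show "n = sz e'" using Suc.hyps(2) sze by simp
      show "(m - 1) dvd sz \<sigma>'" using Suc.prems(1) by (simp only: sz\<sigma> dvd_add_triv_right_iff)
      show "sz e' + sz \<sigma>' div (m - 1) = D" unfolding sz\<sigma> divS using D by linarith
    qed
    ultimately have "spanned a D (\<lambda>v. (sl a i v * mf e' \<sigma> v + a i * mf e' \<sigma> v) +
       (mf e' \<sigma>' v - mf (\<lambda>_. 0) (\<lambda>i. \<sigma>' i + (m - 1) * e' i) v))" by (rule sp_add)
    moreover have "(\<lambda>i. \<sigma>' i + (m - 1) * e' i) = (\<lambda>i. \<sigma> i + (m - 1) * e i)"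
      unfolding \<sigma>'_def by (subst e) (auto simp: fun_eq_iff)
    moreover have "mf e \<sigma> v = G i v * mf e' \<sigma> v" for v by (subst e) (rule mf_G)
    moreover have "mf e' \<sigma>' v = H i v * mf e' \<sigma> v" for v unfolding \<sigma>'_def by (rule mf_H)
    ultimately show ?case by (elim sp_cong) (simp add: sl_def algebra_simps)
  qed
  have zero: "spanned a D (mf (\<lambda>_. 0) \<sigma>)" if dv: "(m - 1) dvd sz \<sigma>" and D: "sz \<sigma> div (m - 1) = D" for \<sigma>
  proof (cases "\<exists>i. \<sigma> i \<ge> m")
    case True
    then obtain i where i: "\<sigma> i \<ge> m" by blast
    define \<mu> where "\<mu> = \<sigma>(i := \<sigma> i - m)"
    have sm: "sz \<sigma> = sz \<mu> + m"
      using sz_upd[of \<mu> i m] i by (simp add: \<mu>_def)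
    define A where "A j = mf (\<lambda>_. 0) (\<mu>(j := \<mu> j + m))" for j
    have \<sigma>: "mf (\<lambda>_. 0) \<sigma> = A i" unfolding A_def \<mu>_def using i by (simp add: fun_upd_triv)
    define s :: complex where "s = (-1) ^ m"
    have pm: "(- x) ^ m = s * x ^ m" for x :: complex unfolding s_def by (rule power_minus)
    have szm: "sz (\<mu>(j := \<mu> j + m)) = sz \<sigma>" for j using sz_upd[of \<mu> j m] sm by simp
    have szY: "sz (\<mu>(j := \<mu> j + 1)) + (m - 1) = sz \<sigma>" for j using sz_upd[of \<mu> j 1] sm m by simp
    have Dpos: "D = Suc (sz (\<mu>(j := \<mu> j + 1)) div (m - 1))" for j
      using szY[of j] D divS[of "sz (\<mu>(j := \<mu> j + 1))"] by simp
    \<comment> \<open>G_j times V^(D-1) v_j v^mu equals V^D v^mu (v_{j+1}^m - s v_{j+2}^m), because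
      v_j v_{j+1} v_{j+2} = V. By \<open>red\<close> the same function agrees with
      \<open>A j\<close> up to spanned functions.\<close>
    have R: "spanned a D (\<lambda>v. A (nxt j) v - s * A (nxt (nxt j)) v - A j v)" for j
    proof -
      let ?e = "(\<lambda>_. 0)(j := (\<lambda>_. 0) j + 1) :: xyz \<Rightarrow> nat"
      let ?Y = "\<mu>(j := \<mu> j + 1)"
      have "spanned a D (\<lambda>v. mf ?e ?Y v - mf (\<lambda>_. 0) (\<lambda>i. ?Y i + (m - 1) * ?e i) v)"
      proof (rule red)
        have "(m - 1) dvd sz ?Y + (m - 1)" using szY[of j] dv by simp
        then show "(m - 1) dvd sz ?Y" by simp
        have "sz ?e = 1" using sz_upd[of "\<lambda>_. 0" j 1] by (simp add: sz_def)
        then show "sz ?e + sz ?Y div (m - 1) = D" using Dpos[of j] by simp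
      qed
      moreover have "(\<lambda>i. ?Y i + (m - 1) * ?e i) = \<mu>(j := \<mu> j + m)"
        using m by (auto simp: fun_eq_iff)
      moreover have "mf ?e ?Y v = A (nxt j) v - s * A (nxt (nxt j)) v" for v
      proof -
        have "mf ?e ?Y v = G j v * (V v ^ (sz ?Y div (m - 1)) * (v j * mn v \<mu>))"
          using mf_G[of "\<lambda>_. 0" j ?Y v] mn_upd[of v \<mu> j 1] by (simp add: mf_def)
        also have "\<dots> = V v ^ D * mn v \<mu> * (v (nxt j) ^ m - s * v (nxt (nxt j)) ^ m)"
          using Dpos[of j] by (simp add: G_def V_def prod_cyc[of _ j] pm mult_ac)
        finally have "mf ?e ?Y v = V v ^ D * mn v \<mu> * (v (nxt j) ^ m - s * v (nxt (nxt j)) ^ m)" .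
        moreover have "A k v = V v ^ D * (v k ^ m * mn v \<mu>)" for k
          unfolding A_def mf_def szm D mn_upd by simp
        ultimately show ?thesis by (simp only: right_diff_distrib mult_ac)
      qed
      ultimately show ?thesis by (simp add: A_def)
    qed
    define R where "R j v = A (nxt j) v - s * A (nxt (nxt j)) v - A j v" for j v
    have R': "spanned a D (R j)" for j using R[of j] unfolding R_def .
    \<comment> \<open>The linear system solved: for even m, R_i + R_{i+1} = -2 A_i; for odd m,
      R_{i+1} + R_{i+2} = 2 A_i.\<close>
    have "A i v = (if even m then - 1/2 * R i v + (- 1/2) * R (nxt i) v
       else 1/2 * R (nxt i) v + 1/2 * R (nxt (nxt i)) v)" for v
      by (auto simp: R_def s_def field_simps)
    moreover have "spanned a D (\<lambda>v. if even m then - 1/2 * R i v + (- 1/2) * R (nxt i) v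
       else 1/2 * R (nxt i) v + 1/2 * R (nxt (nxt i)) v)"
      by (cases "even m"; simp only: if_True if_False not_not simp_thms; intro sp_add sp_scale R')
    ultimately show ?thesis unfolding \<sigma> by (rule sp_cong[rotated])
  next
    case False
    then have lt: "\<sigma> i \<le> m - 1" for i by (metis Suc_pred' m1 not_less_eq_eq diff_Suc_1 less_imp_Suc_add Suc_diff_1 leI less_Suc_eq_le zero_less_diff le_antisym nat_le_linear)
    define p where "p = {i. \<sigma> i = m - 1}"
    show ?thesis
    proof (cases "p = UNIV")
      case False
      \<comment> \<open>Every exponent m - 1 is a factor \<open>H i\<close>, which
        \<open>red\<close> exchanges for \<open>G i\<close>. The exponents left over are below m -
        1, so the pair lies in \<open>core\<close>.\<close>
      define \<alpha> where "\<alpha> i = (if i \<in> p then 0 else \<sigma> i)" for i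
      let ?e = "(\<lambda>i. if i \<in> p then 1 else 0) :: xyz \<Rightarrow> nat"
      have \<sigma>: "\<sigma> = (\<lambda>i. \<alpha> i + (m - 1) * ?e i)" by (auto simp: \<alpha>_def p_def fun_eq_iff)
      then have "sz \<sigma> = sz \<alpha> + (m - 1) * sz ?e" using sz_add sz_mult by metis
      moreover have sze: "sz ?e = card p" unfolding sz_def by (simp add: sum.If_cases)
      ultimately have sz\<sigma>: "sz \<sigma> = sz \<alpha> + (m - 1) * card p" by simp
      have "(m - 1) dvd sz \<alpha>" using dv unfolding sz\<sigma> by (simp add: dvd_add_left_iff)
      moreover have "sz \<sigma> div (m - 1) = card p + sz \<alpha> div (m - 1)" unfolding sz\<sigma> using m1 by simp
      moreover have "\<alpha> i < m - 1" for i using lt[of i] m1 by (auto simp: \<alpha>_def p_def)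
      moreover have "\<forall>i\<in>p. \<alpha> i = 0" by (simp add: \<alpha>_def)
      ultimately have c: "((p, \<alpha>), \<lambda>_. 0) \<in> Idx D" and r: "(m - 1) dvd sz \<alpha>" "sz ?e + sz \<alpha> div (m - 1) = D"
        using False D sze by (auto simp: Idx_def core_def dg_def sz_def)
      have "Bf a ((p, \<alpha>), \<lambda>_. 0) v = mf ?e \<alpha> v" for v by (simp add: Bf_def)
      then have "mf (\<lambda>_. 0) \<sigma> v = Bf a ((p, \<alpha>), \<lambda>_. 0) v - (mf ?e \<alpha> v - mf (\<lambda>_. 0) \<sigma> v)" for v by simp
      moreover have "spanned a D (\<lambda>v. Bf a ((p, \<alpha>), \<lambda>_. 0) v - (mf ?e \<alpha> v - mf (\<lambda>_. 0) \<sigma> v))"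
        using sp_diff[OF sp_B[OF c, of a] red[OF r]] unfolding \<sigma>[symmetric] .
      ultimately show ?thesis by (rule sp_cong[rotated])
    next
      case True
      then have \<sigma>: "\<sigma> = (\<lambda>_. m - 1)" by (auto simp: p_def)
      have szs: "sz \<sigma> = (m - 1) * 3" by (simp add: \<sigma> sz_def UNIV_xyz)
      then have D3: "D = 3" using D m1 by simp
      have W: "mf (\<lambda>_. 0) \<sigma> v = H IX v * H IY v * H IZ v" for v
        unfolding \<sigma> using szs by (simp add: mf_def \<sigma> D3 D H_def mn_def prod_cyc[of _ IX] power3_eq_cube mult_ac)
          (use m1 in \<open>simp add: power3_eq_cube mult_ac\<close>)
      have q: "spanned a D (\<lambda>v. (\<Prod>i\<in>UNIV. if i \<in> q then G i v else H i v) - mf (\<lambda>_. 0) \<sigma> v)" for q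
      proof -
        let ?e = "(\<lambda>i. if i \<in> q then 1 else 0) :: xyz \<Rightarrow> nat"
        let ?s = "(\<lambda>i. if i \<in> q then 0 else m - 1) :: xyz \<Rightarrow> nat"
        have szq: "sz ?s = (m - 1) * card (- q)"
          unfolding sz_def by (simp add: sum.If_cases Compl_eq_Diff_UNIV)
        have cq: "card q + card (- q) = 3"
          using card_Un_disjoint[of q "- q"] by (simp add: UNIV_xyz)
        have sze: "sz ?e = card q" unfolding sz_def by (simp add: sum.If_cases)
        have "spanned a D (\<lambda>v. mf ?e ?s v - mf (\<lambda>_. 0) (\<lambda>i. ?s i + (m - 1) * ?e i) v)"
          using cq m1 by (intro red) (auto simp: szq sze D3)
        moreover have "(\<lambda>i. ?s i + (m - 1) * ?e i) = \<sigma>" by (auto simp: \<sigma>)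
        moreover have "mf ?e ?s v = (\<Prod>i\<in>UNIV. if i \<in> q then G i v else H i v)" for v
        proof -
          have "V v ^ card (- q) = (\<Prod>i\<in>UNIV. if i \<in> q then 1 else V v)"
            by (simp add: prod.If_cases)
          then show ?thesis unfolding mf_def szq mn_def using m1
            by (simp add: prod.distrib[symmetric]) (rule prod.cong, auto simp: H_def)
        qed
        ultimately show ?thesis by simp
      qed
      define T where "T q v = (\<Prod>i\<in>UNIV. if i \<in> q then G i v else H i v) - mf (\<lambda>_. 0) \<sigma> v" for q v
      have T: "spanned a D (T q)" for q using q[of q] unfolding T_def .
      \<comment> \<open>For odd m the cubic relation makes the combination in brackets equal to 4
        H_x H_y H_z; for even m it makes the corresponding sum equal to -4 H_x H_y H_z.\<close>
      have "mf (\<lambda>_. 0) \<sigma> v = (if odd m then 1/4 * (T UNIV v + (-1) * (T {IX} v + T {IY} v + T {IZ} v))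
        else - 1/4 * (T UNIV v + (T {IX} v + T {IY} v + T {IZ} v)))" for v
        using cubic_relation[of v] cubic_relation_even[of v]
        by (auto simp: T_def W prod_cyc[of _ IX] field_simps)
      moreover have "spanned a D (\<lambda>v. if odd m then 1/4 * (T UNIV v + (-1) * (T {IX} v + T {IY} v + T {IZ} v))
        else - 1/4 * (T UNIV v + (T {IX} v + T {IY} v + T {IZ} v)))"
        by (cases "odd m"; simp only: if_True if_False not_not simp_thms; intro sp_add sp_scale T)
      ultimately show ?thesis by (rule sp_cong[rotated])
    qed
  qed
  let ?s = "\<lambda>i. \<sigma> i + (m - 1) * e i"
  have s: "sz ?s = sz \<sigma> + (m - 1) * sz e" using sz_add sz_mult by metis
  have "spanned a D (mf (\<lambda>_. 0) ?s)"
  proof (rule zero)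
    show "(m - 1) dvd sz ?s" unfolding s using less.prems(1) by simp
    show "sz ?s div (m - 1) = D" unfolding s using less.prems(2) m1 by (simp only: div_mult_self2)
  qed
  from sp_add[OF red[OF less.prems] this] show ?case by (rule sp_cong) simp
qed

end

section \<open>Independence of the normal forms\<close>

text \<open>Because the exponents are distinct, the c_j are the coefficients of a univariate
  polynomial, and this polynomial has infinitely many roots. All separation of terms below is
  reduced to this.\<close>

lemma power_sum_eq_0:
  fixes c :: "'a \<Rightarrow> complex"
  assumes "finite A" "inj_on n A" "infinite T" "\<And>t. t \<in> T \<Longrightarrow> (\<Sum>j\<in>A. c j * t ^ n j) = 0" "j \<in> A"
  shows "c j = 0"
proof -
  define p where "p = (\<Sum>j\<in>A. Polynomial.monom (c j) (n j))"
  have "p = 0"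
  proof (rule ccontr)
    assume "p \<noteq> 0"
    then have "finite {t. poly p t = 0}" by (rule poly_roots_finite)
    moreover have "T \<subseteq> {t. poly p t = 0}" using assms(4) by (auto simp: p_def poly_sum poly_monom)
    ultimately show False using assms(3) finite_subset by blast
  qed
  have "Polynomial.coeff p (n j) = (\<Sum>k\<in>A. if n k = n j then c k else 0)"
    by (simp add: p_def coeff_sum)
  also have "\<dots> = (\<Sum>k\<in>A. if k = j then c k else 0)"
    using assms(2,5) by (intro sum.cong) (auto dest: inj_onD)
  also have "\<dots> = c j" using assms(1,5) by simp
  finally show ?thesis using \<open>p = 0\<close> by simp
qed

text \<open>Allows a power of x to be cancelled from an identity and x to be set to 0
  afterwards.\<close>

lemma cont_eq_0:
  fixes f :: "complex \<Rightarrow> complex"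
  assumes "isCont f 0" "\<And>x. x \<noteq> 0 \<Longrightarrow> f x = 0"
  shows "f 0 = 0"
proof -
  have "(f \<longlongrightarrow> f 0) (at 0)" using assms(1) by (simp add: isCont_def)
  moreover have "(f \<longlongrightarrow> 0) (at 0)"
    by (rule tendsto_eventually) (use assms(2) in \<open>auto simp: eventually_at intro: exI[of _ 1]\<close>)
  ultimately show ?thesis by (rule tendsto_unique[rotated]) simp
qed

text \<open>A relation with c_z nonzero would eliminate \<open>B z\<close>, putting all the
  \<open>N j\<close> into the span of fewer functions than there are indices. Elimination then
  yields a nontrivial relation between the \<open>N j\<close>.\<close>

lemma independent_transfer:
  fixes N B :: "'j \<Rightarrow> 'v \<Rightarrow> complex"
  assumes I: "finite I"
    and M: "\<And>j v. j \<in> I \<Longrightarrow> N j v = (\<Sum>k\<in>I. M j k * B k v)"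
    and N: "\<And>x j. (\<And>v. (\<Sum>j\<in>I. x j * N j v) = 0) \<Longrightarrow> j \<in> I \<Longrightarrow> x j = 0"
    and B: "\<And>v. (\<Sum>j\<in>I. c j * B j v) = 0" and z: "z \<in> I"
  shows "c z = 0"
proof (rule ccontr)
  assume cz: "c z \<noteq> 0"
  let ?M = "\<lambda>j k. M j k - M j z * c k / c z"
  have "card (I - {z}) < card I" using I z by (rule card_Diff1_less)
  from underdetermined_system[OF _ I this, of ?M] I obtain x where x: "\<exists>j\<in>I. x j \<noteq> 0"
    "\<forall>k\<in>I - {z}. (\<Sum>j\<in>I. x j * ?M j k) = 0" by blast
  have "(\<Sum>j\<in>I. x j * ?M j k) = 0" if "k \<in> I" for k
    using x(2) that cz by (cases "k = z") auto
  then have 0: "(\<Sum>k\<in>I. (\<Sum>j\<in>I. x j * ?M j k) * B k v) = 0" for v by simp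
  have N': "N j v = (\<Sum>k\<in>I. ?M j k * B k v)" if "j \<in> I" for j v
  proof -
    have "(\<Sum>k\<in>I. ?M j k * B k v) = (\<Sum>k\<in>I. M j k * B k v) - M j z / c z * (\<Sum>k\<in>I. c k * B k v)"
    proof -
      have "?M j k * B k v = M j k * B k v - M j z / c z * (c k * B k v)" for k
        by (simp add: left_diff_distrib)
      then show ?thesis by (simp only: sum_subtractf sum_distrib_left)
    qed
    then show ?thesis using M[OF that] B by simp
  qed
  have "(\<Sum>j\<in>I. x j * N j v) = 0" for v
  proof -
    have "(\<Sum>j\<in>I. x j * N j v) = (\<Sum>j\<in>I. \<Sum>k\<in>I. x j * ?M j k * B k v)"
      by (intro sum.cong refl) (simp only: N' sum_distrib_left mult.assoc)
    also have "\<dots> = (\<Sum>k\<in>I. \<Sum>j\<in>I. x j * ?M j k * B k v)" by (rule sum.swap)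
    also have "\<dots> = 0" using 0[of v] by (simp only: sum_distrib_right)
    finally show ?thesis .
  qed
  then show False using N x(1) by blast
qed

context surf
begin

text \<open>Normal forms: the quadrics rewrite \<open>G\<^sub>i x y z \<lambda>\<close> when \<open>v\<^sub>i\<close> divides \<open>\<lambda>\<close>, and the cubic rewrites
  \<open>G\<^sub>x G\<^sub>y G\<^sub>z\<close>.\<close>

definition nf :: "((xyz \<Rightarrow> nat) \<times> (xyz \<Rightarrow> nat)) set" where
  "nf = {(e, \<sigma>). (\<forall>i. e i = 0 \<or> \<sigma> i = 0) \<and> (\<exists>i. e i = 0) \<and> (m - 1) dvd sz \<sigma>}"

definition deg2 :: "(xyz \<Rightarrow> nat) \<times> (xyz \<Rightarrow> nat) \<Rightarrow> nat" where
  "deg2 j = sz (fst j) + sz (snd j) div (m - 1)"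

text \<open>Setting \<open>v\<^sub>i = x\<close>, the function \<open>mf e \<sigma>\<close> of degree \<open>d\<close> vanishes to order exactly
  \<open>d + \<sigma> i - e i\<close> at \<open>x = 0\<close>.\<close>

lemma nf_independent_step:
  assumes A: "finite A" "A \<subseteq> {j \<in> nf. deg2 j = d}" and a: "a > 0" "\<And>j. j \<in> A \<Longrightarrow> fst j i \<le> a"
    and 0: "\<And>v. (\<Sum>j\<in>A. c j * mf (fst j) (snd j) v) = 0" and j: "j \<in> A" "fst j i = a"
  shows "c j = 0"
proof -
  let ?n = "nxt i" and ?o = "nxt (nxt i)"
  define s :: complex where "s = (- 1) ^ m"
  define k where "k j = sz (snd j) div (m - 1)" for j :: "(xyz \<Rightarrow> nat) \<times> (xyz \<Rightarrow> nat)"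
  have dvd: "sz (snd j) = (m - 1) * k j" if "j \<in> A" for j using A(2) that by (auto simp: nf_def k_def)
  have d: "fst j i + fst j ?n + fst j ?o + k j = d" if "j \<in> A" for j
    using A(2) that by (auto simp: deg2_def k_def sz_def[of "fst j"] sum_cyc[of _ i])
  \<comment> \<open>The test points have v_i = x, v_{i+1} = t and v_{i+2} = 1. \<open>st\<close> is
    the cofactor left when every power of x coming from the factors \<open>G\<close>, V and the
    monomial is pulled out.\<close>
  define st where "st j t x = (t * (t ^ m - s)) ^ fst j i * (1 - (- x) ^ m) ^ fst j ?n *
    (t * (x ^ m - (- t) ^ m)) ^ fst j ?o * t ^ (k j + snd j ?n)"
    for j :: "(xyz \<Rightarrow> nat) \<times> (xyz \<Rightarrow> nat)" and t x :: complex
  have mf: "mf (fst j) (snd j) ((\<lambda>_. 1)(i := x, ?n := t)) = x ^ (d - a) * (x ^ (a - fst j i + snd j i) * st j t x)"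
    if j: "j \<in> A" for j x t
  proof -
    let ?v = "(\<lambda>_. 1)(i := x, ?n := t)"
    have "G i ?v = t * (t ^ m - s)" "G ?n ?v = x * (1 - (- x) ^ m)" "G ?o ?v = x * (t * (x ^ m - (- t) ^ m))"
      "V ?v = x * t" "mn ?v (snd j) = x ^ snd j i * t ^ snd j ?n"
      by (simp_all add: G_def s_def V_def mn_def prod_cyc[of _ i])
    then have "mf (fst j) (snd j) ?v = (t * (t ^ m - s)) ^ fst j i * (x * (1 - (- x) ^ m)) ^ fst j ?n *
        (x * (t * (x ^ m - (- t) ^ m))) ^ fst j ?o * (x * t) ^ k j * (x ^ snd j i * t ^ snd j ?n)"
      by (simp add: mf_def prod_cyc[of _ i] k_def)
    also have "\<dots> = (x ^ fst j ?n * x ^ fst j ?o * x ^ k j * x ^ snd j i) * st j t x"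
      unfolding power_mult_distrib[of x] st_def power_add by (simp only: mult_ac)
    also have "x ^ fst j ?n * x ^ fst j ?o * x ^ k j * x ^ snd j i = x ^ (d - a) * x ^ (a - fst j i + snd j i)"
      unfolding power_add[symmetric] using d[OF j] a(2)[OF j] d[OF assms(6)] assms(7)
      by (intro arg_cong[of _ _ "\<lambda>n. x ^ n"]) linarith
    finally show ?thesis by (simp only: mult.assoc)
  qed
  define A' where "A' = {j \<in> A. fst j i = a}"
  have fA': "finite A'" "j \<in> A'" using A j by (auto simp: A'_def)
  define n where "n j = (m + 1) * fst j ?o + k j + snd j ?n" for j :: "(xyz \<Rightarrow> nat) \<times> (xyz \<Rightarrow> nat)"
  have lead: "(\<Sum>j\<in>A'. (c j * (- s) ^ fst j ?o) * t ^ n j) = 0" if t: "t \<noteq> 0" "t ^ m \<noteq> s" for t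
  proof -
    let ?f = "\<lambda>x. \<Sum>j\<in>A. c j * (x ^ (a - fst j i + snd j i) * st j t x)"
    have "?f 0 = 0"
    proof (rule cont_eq_0)
      show "isCont ?f 0" unfolding st_def by (intro continuous_intros)
      fix x :: complex assume x: "x \<noteq> 0"
      have "x ^ (d - a) * ?f x = (\<Sum>j\<in>A. c j * mf (fst j) (snd j) ((\<lambda>_. 1)(i := x, ?n := t)))"
        unfolding sum_distrib_left by (intro sum.cong refl) (simp only: mf mult.left_commute)
      then have "x ^ (d - a) * ?f x = 0" using 0 by simp
      then show "?f x = 0" using x by simp
    qed
    also have "?f 0 = (\<Sum>j\<in>A'. c j * (0 ^ (a - fst j i + snd j i) * st j t 0))"
    proof (rule sum.mono_neutral_right)
      show "finite A" "A' \<subseteq> A" using A by (auto simp: A'_def)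
      show "\<forall>j\<in>A - A'. c j * (0 ^ (a - fst j i + snd j i) * st j t 0) = 0"
      proof
        fix j assume "j \<in> A - A'"
        then have "a - fst j i + snd j i \<noteq> 0" using a(2)[of j] by (auto simp: A'_def)
        then have "(0::complex) ^ (a - fst j i + snd j i) = 0" by (simp only: zero_power neq0_conv)
        then show "c j * (0 ^ (a - fst j i + snd j i) * st j t 0) = 0"
          by (simp only: mult_zero_left mult_zero_right)
      qed
    qed
    also have "\<dots> = (\<Sum>j\<in>A'. (t * (t ^ m - s)) ^ a * ((c j * (- s) ^ fst j ?o) * t ^ n j))"
    proof (intro sum.cong refl)
      fix j assume jA: "j \<in> A'"
      then have "j \<in> nf" using A by (auto simp: A'_def)
      then have "fst j i = 0 \<or> snd j i = 0" by (simp add: nf_def case_prod_unfold)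
      then have "snd j i = 0" using a(1) jA by (simp add: A'_def)
      moreover have "(- t) ^ m = s * t ^ m" unfolding s_def by (rule power_minus)
      moreover have "(0::complex) ^ m = 0" using m by (simp add: zero_power)
      ultimately have "0 ^ (a - fst j i + snd j i) * st j t 0 =
          (t * (t ^ m - s)) ^ a * (t * ((- s) * t ^ m)) ^ fst j ?o * t ^ (k j + snd j ?n)"
        using jA m by (simp add: st_def A'_def power_0_left)
      also have "\<dots> = (t * (t ^ m - s)) ^ a * ((- s) ^ fst j ?o * t ^ n j)"
      proof -
        have "t * ((- s) * t ^ m) = (- s) * t ^ (m + 1)" by simp
        then have "(t * ((- s) * t ^ m)) ^ fst j ?o = (- s) ^ fst j ?o * t ^ ((m + 1) * fst j ?o)"
          by (simp only: power_mult_distrib power_mult)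
        then show ?thesis by (simp only: n_def power_add mult_ac)
      qed
      finally show "c j * (0 ^ (a - fst j i + snd j i) * st j t 0) =
          (t * (t ^ m - s)) ^ a * ((c j * (- s) ^ fst j ?o) * t ^ n j)" by (simp only: mult_ac)
    qed
    also have "\<dots> = (t * (t ^ m - s)) ^ a * (\<Sum>j\<in>A'. (c j * (- s) ^ fst j ?o) * t ^ n j)"
      by (simp only: sum_distrib_left)
    finally show ?thesis using t by auto
  qed
  have inj: "inj_on n A'"
  proof (rule inj_onI)
    fix j j' assume jj: "j \<in> A'" "j' \<in> A'" and eq: "n j = n j'"
    define q where "q = d - a"
    obtain m' where m': "m = Suc m'" using m by (cases m) auto
    have data: "fst j i = a" "snd j i = 0" "fst j ?n + fst j ?o + k j = q" "snd j ?n + snd j ?o = m' * k j"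
      "fst j ?n = 0 \<or> snd j ?n = 0" "fst j ?o = 0 \<or> snd j ?o = 0" "fst j ?n = 0 \<or> fst j ?o = 0"
      if "j \<in> A'" for j
    proof -
      have jA: "j \<in> A" "fst j i = a" "j \<in> nf" using that A by (auto simp: A'_def)
      show "fst j i = a" by fact
      have e: "\<forall>l. fst j l = 0 \<or> snd j l = 0" "\<exists>l. fst j l = 0" using jA(3) by (auto simp: nf_def)
      show s0: "snd j i = 0" using e(1)[rule_format, of i] a(1) jA(2) by auto
      show "fst j ?n + fst j ?o + k j = q" using d[OF jA(1)] jA(2) by (simp add: q_def)
      show "snd j ?n + snd j ?o = m' * k j"
        using dvd[OF jA(1)] s0 by (simp add: sz_def sum_cyc[of _ i] m')
      show "fst j ?n = 0 \<or> snd j ?n = 0" "fst j ?o = 0 \<or> snd j ?o = 0" by (rule e(1)[rule_format])+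
      show "fst j ?n = 0 \<or> fst j ?o = 0"
      proof -
        obtain l where l: "fst j l = 0" using e(2) by (rule exE)
        moreover have "l \<in> {i, ?n, ?o}" using UNIV_cyc[of i] by (metis UNIV_I)
        moreover have "l \<noteq> i" using l a(1) jA(2) by auto
        ultimately show ?thesis by auto
      qed
    qed
    \<comment> \<open>As e_i > 0, at most one of the other two exponents of \<open>G\<close> is
      positive. The three resulting cases occupy disjoint ranges of \<open>n\<close>: below q, above
      m q, and from q to m q.\<close>
    have n: "n j = (if fst j ?n > 0 then k j else if fst j ?o > 0 then m * q + fst j ?o else q + snd j ?n)"
      if "j \<in> A'" for j
    proof -
      consider "fst j ?n > 0" | "fst j ?n = 0" "fst j ?o > 0" | "fst j ?n = 0" "fst j ?o = 0" by auto
      then show ?thesis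
      proof cases
        case 2
        then have "snd j ?n = m' * k j" "q = fst j ?o + k j" using data[OF that] by auto
        with 2 show ?thesis by (simp add: n_def m' algebra_simps)
      qed (use data[OF that] in \<open>auto simp: n_def\<close>)
    qed
    have bnd: "snd j ?n \<le> m' * q" "fst j ?n > 0 \<longrightarrow> k j < q" if "j \<in> A'" for j
    proof -
      have "m' * k j \<le> m' * q" using data(3)[OF that] by (intro mult_left_mono) auto
      then show "snd j ?n \<le> m' * q" using data(4)[OF that] by linarith
    qed (use data(3)[OF that] in auto)
    have mq: "m * q = q + m' * q" by (simp add: m')
    have sgn: "fst j ?n > 0 \<longleftrightarrow> fst j' ?n > 0" "fst j ?o > 0 \<longleftrightarrow> fst j' ?o > 0"
      using eq[unfolded n[OF jj(1)] n[OF jj(2)]] bnd[OF jj(1)] bnd[OF jj(2)] mq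
        data(7)[OF jj(1)] data(7)[OF jj(2)] by (auto split: if_splits)
    have "fst j ?n = fst j' ?n \<and> fst j ?o = fst j' ?o \<and> snd j ?n = snd j' ?n \<and> snd j ?o = snd j' ?o"
    proof -
      consider "fst j ?n > 0" | "fst j ?n = 0" "fst j ?o > 0" | "fst j ?n = 0" "fst j ?o = 0" by auto
      then show ?thesis
      proof cases
        case 1
        then have "k j = k j'" using eq sgn n[OF jj(1)] n[OF jj(2)] by simp
        then show ?thesis using 1 sgn data(3-7)[OF jj(1)] data(3-7)[OF jj(2)] by auto
      next
        case 2
        then have "fst j ?o = fst j' ?o" using eq sgn n[OF jj(1)] n[OF jj(2)] by simp
        moreover from this have "k j = k j'" using 2 sgn data(3)[OF jj(1)] data(3)[OF jj(2)] by auto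
        ultimately show ?thesis using 2 sgn data(3-7)[OF jj(1)] data(3-7)[OF jj(2)] by auto
      next
        case 3
        then have "snd j ?n = snd j' ?n" using eq sgn n[OF jj(1)] n[OF jj(2)] by simp
        moreover have "k j = k j'" using 3 sgn data(3)[OF jj(1)] data(3)[OF jj(2)] by auto
        ultimately show ?thesis using 3 sgn data(3-7)[OF jj(1)] data(3-7)[OF jj(2)] by auto
      qed
    qed
    then have "\<forall>l. fst j l = fst j' l \<and> snd j l = snd j' l"
      unfolding all_cyc[of _ i] using data(1,2)[OF jj(1)] data(1,2)[OF jj(2)] by simp
    then show "j = j'" by (simp add: prod_eq_iff fun_eq_iff)
  qed
  have "c j * (- s) ^ fst j ?o = 0"
  proof (rule power_sum_eq_0[OF fA'(1) inj _ _ fA'(2)])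
    show "infinite (range (\<lambda>k. of_nat (k + 2) :: complex))"
      by (rule range_inj_infinite) (simp add: inj_on_def)
  next
    fix t :: complex assume "t \<in> range (\<lambda>k. of_nat (k + 2))"
    then obtain l where t: "t = of_nat (l + 2)" by blast
    have nt: "norm t = real (l + 2)" unfolding t by (rule norm_of_nat)
    have "norm (t ^ m) > 1" unfolding norm_power nt using m by (intro one_less_power) auto
    moreover have "norm s = 1" unfolding s_def by (simp add: norm_power)
    ultimately have "t ^ m \<noteq> s" by auto
    moreover have "t \<noteq> 0" using nt by auto
    ultimately show "(\<Sum>j\<in>A'. (c j * (- s) ^ fst j ?o) * t ^ n j) = 0" by (intro lead)
  qed
  then show ?thesis by (simp add: s_def)
qed

text \<open>A factor \<open>G i\<close> in a term with nonzero coefficient is excluded by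
  \<open>nf_independent_step\<close>, applied to the largest e_i that occurs. Only the functions V^d
  v^sigma remain, and these are distinct monomials.\<close>

lemma nf_independent_degree:
  assumes A: "finite A" "A \<subseteq> {j \<in> nf. deg2 j = d}"
    and 0: "\<And>v. (\<Sum>j\<in>A. c j * mf (fst j) (snd j) v) = 0" and j: "j \<in> A"
  shows "c j = 0"
proof (rule ccontr)
  assume cj: "c j \<noteq> 0"
  define A' where "A' = {j \<in> A. c j \<noteq> 0}"
  have A': "finite A'" "A' \<subseteq> {j \<in> nf. deg2 j = d}" "j \<in> A'" using A j cj by (auto simp: A'_def)
  have "(\<Sum>j\<in>A'. c j * mf (fst j) (snd j) v) = (\<Sum>j\<in>A. c j * mf (fst j) (snd j) v)" for v
    by (rule sum.mono_neutral_left) (use A in \<open>auto simp: A'_def\<close>)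
  then have 0: "(\<Sum>j\<in>A'. c j * mf (fst j) (snd j) v) = 0" for v using 0 by simp
  have e0: "fst j i = 0" if "j \<in> A'" for i j
  proof (rule ccontr)
    assume pos: "fst j i \<noteq> 0"
    define a where "a = Max ((\<lambda>j. fst j i) ` A')"
    have ge: "fst l i \<le> a" if "l \<in> A'" for l unfolding a_def using A'(1) that by simp
    have "a \<in> (\<lambda>j. fst j i) ` A'" unfolding a_def using A' by (intro Max_in) auto
    then obtain l where l: "l \<in> A'" "fst l i = a" by auto
    have "a > 0" using ge[OF that] pos by simp
    then have "c l = 0" by (rule nf_independent_step[OF A'(1,2) _ ge 0 l])
    then show False using l by (simp add: A'_def)
  qed
  \<comment> \<open>Kronecker substitution x = t, y = t^M, z = 1: as M exceeds every exponent of x,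
    the triple sigma is recovered from sigma_x + M sigma_y and the fixed total degree.\<close>
  define M where "M = (m - 1) * d + 1"
  define n where "n l = (M + 1) * d + (snd l IX + M * snd l IY)" for l :: "(xyz \<Rightarrow> nat) \<times> (xyz \<Rightarrow> nat)"
  have szA: "sz (snd l) = (m - 1) * d" "sz (snd l) div (m - 1) = d" if "l \<in> A'" for l
  proof -
    have "fst l = (\<lambda>_. 0)" using e0[OF that] by (simp add: fun_eq_iff)
    then have "sz (fst l) = 0" by (simp add: sz_eq_0)
    then show "sz (snd l) div (m - 1) = d" using A'(2) that by (auto simp: deg2_def)
    then show "sz (snd l) = (m - 1) * d" using A'(2) that by (auto simp: nf_def)
  qed
  have "c j = 0"
  proof (rule power_sum_eq_0[where T = UNIV and n = n, OF A'(1) _ infinite_UNIV_char_0 _ A'(3)])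
    show "inj_on n A'"
    proof (rule inj_onI)
      fix j l assume jl: "j \<in> A'" "l \<in> A'" "n j = n l"
      have lt: "snd l IX < M" if "l \<in> A'" for l
        using le_sz[of "snd l" IX] szA(1)[OF that] by (simp add: M_def)
      have eq: "snd j IX + M * snd j IY = snd l IX + M * snd l IY" using jl(3) by (simp add: n_def)
      then have "(snd j IX + M * snd j IY) mod M = (snd l IX + M * snd l IY) mod M" by simp
      then have x: "snd j IX = snd l IX" using lt[OF jl(1)] lt[OF jl(2)] by simp
      moreover have y: "snd j IY = snd l IY"
      proof -
        have "M * snd j IY = M * snd l IY" using eq x by simp
        moreover have "M > 0" by (simp add: M_def)
        ultimately show ?thesis by (metis nat_mult_eq_cancel1)
      qed
      moreover have "snd j IZ = snd l IZ"
        using szA(1)[OF jl(1)] szA(1)[OF jl(2)] x y by (simp add: sz_def UNIV_xyz)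
      ultimately have "snd j = snd l" using all_cyc[of "\<lambda>i. snd j i = snd l i" IX] by (simp add: fun_eq_iff)
      moreover have "fst j = fst l" using e0[OF jl(1)] e0[OF jl(2)] by (simp add: fun_eq_iff)
      ultimately show "j = l" by (simp add: prod_eq_iff)
    qed
  next
    fix t :: complex
    let ?v = "\<lambda>i. case i of IX \<Rightarrow> t | IY \<Rightarrow> t ^ M | IZ \<Rightarrow> 1"
    have "mf (fst l) (snd l) ?v = t ^ n l" if "l \<in> A'" for l
    proof -
      have "mf (fst l) (snd l) ?v = V ?v ^ d * mn ?v (snd l)"
        using szA[OF that] e0[OF that] by (simp add: mf_def)
      also have "\<dots> = (t * t ^ M) ^ d * (t ^ snd l IX * (t ^ M) ^ snd l IY)"
        by (simp add: V_def mn_def prod_cyc[of _ IX])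
      also have "t * t ^ M = t ^ (M + 1)" by simp
      finally show ?thesis by (simp add: n_def power_mult[symmetric] power_add[symmetric] mult_ac del: power_Suc)
    qed
    then have "(\<Sum>l\<in>A'. c l * t ^ n l) = (\<Sum>l\<in>A'. c l * mf (fst l) (snd l) ?v)"
      by (intro sum.cong refl) simp
    then show "(\<Sum>l\<in>A'. c l * t ^ n l) = 0" using 0 by simp
  qed
  then show False using cj by simp
qed

lemma mf_scale:
  assumes "(m - 1) dvd sz \<sigma>"
  shows "mf e \<sigma> (\<lambda>i. t * v i) = t ^ ((m + 2) * deg2 (e, \<sigma>)) * mf e \<sigma> v"
proof -
  define k where "k = sz \<sigma> div (m - 1)"
  have k: "sz \<sigma> = (m - 1) * k" using assms by (simp add: k_def)
  have G: "G i (\<lambda>i. t * v i) = t ^ (m + 2) * G i v" for i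
    by (simp add: G_def power_mult_distrib power_add algebra_simps power2_eq_square flip: power_mult_distrib[of "-1"] mult_minus_right)
  have V: "V (\<lambda>i. t * v i) = t ^ 3 * V v" by (simp add: V_def prod.distrib UNIV_xyz power3_eq_cube)
  have mn: "mn (\<lambda>i. t * v i) \<sigma> = t ^ sz \<sigma> * mn v \<sigma>"
    by (simp add: mn_def power_mult_distrib prod.distrib sz_def power_sum)
  have "mf e \<sigma> (\<lambda>i. t * v i) = (\<Prod>i\<in>UNIV. (t ^ (m + 2)) ^ e i) * (t ^ 3) ^ k * t ^ sz \<sigma> * mf e \<sigma> v"
    by (simp only: mf_def G V mn power_mult_distrib prod.distrib k_def[symmetric] mult_ac)
  also have "(\<Prod>i\<in>UNIV. (t ^ (m + 2)) ^ e i) = t ^ ((m + 2) * sz e)"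
    by (simp only: sz_def power_sum[symmetric] power_mult)
  also have "t ^ ((m + 2) * sz e) * (t ^ 3) ^ k * t ^ sz \<sigma> = t ^ ((m + 2) * sz e + 3 * k + sz \<sigma>)"
    by (simp only: power_add power_mult)
  also have "(m + 2) * sz e + 3 * k + sz \<sigma> = (m + 2) * deg2 (e, \<sigma>)"
  proof -
    have "3 + (m - 1) = m + 2" using m by simp
    then have "3 * k + (m - 1) * k = (m + 2) * k" by (metis distrib_right)
    moreover have "deg2 (e, \<sigma>) = sz e + k" by (simp add: deg2_def k_def)
    ultimately show ?thesis unfolding k by (simp only: distrib_left)
  qed
  finally show ?thesis .
qed

text \<open>Scaling v by t multiplies the terms of degree d by t^((m+2) d), which splits a relation
  into its homogeneous parts.\<close>

lemma nf_independent:
  assumes A: "finite A" "A \<subseteq> nf"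
    and 0: "\<And>v. (\<Sum>j\<in>A. c j * mf (fst j) (snd j) v) = 0" and j: "j \<in> A"
  shows "c j = 0"
proof -
  have part: "(\<Sum>j | j \<in> A \<and> deg2 j = d. c j * mf (fst j) (snd j) v) = 0" if d: "d \<in> deg2 ` A" for d v
  proof (rule power_sum_eq_0[where A = "deg2 ` A" and n = "\<lambda>d. (m + 2) * d" and T = UNIV and j = d
      and c = "\<lambda>d. \<Sum>j | j \<in> A \<and> deg2 j = d. c j * mf (fst j) (snd j) v"])
    show "finite (deg2 ` A)" using A by simp
    show "inj_on (\<lambda>d. (m + 2) * d) (deg2 ` A)"
    proof (rule inj_onI)
      fix x y assume "(m + 2) * x = (m + 2) * y"
      moreover have "m + 2 > 0" by simp
      ultimately show "x = y" by (metis nat_mult_eq_cancel1)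
    qed
    show "infinite (UNIV :: complex set)" by (rule infinite_UNIV_char_0)
    show "d \<in> deg2 ` A" by fact
    fix t :: complex
    have "(\<Sum>d\<in>deg2 ` A. (\<Sum>j | j \<in> A \<and> deg2 j = d. c j * mf (fst j) (snd j) v) * t ^ ((m + 2) * d)) =
      (\<Sum>d\<in>deg2 ` A. \<Sum>j | j \<in> A \<and> deg2 j = d. c j * mf (fst j) (snd j) (\<lambda>i. t * v i))"
    proof (intro sum.cong refl)
      fix d
      have "mf (fst j) (snd j) (\<lambda>i. t * v i) = t ^ ((m + 2) * d) * mf (fst j) (snd j) v"
        if "j \<in> A" "deg2 j = d" for j
        using mf_scale[of "snd j" "fst j" t v] A(2) that by (auto simp: nf_def)
      then show "(\<Sum>j | j \<in> A \<and> deg2 j = d. c j * mf (fst j) (snd j) v) * t ^ ((m + 2) * d) =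
        (\<Sum>j | j \<in> A \<and> deg2 j = d. c j * mf (fst j) (snd j) (\<lambda>i. t * v i))"
        unfolding sum_distrib_right by (intro sum.cong refl) simp
    qed
    also have "\<dots> = (\<Sum>j\<in>A. c j * mf (fst j) (snd j) (\<lambda>i. t * v i))"
      using sum.image_gen[OF A(1), of "\<lambda>j. c j * mf (fst j) (snd j) (\<lambda>i. t * v i)" deg2] by simp
    finally show "(\<Sum>d\<in>deg2 ` A. (\<Sum>j | j \<in> A \<and> deg2 j = d. c j * mf (fst j) (snd j) v) * t ^ ((m + 2) * d)) = 0"
      using 0 by simp
  qed
  show ?thesis
    by (rule nf_independent_degree[of "{l \<in> A. deg2 l = deg2 j}" "deg2 j" c, OF _ _ part]) (use A j in auto)
qed

text \<open>Each factor sl_i of a basis function is traded for G_i if i lies in the set component,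
  and for H_i otherwise. The result is a normal form of the same degree, which matches the two
  families index by index.\<close>

definition nf_of :: "(xyz set \<times> (xyz \<Rightarrow> nat)) \<times> (xyz \<Rightarrow> nat) \<Rightarrow> (xyz \<Rightarrow> nat) \<times> (xyz \<Rightarrow> nat)" where
  "nf_of j = ((\<lambda>i. if i \<in> fst (fst j) then snd j i + 1 else 0),
     (\<lambda>i. if i \<in> fst (fst j) then 0 else snd (fst j) i + (m - 1) * snd j i))"

text \<open>The set is where the first component is positive. Off this set alpha_i and epsilon_i are
  remainder and quotient of the second component by m - 1, as alpha_i < m - 1.\<close>

lemma inj_nf_of: "inj_on nf_of {j. fst j \<in> core}"
proof (rule inj_onI)
  fix j l assume jl: "j \<in> {j. fst j \<in> core}" "l \<in> {j. fst j \<in> core}" "nf_of j = nf_of l"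
  obtain p \<alpha> \<epsilon> q \<beta> \<delta> where j: "j = ((p, \<alpha>), \<epsilon>)" and l: "l = ((q, \<beta>), \<delta>)" by (metis surj_pair)
  have e: "(if i \<in> p then \<epsilon> i + 1 else 0) = (if i \<in> q then \<delta> i + 1 else 0)"
    and s: "(if i \<in> p then 0 else \<alpha> i + (m - 1) * \<epsilon> i) = (if i \<in> q then 0 else \<beta> i + (m - 1) * \<delta> i)" for i
  proof -
    have "fst (nf_of j) i = fst (nf_of l) i" "snd (nf_of j) i = snd (nf_of l) i" using jl(3) by simp_all
    then show "(if i \<in> p then \<epsilon> i + 1 else 0) = (if i \<in> q then \<delta> i + 1 else 0)"
      "(if i \<in> p then 0 else \<alpha> i + (m - 1) * \<epsilon> i) = (if i \<in> q then 0 else \<beta> i + (m - 1) * \<delta> i)"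
      by (simp_all only: nf_of_def j l fst_conv snd_conv)
  qed
  have pq: "i \<in> p \<longleftrightarrow> i \<in> q" for i using e[of i] by (auto split: if_splits)
  have c: "\<alpha> i < m - 1" "\<beta> i < m - 1" "i \<in> p \<longrightarrow> \<alpha> i = 0" "i \<in> q \<longrightarrow> \<beta> i = 0" for i
    using jl(1,2) by (auto simp: core_def j l)
  have "\<epsilon> i = \<delta> i \<and> \<alpha> i = \<beta> i" for i
  proof (cases "i \<in> p")
    case True
    then show ?thesis using e[of i] pq c by simp
  next
    case False
    then have eq: "\<alpha> i + (m - 1) * \<epsilon> i = \<beta> i + (m - 1) * \<delta> i" using s[of i] pq by simp
    then have "(\<alpha> i + (m - 1) * \<epsilon> i) mod (m - 1) = (\<beta> i + (m - 1) * \<delta> i) mod (m - 1)" by simp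
    then have "\<alpha> i = \<beta> i" using c(1,2)[of i] by simp
    with eq m show ?thesis by simp
  qed
  then show "j = l" using pq unfolding j l by (auto simp: fun_eq_iff)
qed

lemma nf_of_nf:
  assumes "fst j \<in> core"
  shows "nf_of j \<in> nf" "deg2 (nf_of j) = dg (fst j) + sz (snd j)"
proof -
  obtain p \<alpha> \<epsilon> where j: "j = ((p, \<alpha>), \<epsilon>)" by (metis surj_pair)
  have c: "\<alpha> i < m - 1" "i \<in> p \<Longrightarrow> \<alpha> i = 0" "(m - 1) dvd sz \<alpha>" "p \<noteq> UNIV" for i
    using assms by (auto simp: core_def j)
  have nfj: "nf_of j = ((\<lambda>i. if i \<in> p then \<epsilon> i + 1 else 0),
      (\<lambda>i. if i \<in> p then 0 else \<alpha> i + (m - 1) * \<epsilon> i))"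
    unfolding nf_of_def j fst_conv snd_conv ..
  define x where "x = (\<Sum>i\<in>-p. \<epsilon> i)"
  have "sz (\<lambda>i. if i \<in> p then 0 else \<alpha> i + (m - 1) * \<epsilon> i) = sz (\<lambda>i. \<alpha> i + (m - 1) * (if i \<in> p then 0 else \<epsilon> i))"
    using c(2) by (intro arg_cong[of _ _ sz]) auto
  also have "\<dots> = sz \<alpha> + (m - 1) * sz (\<lambda>i. if i \<in> p then 0 else \<epsilon> i)"
    using sz_add[of \<alpha>] sz_mult by metis
  also have "sz (\<lambda>i. if i \<in> p then 0 else \<epsilon> i) = x"
    by (simp add: sz_def x_def sum.If_cases Compl_eq_Diff_UNIV)
  finally have s: "sz (\<lambda>i. if i \<in> p then 0 else \<alpha> i + (m - 1) * \<epsilon> i) = sz \<alpha> + (m - 1) * x" .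
  have "sz (\<lambda>i. if i \<in> p then \<epsilon> i + 1 else 0) = (\<Sum>i\<in>p. \<epsilon> i) + card p"
    by (simp add: sz_def sum.If_cases Compl_eq_Diff_UNIV sum.distrib sum_Suc)
  moreover have "sz \<epsilon> = (\<Sum>i\<in>p. \<epsilon> i) + x" unfolding sz_def x_def
    by (subst sum.union_disjoint[symmetric]) auto
  moreover have "(sz \<alpha> + (m - 1) * x) div (m - 1) = sz \<alpha> div (m - 1) + x" using m by simp
  ultimately show "deg2 (nf_of j) = dg (fst j) + sz (snd j)"
    unfolding deg2_def nfj fst_conv snd_conv s by (simp add: j dg_def)
  have "\<exists>i. i \<notin> p" using c(4) by auto
  then show "nf_of j \<in> nf" unfolding nf_def nfj using c(3) by (auto simp: s)
qed

text \<open>The normal forms matched with \<open>Idx d\<close> are independent, and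
  \<open>spanned_mf\<close> puts them into the span of the equally many functions
  \<open>Bf a j\<close>. With \<open>spanned_mf\<close> this says that the coordinate ring is free
  over the polynomial ring in the shifted linear forms.\<close>

lemma Bf_independent:
  assumes B: "\<And>v. (\<Sum>j\<in>Idx d. c j * Bf a j v) = 0" and j: "j \<in> Idx d"
  shows "c j = 0"
proof -
  have core: "fst j \<in> core" "dg (fst j) + sz (snd j) \<le> d" if "j \<in> Idx d" for j
    using that by (auto simp: Idx_def)
  have "\<exists>M. \<forall>j\<in>Idx d. \<forall>v. mf (fst (nf_of j)) (snd (nf_of j)) v = (\<Sum>k\<in>Idx d. M j k * Bf a k v)"
  proof -
    have "\<forall>j\<in>Idx d. \<exists>x. \<forall>v. mf (fst (nf_of j)) (snd (nf_of j)) v = (\<Sum>k\<in>Idx d. x k * Bf a k v)"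
    proof
      fix j assume j: "j \<in> Idx d"
      have "spanned a (deg2 (nf_of j)) (mf (fst (nf_of j)) (snd (nf_of j)))"
        using nf_of_nf(1)[OF core(1)[OF j]] by (intro spanned_mf) (auto simp: nf_def deg2_def)
      then have "spanned a d (mf (fst (nf_of j)) (snd (nf_of j)))"
        by (rule sp_mono) (use nf_of_nf(2)[OF core(1)[OF j]] core(2)[OF j] in simp)
      then show "\<exists>x. \<forall>v. mf (fst (nf_of j)) (snd (nf_of j)) v = (\<Sum>k\<in>Idx d. x k * Bf a k v)"
        by (simp add: spanned_def)
    qed
    then show ?thesis by (rule bchoice)
  qed
  then obtain M where M: "\<And>j v. j \<in> Idx d \<Longrightarrow>
      mf (fst (nf_of j)) (snd (nf_of j)) v = (\<Sum>k\<in>Idx d. M j k * Bf a k v)" by blast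
  show ?thesis
  proof (rule independent_transfer[OF finite_Idx M _ B j])
    fix x j assume x: "\<And>v. (\<Sum>j\<in>Idx d. x j * mf (fst (nf_of j)) (snd (nf_of j)) v) = 0" and j: "j \<in> Idx d"
    have inj: "inj_on nf_of (Idx d)" using inj_nf_of by (rule inj_on_subset) (use core in auto)
    have "x (the_inv_into (Idx d) nf_of (nf_of j)) = 0"
    proof (rule nf_independent[where A = "nf_of ` Idx d"])
      show "finite (nf_of ` Idx d)" using finite_Idx by simp
      show "nf_of ` Idx d \<subseteq> nf" using nf_of_nf(1) core by auto
      show "nf_of j \<in> nf_of ` Idx d" using j by simp
      show "(\<Sum>j\<in>nf_of ` Idx d. x (the_inv_into (Idx d) nf_of j) * mf (fst j) (snd j) v) = 0" for v
        using x[of v] inj by (simp add: sum.reindex the_inv_into_f_f)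
    qed
    then show "x j = 0" using inj j by (simp add: the_inv_into_f_f)
  qed
qed

text \<open>In the basis, multiplication by sl_i is a shift of the exponent epsilon_i by one;
  indices with epsilon_i = 0 receive the coefficient 0.\<close>

lemma shift_rep:
  assumes g: "\<And>v. g v = (\<Sum>j\<in>Idx d. c j * Bf a j v)"
  shows "sl a i v * g v = (\<Sum>j\<in>Idx (Suc d). (if snd j i > 0 then c (fst j, (snd j)(i := snd j i - 1)) else 0) * Bf a j v)"
proof -
  let ?h = "\<lambda>j. (fst j, (snd j)(i := snd j i + 1))"
  let ?c = "\<lambda>j. if snd j i > 0 then c (fst j, (snd j)(i := snd j i - 1)) else 0"
  have inj: "inj_on ?h (Idx d)"
  proof (rule inj_onI)
    fix j l assume "j \<in> Idx d" "?h j = ?h l"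
    then have "fst j = fst l" "\<And>k. ((snd j)(i := snd j i + 1)) k = ((snd l)(i := snd l i + 1)) k" by auto
    moreover have "snd j k = snd l k" for k using calculation(2)[of k] by (cases "k = i") auto
    ultimately show "j = l" by (simp add: prod_eq_iff fun_eq_iff)
  qed
  have im: "?h ` Idx d = {j \<in> Idx (Suc d). snd j i > 0}"
  proof (intro equalityI subsetI)
    fix j assume "j \<in> ?h ` Idx d"
    then obtain l where "l \<in> Idx d" "j = ?h l" by blast
    then show "j \<in> {j \<in> Idx (Suc d). snd j i > 0}" using sz_upd[of "snd l" i 1] by (auto simp: Idx_def)
  next
    fix j assume j: "j \<in> {j \<in> Idx (Suc d). snd j i > 0}"
    define \<epsilon> where "\<epsilon> = (snd j)(i := snd j i - 1)"
    have e: "snd j = \<epsilon>(i := \<epsilon> i + 1)" unfolding \<epsilon>_def using j by (intro upd_decr) auto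
    have "sz (snd j) = sz \<epsilon> + 1" by (subst e) (rule sz_upd)
    then have "(fst j, \<epsilon>) \<in> Idx d" using j by (auto simp: Idx_def)
    moreover have "j = ?h (fst j, \<epsilon>)" using e by (simp add: prod_eq_iff)
    ultimately show "j \<in> ?h ` Idx d" by blast
  qed
  have hB: "Bf a (fst j, (snd j)(i := Suc (snd j i))) v = sl a i v * Bf a j v" for j
    using Bf_upd[of a "fst j" "snd j" i v] by simp
  have "(\<Sum>j\<in>Idx (Suc d). ?c j * Bf a j v) = (\<Sum>j\<in>?h ` Idx d. ?c j * Bf a j v)"
    unfolding im by (rule sum.mono_neutral_right) (use finite_Idx in auto)
  also have "\<dots> = (\<Sum>j\<in>Idx d. c j * (sl a i v * Bf a j v))"
    unfolding sum.reindex[OF inj] comp_def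
    by (intro sum.cong refl) (simp add: hB)
  also have "\<dots> = sl a i v * g v" by (simp only: g sum_distrib_left mult.left_commute)
  finally show ?thesis by simp
qed

end

section \<open>The kernel of the parametrisation and the Cohen--Macaulay property\<close>

fun Gc :: "xyz \<Rightarrow> coordinate" where
  "Gc IX = Gx" | "Gc IY = Gy" | "Gc IZ = Gz"

definition Lc :: "(xyz \<Rightarrow> nat) \<Rightarrow> coordinate" where
  "Lc \<alpha> = Lam (\<alpha> IX) (\<alpha> IY) (\<alpha> IZ)"

lemma Lc_surj: "\<exists>\<alpha>. Lam a b c = Lc \<alpha> \<and> sz \<alpha> = a + b + c"
  by (rule exI[of _ "\<lambda>i. case i of IX \<Rightarrow> a | IY \<Rightarrow> b | IZ \<Rightarrow> c"]) (simp add: Lc_def sz_def UNIV_xyz)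

lemma inj_Lc: "Lc \<alpha> = Lc \<beta> \<longleftrightarrow> \<alpha> = \<beta>"
  using all_cyc[of "\<lambda>i. \<alpha> i = \<beta> i" IX] by (auto simp: Lc_def fun_eq_iff)

lemma inj_Gc: "Gc i = Gc j \<longleftrightarrow> i = j" by (cases i; cases j; simp)
lemma Gc_ne_Lc [simp]: "Gc i \<noteq> Lc \<alpha>" "Lc \<alpha> \<noteq> Gc i" by (cases i; simp add: Lc_def)+

lemma coords_eq: "coords m = Lc ` {\<alpha>. sz \<alpha> = m - 1} \<union> range Gc"
proof (intro equalityI subsetI)
  fix k assume "k \<in> coords m"
  then consider a b c where "k = Lam a b c" "a + b + c = m - 1" | "k = Gc IX" | "k = Gc IY" | "k = Gc IZ"
    by (auto simp: coords_def)
  then show "k \<in> Lc ` {\<alpha>. sz \<alpha> = m - 1} \<union> range Gc"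
    using Lc_surj by cases (fastforce, auto simp del: Gc.simps)
next
  fix k assume "k \<in> Lc ` {\<alpha>. sz \<alpha> = m - 1} \<union> range Gc"
  then consider \<alpha> where "k = Lc \<alpha>" "sz \<alpha> = m - 1" | i where "k = Gc i" by blast
  then show "k \<in> coords m"
  proof cases
    case (2 i)
    then show ?thesis by (cases i) (auto simp: coords_def)
  qed (auto simp: coords_def Lc_def sz_def UNIV_xyz)
qed

lemma exists_subexponent: "n \<le> sz \<sigma> \<Longrightarrow> \<exists>\<delta>. (\<forall>i. \<delta> i \<le> \<sigma> i) \<and> sz \<delta> = n"
proof (induction n)
  case 0
  show ?case by (intro exI[of _ "\<lambda>_. 0"]) (simp add: sz_def)
next
  case (Suc n)
  then obtain \<delta> where d: "\<forall>i. \<delta> i \<le> \<sigma> i" "sz \<delta> = n" by auto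
  have "\<exists>i. \<delta> i < \<sigma> i"
  proof (rule ccontr)
    assume "\<nexists>i. \<delta> i < \<sigma> i"
    then have "\<delta> = \<sigma>" using d(1) by (auto simp: fun_eq_iff not_less intro: antisym)
    then show False using d(2) Suc.prems by simp
  qed
  then obtain i where "\<delta> i < \<sigma> i" by blast
  then have "\<forall>j. (\<delta>(i := \<delta> i + 1)) j \<le> \<sigma> j" using d(1) by simp
  moreover have "sz (\<delta>(i := \<delta> i + 1)) = Suc n" using sz_upd[of \<delta> i 1] d(2) by simp
  ultimately show ?case by blast
qed

lemma sz_diff: "(\<And>i. \<delta> i \<le> \<sigma> i) \<Longrightarrow> sz (\<lambda>i. \<sigma> i - \<delta> i) + sz \<delta> = sz \<sigma>"
  unfolding sz_add[symmetric] by (intro arg_cong[of _ _ sz]) (simp add: fun_eq_iff)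

definition Lsum :: "(xyz \<Rightarrow> nat) list \<Rightarrow> xyz \<Rightarrow> nat" where
  "Lsum \<alpha>s i = (\<Sum>\<alpha>\<leftarrow>\<alpha>s. \<alpha> i)"

lemma Lsum_Nil: "Lsum [] = (\<lambda>_. 0)" by (simp add: Lsum_def fun_eq_iff)
lemma Lsum_Cons: "Lsum (\<alpha> # \<alpha>s) = (\<lambda>i. \<alpha> i + Lsum \<alpha>s i)" by (simp add: Lsum_def fun_eq_iff)

lemma sz_Lsum: "\<forall>\<alpha>\<in>set \<alpha>s. sz \<alpha> = n \<Longrightarrow> sz (Lsum \<alpha>s) = n * length \<alpha>s"
proof (induction \<alpha>s)
  case (Cons \<alpha> \<alpha>s)
  then show ?case by (simp add: Lsum_Cons sz_add)
qed (simp add: Lsum_Nil sz_def)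

text \<open>Divisors of degree n are split off greedily. With n = m - 1 this lifts every exponent
  whose degree is a multiple of m - 1 to a monomial in the coordinates.\<close>

lemma exists_Lsum: "sz \<sigma> = n * k \<Longrightarrow> \<exists>\<alpha>s. Lsum \<alpha>s = \<sigma> \<and> (\<forall>\<alpha>\<in>set \<alpha>s. sz \<alpha> = n) \<and> length \<alpha>s = k"
proof (induction k arbitrary: \<sigma>)
  case 0
  then have "\<sigma> = (\<lambda>_. 0)" by (simp add: sz_eq_0)
  then show ?case by (intro exI[of _ "[]"]) (simp add: Lsum_Nil)
next
  case (Suc k)
  then have "n \<le> sz \<sigma>" by simp
  then obtain \<delta> where d: "\<forall>i. \<delta> i \<le> \<sigma> i" "sz \<delta> = n" using exists_subexponent by blast
  have "sz (\<lambda>i. \<sigma> i - \<delta> i) = n * k" using sz_diff[of \<delta> \<sigma>] d Suc.prems by simp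
  then obtain \<alpha>s where "Lsum \<alpha>s = (\<lambda>i. \<sigma> i - \<delta> i)" "\<forall>\<alpha>\<in>set \<alpha>s. sz \<alpha> = n" "length \<alpha>s = k"
    using Suc.IH by blast
  then show ?case using d by (intro exI[of _ "\<delta> # \<alpha>s"]) (simp add: Lsum_Cons fun_eq_iff)
qed

lemma sum_single_lookup: "f = (\<Sum>E\<in>Poly_Mapping.keys f. Poly_Mapping.single E (Poly_Mapping.lookup f E))"
  by (rule poly_mapping_eqI) (simp add: lookup_sum lookup_single when_def in_keys_iff)

context surf
begin

section \<open>Pulling polynomials back along the parametrisation\<close>

abbreviation J :: "coordinate set" where "J \<equiv> coords m"

lemma Gc_J [simp]: "Gc i \<in> J" by (simp add: coords_eq)
lemma Lc_J [simp]: "Lc \<alpha> \<in> J \<longleftrightarrow> sz \<alpha> = m - 1" by (auto simp: coords_eq inj_Lc)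

lemma finite_J: "finite J"
proof -
  have "{\<alpha>. sz \<alpha> = m - 1} \<subseteq> {\<alpha>. \<forall>i. \<alpha> i \<le> m - 1}"
  proof safe
    fix \<alpha> i assume "sz \<alpha> = m - 1"
    then show "\<alpha> i \<le> m - 1" using le_sz[of \<alpha> i] by simp
  qed
  then have "finite {\<alpha>. sz \<alpha> = m - 1}" using finite_bounded_funs by (rule finite_subset)
  then show ?thesis unfolding coords_eq by simp
qed

lemma vars_J_closed [intro]:
  "vars f \<subseteq> J \<Longrightarrow> vars g \<subseteq> J \<Longrightarrow> vars (f + g) \<subseteq> J"
  "vars f \<subseteq> J \<Longrightarrow> vars g \<subseteq> J \<Longrightarrow> vars (f - g) \<subseteq> J"
  "vars f \<subseteq> J \<Longrightarrow> vars g \<subseteq> J \<Longrightarrow> vars (f * g) \<subseteq> J"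
  "vars f \<subseteq> J \<Longrightarrow> vars (f ^ n) \<subseteq> J"
  using vars_add[of f g] vars_diff[of f g] vars_mult[of f g] vars_power[of f n] by auto

lemma phi_G: "phi m v (Gc i) = G i v"
proof -
  have "phi m v (Gc i) = peval v (basis_form m (Gc i))" by (simp add: phi_def)
  then show ?thesis by (cases i) (simp_all add: G_def peval_mult peval_diff peval_power peval_uminus)
qed

lemma phi_L: "sz \<alpha> = m - 1 \<Longrightarrow> phi m v (Lc \<alpha>) = V v * mn v \<alpha>"
proof -
  assume a: "sz \<alpha> = m - 1"
  have "phi m v (Lc \<alpha>) = peval v (basis_form m (Lc \<alpha>))" using a by (simp add: phi_def)
  then show ?thesis by (simp add: Lc_def peval_mult peval_power V_def mn_def prod_cyc[of _ IX])
qed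

definition hat :: "coordinate cpoly \<Rightarrow> (xyz \<Rightarrow> complex) \<Rightarrow> complex" where
  "hat f v = peval (phi m v) f"

lemma hat_simps [simp]:
  "hat 0 v = 0" "hat 1 v = 1" "hat (Const c) v = c" "hat (Var k) v = phi m v k"
  "hat (f + g) v = hat f v + hat g v" "hat (f * g) v = hat f v * hat g v"
  "hat (f - g) v = hat f v - hat g v" "hat (- f) v = - hat f v" "hat (f ^ n) v = hat f v ^ n"
  "hat (sum F A) v = (\<Sum>x\<in>A. hat (F x) v)" "hat (prod F A) v = (\<Prod>x\<in>A. hat (F x) v)"
  by (simp_all add: hat_def peval_add peval_mult peval_diff peval_uminus peval_power peval_sum peval_prod)

text \<open>A monomial in the shape of \<open>mf\<close>. The exponents are kept as a list because
  many lists share a sum, hence a pullback; this ambiguity is what the Veronese quadrics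
  express.\<close>

definition MP :: "(xyz \<Rightarrow> nat) \<Rightarrow> (xyz \<Rightarrow> nat) list \<Rightarrow> coordinate cpoly" where
  "MP e \<alpha>s = (\<Prod>i\<in>UNIV. Var (Gc i) ^ e i) * (\<Prod>\<alpha>\<leftarrow>\<alpha>s. Var (Lc \<alpha>))"

lemma MP_G: "MP (e(i := e i + 1)) \<alpha>s = Var (Gc i) * MP e \<alpha>s"
  by (simp add: MP_def prod_cyc[of _ i] mult_ac)

lemma MP_L: "MP e (\<alpha> # \<alpha>s) = Var (Lc \<alpha>) * MP e \<alpha>s"
  by (simp add: MP_def mult_ac)

lemma MP_0: "MP (\<lambda>_. 0) [] = 1" by (simp add: MP_def)

lemma hat_MP:
  assumes "\<forall>\<alpha>\<in>set \<alpha>s. sz \<alpha> = m - 1"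
  shows "hat (MP e \<alpha>s) v = mf e (Lsum \<alpha>s) v"
proof -
  have "sz (Lsum \<alpha>s) div (m - 1) = length \<alpha>s" using sz_Lsum[OF assms] m by simp
  moreover have "hat (\<Prod>\<alpha>\<leftarrow>\<alpha>s. Var (Lc \<alpha>)) v = V v ^ length \<alpha>s * mn v (Lsum \<alpha>s)"
    using assms
  proof (induction \<alpha>s)
    case (Cons \<alpha> \<alpha>s)
    then show ?case by (simp add: phi_L Lsum_Cons mn_add mult_ac)
  qed (simp add: Lsum_Nil mn_def)
  ultimately show ?thesis by (simp add: MP_def mf_def phi_G)
qed

lemma vars_MP:
  assumes "\<forall>\<alpha>\<in>set \<alpha>s. sz \<alpha> = m - 1"
  shows "vars (MP e \<alpha>s) \<subseteq> J"
proof -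
  have "vars (\<Prod>i\<in>UNIV. Var (Gc i) ^ e i) \<subseteq> J"
    using vars_power[of "Var (Gc _)"] by (intro vars_prod) fastforce
  moreover have "vars (\<Prod>\<alpha>\<leftarrow>\<alpha>s. Var (Lc \<alpha>)) \<subseteq> J"
    using assms by (intro vars_prod_list) auto
  ultimately show ?thesis unfolding MP_def by (rule vars_J_closed(3))
qed

lemma single_MP:
  assumes "Poly_Mapping.keys E \<subseteq> J"
  shows "\<exists>e \<alpha>s. Poly_Mapping.single E 1 = MP e \<alpha>s \<and> (\<forall>\<alpha>\<in>set \<alpha>s. sz \<alpha> = m - 1) \<and>
    sz e + length \<alpha>s = (\<Sum>k\<in>Poly_Mapping.keys E. Poly_Mapping.lookup E k)"
  using assms
proof (induction "\<Sum>k\<in>Poly_Mapping.keys E. Poly_Mapping.lookup E k" arbitrary: E)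
  case 0
  have "Poly_Mapping.keys E = {}"
  proof (rule ccontr)
    assume "Poly_Mapping.keys E \<noteq> {}"
    then obtain k where "k \<in> Poly_Mapping.keys E" by blast
    then show False using 0(1) by (simp add: in_keys_iff)
  qed
  then have "E = 0" by simp
  then show ?case by (intro exI[of _ "\<lambda>_. 0"] exI[of _ "[]"]) (simp add: MP_0 sz_def)
next
  case (Suc n)
  have "Poly_Mapping.keys E \<noteq> {}" using Suc(2) by auto
  then obtain k where k: "k \<in> Poly_Mapping.keys E" by blast
  define E' where "E' = E - Poly_Mapping.single k 1"
  have E: "E = Poly_Mapping.single k 1 + E'"
    using k by (intro poly_mapping_eqI) (auto simp: E'_def lookup_add lookup_minus lookup_single when_def in_keys_iff)
  have keys': "Poly_Mapping.keys E' \<subseteq> J"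
  proof
    fix l assume "l \<in> Poly_Mapping.keys E'"
    then have "l \<in> Poly_Mapping.keys E" by (auto simp: E'_def lookup_minus in_keys_iff)
    then show "l \<in> J" using Suc(3) by blast
  qed
  have sum: "Suc n = 1 + (\<Sum>k\<in>Poly_Mapping.keys E'. Poly_Mapping.lookup E' k)"
    unfolding Suc(2) by (subst (1 2) E) (simp add: exponent_sum_add)
  then obtain e \<alpha>s where IH: "Poly_Mapping.single E' 1 = MP e \<alpha>s" "\<forall>\<alpha>\<in>set \<alpha>s. sz \<alpha> = m - 1"
    "sz e + length \<alpha>s = n" using Suc(1)[of E'] keys' by auto
  have s: "Poly_Mapping.single E 1 = Var k * MP e \<alpha>s"
    unfolding IH(1)[symmetric] Var_def by (subst E) (simp add: mult_single)
  have "k \<in> J" using k Suc(3) by blast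
  then consider i where "k = Gc i" | \<alpha> where "k = Lc \<alpha>" "sz \<alpha> = m - 1" by (auto simp: coords_eq)
  then show ?case
  proof cases
    case (1 i)
    then have "Poly_Mapping.single E 1 = MP (e(i := e i + 1)) \<alpha>s" unfolding s MP_G by simp
    moreover have "sz (e(i := e i + 1)) + length \<alpha>s = Suc n" using IH(3) sz_upd[of e i 1] by simp
    ultimately show ?thesis using IH(2) Suc(2) by metis
  next
    case (2 \<alpha>)
    then have "Poly_Mapping.single E 1 = MP e (\<alpha> # \<alpha>s)" unfolding s MP_L by simp
    moreover have "sz e + length (\<alpha> # \<alpha>s) = Suc n" using IH(3) by simp
    moreover have "\<forall>\<alpha>\<in>set (\<alpha> # \<alpha>s). sz \<alpha> = m - 1" using IH(2) 2 by simp
    ultimately show ?thesis using Suc(2) by metis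
  qed
qed

text \<open>The predicate \<open>D\<close> carries information on the total degrees, so the rule
  serves under a degree bound and, with \<open>D\<close> always true, for arbitrary
  polynomials.\<close>

lemma poly_MP_induct:
  assumes f: "vars f \<subseteq> J" and D: "\<And>E. E \<in> Poly_Mapping.keys f \<Longrightarrow> D (\<Sum>k\<in>Poly_Mapping.keys E. Poly_Mapping.lookup E k)"
    and P: "P 0" "\<And>f g. P f \<Longrightarrow> P g \<Longrightarrow> P (f + g)"
      "\<And>c e \<alpha>s. (\<forall>\<alpha>\<in>set \<alpha>s. sz \<alpha> = m - 1) \<Longrightarrow> D (sz e + length \<alpha>s) \<Longrightarrow> P (Const c * MP e \<alpha>s)"
  shows "P f"
proof -
  have "P (\<Sum>E\<in>A. Poly_Mapping.single E (Poly_Mapping.lookup f E))" if "finite A" "A \<subseteq> Poly_Mapping.keys f" for A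
    using that
  proof (induction A rule: finite_induct)
    case (insert E A)
    have "Poly_Mapping.keys E \<subseteq> J" using f insert by (auto simp: vars_def)
    from single_MP[OF this] obtain e \<alpha>s where e: "Poly_Mapping.single E 1 = MP e \<alpha>s" "\<forall>\<alpha>\<in>set \<alpha>s. sz \<alpha> = m - 1"
      "sz e + length \<alpha>s = (\<Sum>k\<in>Poly_Mapping.keys E. Poly_Mapping.lookup E k)" by blast
    have "Poly_Mapping.single E (Poly_Mapping.lookup f E) = Const (Poly_Mapping.lookup f E) * MP e \<alpha>s"
      unfolding e(1)[symmetric] Const_def by (simp add: mult_single)
    moreover have "P \<dots>" using e D[of E] insert.prems by (intro P(3)) auto
    ultimately show ?case using insert by (simp add: P(2))
  qed (simp add: P(1))
  from this[of "Poly_Mapping.keys f"] show ?thesis by (simp flip: sum_single_lookup)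
qed

lemma spanned_hat:
  assumes "vars f \<subseteq> J" "deg_le d f"
  shows "spanned a d (hat f)"
proof (rule poly_MP_induct[where D = "\<lambda>n. n \<le> d", OF assms(1)])
  show "spanned a d (hat 0)" by (rule sp_cong[OF sp_0]) simp
  show "spanned a d (hat (f + g))" if "spanned a d (hat f)" "spanned a d (hat g)" for f g
    by (rule sp_cong[OF sp_add[OF that]]) simp
next
  fix c e \<alpha>s assume *: "\<forall>\<alpha>\<in>set \<alpha>s. sz \<alpha> = m - 1" "sz e + length \<alpha>s \<le> d"
  have "sz (Lsum \<alpha>s) = (m - 1) * length \<alpha>s" by (rule sz_Lsum[OF *(1)])
  then have "spanned a (sz e + length \<alpha>s) (mf e (Lsum \<alpha>s))" using m by (intro spanned_mf) auto
  then have "spanned a d (\<lambda>v. c * mf e (Lsum \<alpha>s) v)" by (intro sp_scale sp_mono[OF _ *(2)])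
  then show "spanned a d (hat (Const c * MP e \<alpha>s))" by (rule sp_cong) (simp add: hat_MP[OF *(1)])
qed (use assms(2) in \<open>auto simp: deg_le_def\<close>)

definition Ker :: "coordinate cpoly set" where
  "Ker = {f. vars f \<subseteq> J \<and> (\<forall>v. hat f v = 0)}"

lemma ideal_Ker: "ideal Ker (poly_ring J)"
  by (rule poly_idealI) (simp_all add: Ker_def vars_J_closed)

text \<open>Polynomials of degree at most d pull back into the span of the functions indexed by
  \<open>Idx d\<close>, of which there are at most \<open>card core * (d + 1) ^ 3\<close>. A
  relation between pullbacks is a relation modulo \<open>Ker\<close>.\<close>

lemma growth_Ker: "growth_bound J Ker (card core)"
  unfolding growth_bound_def
proof (intro allI impI)
  fix d A and f :: "complex list \<Rightarrow> coordinate cpoly"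
  assume A: "finite A" "\<forall>a\<in>A. vars (f a) \<subseteq> J \<and> deg_le d (f a)" "card A > card core * (d + 1) ^ 3"
  let ?a = "\<lambda>_. 0 :: complex"
  have "\<forall>a\<in>A. \<exists>c. \<forall>v. hat (f a) v = (\<Sum>j\<in>Idx d. c j * Bf ?a j v)"
    using spanned_hat A(2) by (auto simp: spanned_def)
  then obtain M where M: "\<forall>a\<in>A. \<forall>v. hat (f a) v = (\<Sum>j\<in>Idx d. M a j * Bf ?a j v)"
    by (rule bchoice[THEN exE])
  have "card (Idx d) < card A" using card_Idx[of d] A(3) by linarith
  from underdetermined_system[OF finite_Idx A(1) this, of M] obtain c where
    c: "\<exists>a\<in>A. c a \<noteq> 0" "\<forall>j\<in>Idx d. (\<Sum>a\<in>A. c a * M a j) = 0" by blast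
  have "hat (\<Sum>a\<in>A. Const (c a) * f a) v = 0" for v
  proof -
    have "hat (\<Sum>a\<in>A. Const (c a) * f a) v = (\<Sum>a\<in>A. \<Sum>j\<in>Idx d. c a * M a j * Bf ?a j v)"
      using M by (simp add: sum_distrib_left mult.assoc)
    also have "\<dots> = (\<Sum>j\<in>Idx d. (\<Sum>a\<in>A. c a * M a j) * Bf ?a j v)"
      by (subst sum.swap) (simp only: sum_distrib_right)
    finally show ?thesis using c(2) by simp
  qed
  moreover have "vars (\<Sum>a\<in>A. Const (c a) * f a) \<subseteq> J" using A(2) by (intro vars_sum vars_J_closed) auto
  ultimately show "\<exists>c. (\<exists>a\<in>A. c a \<noteq> 0) \<and> (\<Sum>a\<in>A. Const (c a) * f a) \<in> Ker"
    using c(1) by (auto simp: Ker_def)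
qed

section \<open>The shifted linear forms and the ideals they generate\<close>

definition Sp :: "(xyz \<Rightarrow> complex) \<Rightarrow> xyz \<Rightarrow> coordinate cpoly" where
  "Sp a i = Var (Gc i) - Var (Lc ((\<lambda>_. 0)(i := m - 1))) - Const (a i)"

lemma sz_pure: "sz ((\<lambda>_. 0)(i := n)) = n" by (simp add: sz_def sum_cyc[of _ i])

lemma vars_Sp: "vars (Sp a i) \<subseteq> J"
  unfolding Sp_def by (intro vars_J_closed) (simp_all add: sz_pure)

lemma hat_Sp: "hat (Sp a i) v = sl a i v"
  by (simp add: Sp_def sl_def phi_G phi_L sz_pure H_def mn_def prod_cyc[of _ i])

lemma exists_Bp:
  assumes "c \<in> core"
  shows "\<exists>f. vars f \<subseteq> J \<and> (\<forall>v. hat f v = Bf a (c, \<epsilon>) v)"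
proof -
  have "(m - 1) dvd sz (snd c)" using assms by (auto simp: core_def)
  then obtain k where "sz (snd c) = (m - 1) * k" by blast
  then obtain \<alpha>s where \<alpha>s: "Lsum \<alpha>s = snd c" "\<forall>\<alpha>\<in>set \<alpha>s. sz \<alpha> = m - 1" using exists_Lsum by blast
  have "hat (MP (\<lambda>i. if i \<in> fst c then 1 else 0) \<alpha>s * (\<Prod>i\<in>UNIV. Sp a i ^ \<epsilon> i)) v = Bf a (c, \<epsilon>) v" for v
    by (simp add: hat_MP[OF \<alpha>s(2)] \<alpha>s(1) Bf_def hat_Sp cong: if_cong)
  moreover have "vars (MP (\<lambda>i. if i \<in> fst c then 1 else 0) \<alpha>s * (\<Prod>i\<in>UNIV. Sp a i ^ \<epsilon> i)) \<subseteq> J"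
    by (intro vars_J_closed vars_prod vars_MP \<alpha>s vars_Sp)
  ultimately show ?thesis by blast
qed

text \<open>The ideal generated by \<open>Ker\<close> and the \<open>Sp a i\<close> with
  \<open>i \<in> q\<close>, described through pullbacks so that membership can be tested on
  coefficients.\<close>

definition Tq :: "(xyz \<Rightarrow> complex) \<Rightarrow> xyz set \<Rightarrow> coordinate cpoly set" where
  "Tq a q = {f. vars f \<subseteq> J \<and> (\<exists>h. (\<forall>i. vars (h i) \<subseteq> J) \<and> (\<forall>v. hat f v = (\<Sum>i\<in>q. sl a i v * hat (h i) v)))}"

lemma Tq_vars: "f \<in> Tq a q \<Longrightarrow> vars f \<subseteq> J" by (simp add: Tq_def)

text \<open>Freeness at work: coefficients are unique by \<open>Bf_independent\<close>, and every
  multiple of sl_i has, by \<open>shift_rep\<close>, only indices with positive epsilon_i.\<close>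

lemma Tq_iff:
  assumes f: "vars f \<subseteq> J" and rep: "\<And>v. hat f v = (\<Sum>j\<in>Idx d. c j * Bf a j v)"
  shows "f \<in> Tq a q \<longleftrightarrow> (\<forall>j\<in>Idx d. c j \<noteq> 0 \<longrightarrow> (\<exists>i\<in>q. snd j i > 0))"
proof
  assume "f \<in> Tq a q"
  then obtain h where h: "\<And>i. vars (h i) \<subseteq> J" "\<And>v. hat f v = (\<Sum>i\<in>q. sl a i v * hat (h i) v)"
    by (auto simp: Tq_def)
  have "\<forall>i. \<exists>d. deg_le d (h i)" using deg_le_ex by blast
  then obtain D0 where D0: "\<And>i. deg_le (D0 i) (h i)" by metis
  define D where "D = d + (\<Sum>i\<in>UNIV. D0 i)"
  have "D0 i \<le> D" for i unfolding D_def by (rule trans_le_add2, rule member_le_sum) auto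
  then have "spanned a D (hat (h i))" for i using spanned_hat[OF h(1)] deg_le_mono[OF D0] by blast
  then obtain b where b: "\<And>i v. hat (h i) v = (\<Sum>j\<in>Idx D. b i j * Bf a j v)"
    unfolding spanned_def by metis
  define b' where "b' i j = (if snd j i > 0 then b i (fst j, (snd j)(i := snd j i - 1)) else 0)" for i j
  have b': "sl a i v * hat (h i) v = (\<Sum>j\<in>Idx (Suc D). b' i j * Bf a j v)" for i v
    unfolding b'_def by (rule shift_rep[OF b])
  have sub: "Idx d \<subseteq> Idx (Suc D)" by (auto simp: Idx_def D_def)
  have eq: "(\<Sum>j\<in>Idx (Suc D). ((if j \<in> Idx d then c j else 0) - (\<Sum>i\<in>q. b' i j)) * Bf a j v) = 0" for v
  proof -
    have "(\<Sum>j\<in>Idx (Suc D). (if j \<in> Idx d then c j else 0) * Bf a j v) = hat f v"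
      unfolding rep by (rule sum.mono_neutral_cong_right) (use sub finite_Idx in auto)
    moreover have "(\<Sum>j\<in>Idx (Suc D). (\<Sum>i\<in>q. b' i j) * Bf a j v) = hat f v"
      unfolding h(2) b' sum_distrib_right by (rule sum.swap)
    ultimately show ?thesis by (simp add: left_diff_distrib sum_subtractf)
  qed
  show "\<forall>j\<in>Idx d. c j \<noteq> 0 \<longrightarrow> (\<exists>i\<in>q. snd j i > 0)"
  proof (intro ballI impI)
    fix j assume j: "j \<in> Idx d" "c j \<noteq> 0"
    have "c j = (\<Sum>i\<in>q. b' i j)" using Bf_independent[OF eq, of j] j(1) sub by auto
    then have "\<exists>i\<in>q. b' i j \<noteq> 0" using j(2) by (metis sum.neutral)
    then show "\<exists>i\<in>q. snd j i > 0" by (auto simp: b'_def split: if_splits)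
  qed
next
  assume supp: "\<forall>j\<in>Idx d. c j \<noteq> 0 \<longrightarrow> (\<exists>i\<in>q. snd j i > 0)"
  let ?A = "{j \<in> Idx d. c j \<noteq> 0}"
  \<comment> \<open>One factor sl_i with i in \<open>q\<close> is chosen for each index that occurs;
    grouping the terms by the chosen i produces the cofactors \<open>h i\<close>.\<close>
  have "\<forall>j\<in>?A. \<exists>i. i \<in> q \<and> snd j i > 0" using supp by blast
  then obtain w where w: "\<forall>j\<in>?A. w j \<in> q \<and> snd j (w j) > 0" by (rule bchoice[THEN exE])
  have "\<forall>j\<in>?A. \<exists>f. vars f \<subseteq> J \<and> (\<forall>v. hat f v = Bf a (fst j, (snd j)(w j := snd j (w j) - 1)) v)"
    by (intro ballI exists_Bp) (auto simp: Idx_def)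
  then obtain g where g: "\<forall>j\<in>?A. vars (g j) \<subseteq> J \<and> (\<forall>v. hat (g j) v = Bf a (fst j, (snd j)(w j := snd j (w j) - 1)) v)"
    by (rule bchoice[THEN exE])
  have sg: "sl a (w j) v * hat (g j) v = Bf a j v" if "j \<in> ?A" for j v
  proof -
    let ?\<epsilon> = "(snd j)(w j := snd j (w j) - 1)"
    have "snd j = ?\<epsilon>(w j := ?\<epsilon> (w j) + 1)" using bspec[OF w that] by (intro upd_decr) simp
    then have "Bf a j v = Bf a (fst j, ?\<epsilon>(w j := ?\<epsilon> (w j) + 1)) v" by (metis prod.collapse)
    also have "\<dots> = sl a (w j) v * Bf a (fst j, ?\<epsilon>) v" by (rule Bf_upd)
    finally show ?thesis using bspec[OF g that] by simp
  qed
  define h where "h i = (\<Sum>j\<in>{j \<in> ?A. w j = i}. Const (c j) * g j)" for i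
  have "vars (h i) \<subseteq> J" for i unfolding h_def using g by (intro vars_sum vars_J_closed) auto
  moreover have "hat f v = (\<Sum>i\<in>q. sl a i v * hat (h i) v)" for v
  proof -
    have fA: "finite ?A" using finite_Idx by simp
    have "hat f v = (\<Sum>j\<in>?A. c j * Bf a j v)" unfolding rep
      by (rule sum.mono_neutral_right) (use finite_Idx in auto)
    also have "\<dots> = (\<Sum>j\<in>?A. sl a (w j) v * (c j * hat (g j) v))"
      by (intro sum.cong refl) (simp add: sg[symmetric] mult_ac)
    also have "\<dots> = (\<Sum>i\<in>q. \<Sum>j\<in>{j \<in> ?A. w j = i}. sl a (w j) v * (c j * hat (g j) v))"
      using w by (intro sum.group[symmetric] fA) auto
    also have "\<dots> = (\<Sum>i\<in>q. sl a i v * hat (h i) v)"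
      by (intro sum.cong refl) (simp add: h_def sum_distrib_left)
    finally show ?thesis .
  qed
  ultimately show "f \<in> Tq a q" using f by (auto simp: Tq_def)
qed

lemma hat_rep:
  assumes "vars f \<subseteq> J"
  obtains d c where "\<And>v. hat f v = (\<Sum>j\<in>Idx d. c j * Bf a j v)"
proof -
  obtain d where "deg_le d f" using deg_le_ex by blast
  from spanned_hat[OF assms this, of a] show ?thesis using that by (auto simp: spanned_def)
qed

lemma ideal_Tq: "ideal (Tq a q) (poly_ring J)"
proof (rule poly_idealI)
  show "0 \<in> Tq a q" by (auto simp: Tq_def intro!: exI[of _ "\<lambda>_. 0"])
next
  fix f g assume f: "f \<in> Tq a q" and g: "g \<in> Tq a q"
  then obtain h k where "\<forall>i. vars (h i) \<subseteq> J" "\<forall>v. hat f v = (\<Sum>i\<in>q. sl a i v * hat (h i) v)"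
    "\<forall>i. vars (k i) \<subseteq> J" "\<forall>v. hat g v = (\<Sum>i\<in>q. sl a i v * hat (k i) v)"
    by (auto simp: Tq_def)
  then show "f + g \<in> Tq a q" using Tq_vars[OF f] Tq_vars[OF g] unfolding Tq_def
    by (intro CollectI conjI exI[of _ "\<lambda>i. h i + k i"])
      (simp_all add: distrib_left sum.distrib vars_J_closed)
next
  fix f g assume f: "f \<in> Tq a q" and g: "vars g \<subseteq> J"
  then obtain h where "\<forall>i. vars (h i) \<subseteq> J" "\<forall>v. hat f v = (\<Sum>i\<in>q. sl a i v * hat (h i) v)"
    by (auto simp: Tq_def)
  then show "g * f \<in> Tq a q" using Tq_vars[OF f] g unfolding Tq_def
    by (intro CollectI conjI exI[of _ "\<lambda>i. g * h i"])
      (simp_all add: sum_distrib_left mult.left_commute vars_J_closed)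
qed (rule Tq_vars)

lemma Ker_Tq: "Ker \<subseteq> Tq a q"
  by (auto simp: Ker_def Tq_def intro!: exI[of _ "\<lambda>_. 0"])

lemma Sp_Tq: "i \<in> q \<Longrightarrow> Sp a i \<in> Tq a q"
  unfolding Tq_def
proof (intro CollectI conjI exI[of _ "\<lambda>j. if j = i then 1 else 0"] allI vars_Sp)
  fix v assume i: "i \<in> q"
  have "(\<Sum>j\<in>q. sl a j v * hat (if j = i then 1 else 0) v) = (\<Sum>j\<in>q. if j = i then sl a i v else 0)"
    by (intro sum.cong refl) auto
  then show "hat (Sp a i) v = (\<Sum>j\<in>q. sl a j v * hat (if j = i then 1 else 0) v)"
    using i by (simp add: hat_Sp finite_subset[OF subset_UNIV])
qed auto

lemma Tq_least:
  assumes L: "ideal L (poly_ring J)" "Ker \<subseteq> L" "\<And>i. i \<in> q \<Longrightarrow> Sp a i \<in> L"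
  shows "Tq a q \<subseteq> L"
proof
  fix f assume f: "f \<in> Tq a q"
  then obtain h where h: "\<forall>i. vars (h i) \<subseteq> J" "\<forall>v. hat f v = (\<Sum>i\<in>q. sl a i v * hat (h i) v)"
    by (auto simp: Tq_def)
  have S: "(\<Sum>i\<in>q. h i * Sp a i) \<in> L" using h L by (intro poly_ideal_sum[OF L(1)] poly_ideal(4)[OF L(1)]) auto
  then have "vars (\<Sum>i\<in>q. h i * Sp a i) \<subseteq> J" using poly_ideal(2)[OF L(1)] by blast
  then have "f - (\<Sum>i\<in>q. h i * Sp a i) \<in> Ker"
    using h Tq_vars[OF f] by (simp add: Ker_def hat_Sp mult.commute vars_J_closed)
  then show "f \<in> L" using S poly_ideal(3)[OF L(1), of "f - (\<Sum>i\<in>q. h i * Sp a i)"] L(2) by fastforce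
qed

text \<open>1 is the basis function without any factor, so the criterion \<open>Tq_iff\<close> fails
  for it.\<close>

lemma one_notin_Tq: "1 \<notin> Tq a q"
proof
  have c: "(({}, \<lambda>_. 0), \<lambda>_. 0) \<in> Idx 0" using m by (auto simp: Idx_def core_def dg_def sz_def)
  assume 1: "1 \<in> Tq a q"
  have rep: "hat 1 v = (\<Sum>j\<in>Idx 0. (if j = (({}, \<lambda>_. 0), \<lambda>_. 0) then 1 else 0) * Bf a j v)" for v
  proof -
    have "Bf a (({}, \<lambda>_. 0), \<lambda>_. 0) v = 1" by (simp add: Bf_def mf_00)
    then show ?thesis using c finite_Idx
      by (simp add: if_distrib[of "\<lambda>x. x * _"] cong: if_cong)
  qed
  show False using c 1 Tq_iff[OF _ rep, of q] by fastforce
qed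

text \<open>Multiplication by \<open>Sp a i\<close> raises epsilon_i and leaves the exponents with
  index in \<open>q\<close> alone, so the criterion \<open>Tq_iff\<close> passes from the product
  back to \<open>f\<close>.\<close>

lemma Tq_regular:
  assumes i: "i \<notin> q" and f: "vars f \<subseteq> J" "f * Sp a i \<in> Tq a q"
  shows "f \<in> Tq a q"
proof -
  obtain d c where rep: "\<And>v. hat f v = (\<Sum>j\<in>Idx d. c j * Bf a j v)" using hat_rep[OF f(1)] by blast
  have rep': "hat (f * Sp a i) v =
    (\<Sum>j\<in>Idx (Suc d). (if snd j i > 0 then c (fst j, (snd j)(i := snd j i - 1)) else 0) * Bf a j v)" for v
    using shift_rep[OF rep, where i = i and v = v] by (simp add: hat_Sp mult.commute)
  show ?thesis unfolding Tq_iff[OF f(1) rep]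
  proof (intro ballI impI)
    fix j assume j: "j \<in> Idx d" "c j \<noteq> 0"
    let ?j = "(fst j, (snd j)(i := snd j i + 1))"
    have "?j \<in> Idx (Suc d)" using j(1) sz_upd[of "snd j" i 1] by (auto simp: Idx_def)
    moreover have "vars (f * Sp a i) \<subseteq> J" by (rule Tq_vars[OF f(2)])
    ultimately have "\<exists>l\<in>q. snd ?j l > 0"
      using f(2) Tq_iff[OF _ rep', of q] j(2) by fastforce
    then show "\<exists>l\<in>q. snd j l > 0" using i by (auto split: if_splits)
  qed
qed

section \<open>The coordinate ring as a quotient\<close>

abbreviation coset :: "coordinate cpoly \<Rightarrow> coordinate cpoly set" where
  "coset f \<equiv> Ker +>\<^bsub>poly_ring J\<^esub> f"

abbreviation Q :: "coordinate cpoly set ring" where "Q \<equiv> poly_ring J Quot Ker"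

lemma coset_eq: "vars f \<subseteq> J \<Longrightarrow> vars g \<subseteq> J \<Longrightarrow> coset f = coset g \<longleftrightarrow> f - g \<in> Ker"
  using PR.quotient_eq_iff_same_a_r_cos[OF ideal_Ker, of f g]
  by (simp add: a_minus_def poly_ring_uminus)

lemma Q_hom: "ring_hom_cring (poly_ring J) Q coset"
  by (rule ideal.rcos_ring_hom_cring[OF ideal_Ker cring_poly_ring])

lemma Q_carrier: "X \<in> carrier Q \<longleftrightarrow> (\<exists>f. vars f \<subseteq> J \<and> X = coset f)"
  by (auto simp: FactRing_def A_RCOSETS_def'[of "poly_ring J" Ker])

lemma coset_image_ideal:
  assumes L: "ideal L (poly_ring J)" "Ker \<subseteq> L" and f: "vars f \<subseteq> J"
  shows "coset f \<in> coset ` L \<longleftrightarrow> f \<in> L"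
proof
  assume "coset f \<in> coset ` L"
  then obtain g where g: "g \<in> L" "coset f = coset g" by blast
  then have "f - g \<in> L" using coset_eq[OF f] poly_ideal(2)[OF L(1)] L(2) by blast
  then show "f \<in> L" using poly_ideal(3)[OF L(1), of "f - g" g] g(1) by simp
qed simp

lemma genideal_Sp:
  "genideal Q ((\<lambda>i. coset (Sp a i)) ` q) = coset ` Tq a q"
proof -
  interpret h: ring_hom_cring "poly_ring J" Q coset by (rule Q_hom)
  have hr: "ring_hom_ring (poly_ring J) Q coset" by (rule ideal.rcos_ring_hom_ring[OF ideal_Ker])
  have sub: "(\<lambda>i. coset (Sp a i)) ` q \<subseteq> carrier Q" using vars_Sp Q_carrier by auto
  let ?g = "genideal Q ((\<lambda>i. coset (Sp a i)) ` q)"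
  have gi: "ideal ?g Q" by (rule h.S.genideal_ideal[OF sub])
  show ?thesis
  proof
    show "?g \<subseteq> coset ` Tq a q"
      using Sp_Tq by (intro h.S.genideal_minimal PR.ring_ideal_imp_quot_ideal ideal_Ker ideal_Tq) auto
    let ?L = "{r \<in> carrier (poly_ring J). coset r \<in> ?g}"
    have "Tq a q \<subseteq> ?L"
    proof (rule Tq_least)
      show "ideal ?L (poly_ring J)" by (rule ring_hom_ring.ideal_vimage[OF hr gi])
      show "Ker \<subseteq> ?L"
      proof
        fix f assume f: "f \<in> Ker"
        then have v: "vars f \<subseteq> J" by (simp add: Ker_def)
        have "coset f = coset 0" using f v by (subst coset_eq) auto
        also have "\<dots> = \<zero>\<^bsub>Q\<^esub>" using h.hom_zero by simp
        finally show "f \<in> ?L" using v additive_subgroup.zero_closed[OF ideal.axioms(1)[OF gi]] by simp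
      qed
      show "Sp a i \<in> ?L" if "i \<in> q" for i using that vars_Sp h.S.genideal_self[OF sub] by auto
    qed
    then show "coset ` Tq a q \<subseteq> ?g" by blast
  qed
qed

lemma regular_Sp: "regular_sequence Q (map (\<lambda>i. coset (Sp a i)) [IX, IY, IZ])"
  unfolding regular_sequence_def
proof (intro conjI allI impI ballI)
  let ?x = "\<lambda>i. coset (Sp a i)"
  show "set (map ?x [IX, IY, IZ]) \<subseteq> carrier Q" using vars_Sp Q_carrier by auto
  have "coset 1 \<notin> coset ` Tq a {IX, IY, IZ}"
    using coset_image_ideal[OF ideal_Tq Ker_Tq, of 1] one_notin_Tq by simp
  moreover have "coset 1 \<in> carrier Q" unfolding Q_carrier by (intro exI[of _ 1]) simp
  ultimately show "genideal Q (set (map ?x [IX, IY, IZ])) \<noteq> carrier Q"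
    using genideal_Sp[of a "{IX, IY, IZ}"] by auto
next
  let ?x = "\<lambda>i. coset (Sp a i)"
  interpret h: ring_hom_cring "poly_ring J" Q coset by (rule Q_hom)
  fix k X assume k: "k < length (map ?x [IX, IY, IZ])" and X: "X \<in> carrier Q"
    and mem: "X \<otimes>\<^bsub>Q\<^esub> map ?x [IX, IY, IZ] ! k \<in> genideal Q (set (take k (map ?x [IX, IY, IZ])))"
  let ?i = "[IX, IY, IZ] ! k" and ?q = "set (take k [IX, IY, IZ])"
  have iq: "?i \<notin> ?q" using k by (auto simp: less_Suc_eq numeral_3_eq_3 numeral_2_eq_2)
  have gen: "genideal Q (set (take k (map ?x [IX, IY, IZ]))) = coset ` Tq a ?q"
    unfolding take_map set_map by (rule genideal_Sp)
  from X obtain f where f: "vars f \<subseteq> J" "X = coset f" by (auto simp: Q_carrier)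
  have "map ?x [IX, IY, IZ] ! k = ?x ?i" using k by (simp only: nth_map length_map)
  then have eq: "X \<otimes>\<^bsub>Q\<^esub> map ?x [IX, IY, IZ] ! k = coset (f * Sp a ?i)"
    using h.hom_mult[of f "Sp a ?i"] f vars_Sp by (simp only: poly_ring_simps mem_Collect_eq)
  have "vars (f * Sp a ?i) \<subseteq> J" by (intro vars_J_closed f vars_Sp)
  then have "f * Sp a ?i \<in> Tq a ?q"
    using mem unfolding gen eq by (rule coset_image_ideal[OF ideal_Tq Ker_Tq, THEN iffD1])
  then have "f \<in> Tq a ?q" by (rule Tq_regular[OF iq f(1)])
  then show "X \<in> genideal Q (set (take k (map ?x [IX, IY, IZ])))" unfolding gen f(2) by blast
qed

theorem cohen_macaulay_Q: "cohen_macaulay Q"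
proof -
  interpret h: ring_hom_cring "poly_ring J" Q coset by (rule Q_hom)
  have hr: "ring_hom_ring (poly_ring J) Q coset" by (rule ideal.rcos_ring_hom_ring[OF ideal_Ker])
  have coset_Ker: "coset f = \<zero>\<^bsub>Q\<^esub>" if "f \<in> Ker" for f
  proof -
    have "coset f = coset 0" using that by (subst coset_eq) (auto simp: Ker_def)
    then show ?thesis using h.hom_zero by simp
  qed
  show ?thesis
  proof (rule h.S.cohen_macaulayI[where d = 3])
    show "noetherian_ring Q"
      by (rule noetherian_ring.noetherian_quotient[OF noetherian_poly_ring[OF finite_J] ideal_Ker])
  next
    fix c n assume c: "\<forall>i\<le>n. primeideal (c i) Q" "\<forall>i<n. c i \<subset> c (Suc i)"
    \<comment> \<open>Chains are pulled back to the polynomial ring, where the growth bound for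
      \<open>Ker\<close> applies. They stay strict because \<open>coset\<close> is
      surjective.\<close>
    let ?c = "\<lambda>i. {r \<in> carrier (poly_ring J). coset r \<in> c i}"
    have "n < 4"
    proof (rule PR.chain_length_less[where I = Ker and p = ?c])
      show "lombardi (poly_ring J) xs \<inter> Ker \<noteq> {}" if "set xs \<subseteq> carrier (poly_ring J)" "length xs = 4" for xs
        by (rule lombardi_meets[OF ideal_Ker growth_Ker that])
      show "\<forall>i\<le>n. primeideal (?c i) (poly_ring J)"
        by (intro allI impI h.primeideal_vimage) (use c(1) in blast)
      show "\<forall>i<n. ?c i \<subset> ?c (Suc i)"
      proof (intro allI impI)
        fix i assume i: "i < n"
        then obtain X where X: "X \<in> c (Suc i)" "X \<notin> c i" using c(2) by blast
        interpret P: primeideal "c (Suc i)" Q using c(1) i by simp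
        obtain f where "vars f \<subseteq> J" "X = coset f" using P.Icarr[OF X(1)] by (auto simp: Q_carrier)
        then have "f \<in> ?c (Suc i) - ?c i" using X by simp
        moreover have "?c i \<subseteq> ?c (Suc i)" using c(2) i by auto
        ultimately show "?c i \<subset> ?c (Suc i)" by blast
      qed
      interpret P: primeideal "c 0" Q using c(1) by simp
      show "Ker \<subseteq> ?c 0" using coset_Ker P.zero_closed by (auto simp: Ker_def)
    qed
    then show "n \<le> 3" by simp
  next
    fix P assume P: "maximalideal P Q"
    then have pP: "primeideal P Q" by (rule h.S.maximalideal_prime)
    interpret P: maximalideal P Q by (rule P)
    define P' where "P' = {r \<in> carrier (poly_ring J). coset r \<in> P}"
    have prime': "primeideal P' (poly_ring J)" unfolding P'_def by (rule h.primeideal_vimage[OF pP])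
    then have id': "ideal P' (poly_ring J)" by (rule primeideal.axioms(1))
    have KP: "Ker \<subseteq> P'" using coset_Ker P.zero_closed by (auto simp: Ker_def P'_def)
    have one: "1 \<notin> P'"
    proof
      assume "1 \<in> P'"
      then have "\<one>\<^bsub>Q\<^esub> \<in> P" using h.hom_one by (simp add: P'_def)
      then show False using P.one_imp_carrier P.I_notcarr by simp
    qed
    \<comment> \<open>The residue class of G_i - H_i at \<open>P\<close> is a complex number. These
      three numbers are the shifts for which the regular sequence lies in \<open>P\<close>.\<close>
    have "\<exists>r. (Var (Gc i) - Var (Lc ((\<lambda>_. 0)(i := m - 1)))) - Const r \<in> P'" for i
    proof (rule residue_field_complex[OF id' one])
      show "growth_bound J P' (card core)" by (rule growth_bound_mono[OF growth_Ker KP])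
      show "f \<in> P' \<or> g \<in> P'" if "vars f \<subseteq> J" "vars g \<subseteq> J" "f * g \<in> P'" for f g
        using primeideal.I_prime[OF prime', of f g] that by simp
      show "vars (Var (Gc i) - Var (Lc ((\<lambda>_. 0)(i := m - 1)))) \<subseteq> J"
        by (intro vars_J_closed) (simp_all add: sz_pure)
    next
      fix f assume f: "vars f \<subseteq> J" "f \<notin> P'"
      \<comment> \<open>The ideal generated by \<open>P'\<close> and \<open>f\<close>. By maximality
        of \<open>P\<close> its image is the whole ring, and 1 in \<open>L\<close> gives the inverse
        of \<open>f\<close> modulo \<open>P'\<close>.\<close>
      define L where "L = {h. vars h \<subseteq> J \<and> (\<exists>g. vars g \<subseteq> J \<and> h - g * f \<in> P')}"
      have L: "ideal L (poly_ring J)"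
      proof (rule poly_idealI)
        show "0 \<in> L" using poly_ideal(1)[OF id'] by (auto simp: L_def intro!: exI[of _ 0])
      next
        fix h h' assume "h \<in> L" "h' \<in> L"
        then obtain g g' where *: "vars h \<subseteq> J" "vars g \<subseteq> J" "h - g * f \<in> P'"
          "vars h' \<subseteq> J" "vars g' \<subseteq> J" "h' - g' * f \<in> P'" by (auto simp: L_def)
        have "(h + h') - (g + g') * f \<in> P'" using poly_ideal(3)[OF id' *(3,6)] by (simp add: algebra_simps)
        moreover have "vars (h + h') \<subseteq> J" "vars (g + g') \<subseteq> J" using * by (simp_all add: vars_J_closed)
        ultimately show "h + h' \<in> L" unfolding L_def by blast
      next
        fix h k assume "h \<in> L" "vars k \<subseteq> J"
        then obtain g where *: "vars h \<subseteq> J" "vars g \<subseteq> J" "h - g * f \<in> P'" "vars k \<subseteq> J" by (auto simp: L_def)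
        have "k * h - (k * g) * f \<in> P'" using poly_ideal(4)[OF id' *(3,4)] by (simp add: algebra_simps)
        moreover have "vars (k * h) \<subseteq> J" "vars (k * g) \<subseteq> J" using * by (simp_all add: vars_J_closed)
        ultimately show "k * h \<in> L" unfolding L_def by blast
      qed (simp add: L_def)
      have PL: "P' \<subseteq> L"
      proof
        fix h assume "h \<in> P'"
        then show "h \<in> L" using poly_ideal(2)[OF id'] by (auto simp: L_def intro!: exI[of _ 0])
      qed
      have fL: "f \<in> L" using f poly_ideal(1)[OF id'] by (auto simp: L_def intro!: exI[of _ 1])
      have KL: "Ker \<subseteq> L" using KP PL by blast
      have "ideal (coset ` L) Q" by (rule PR.ring_ideal_imp_quot_ideal[OF ideal_Ker L])
      moreover have "P \<subseteq> coset ` L"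
      proof
        fix X assume X: "X \<in> P"
        then obtain h where "vars h \<subseteq> J" "X = coset h" using P.Icarr[OF X] by (auto simp: Q_carrier)
        then show "X \<in> coset ` L" using X PL by (auto simp: P'_def)
      qed
      moreover have "coset ` L \<subseteq> carrier Q" using poly_ideal(2)[OF L] by (auto simp: Q_carrier)
      ultimately have "coset ` L = P \<or> coset ` L = carrier Q" by (rule P.I_maximal)
      moreover have "coset ` L \<noteq> P" using fL f by (auto simp: P'_def)
      moreover have "coset 1 \<in> carrier Q" unfolding Q_carrier by (intro exI[of _ 1]) simp
      ultimately have "coset 1 \<in> coset ` L" by simp
      then have "1 \<in> L" using coset_image_ideal[OF L KL, of 1] by simp
      then obtain g where "vars g \<subseteq> J" "1 - g * f \<in> P'" by (auto simp: L_def)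
      then show "\<exists>g. vars g \<subseteq> J \<and> f * g - 1 \<in> P'"
        using poly_ideal(5)[OF id', of "1 - g * f"] by (auto simp: mult.commute)
    qed
    then obtain a where "\<And>i. (Var (Gc i) - Var (Lc ((\<lambda>_. 0)(i := m - 1)))) - Const (a i) \<in> P'" by metis
    then have "coset (Sp a i) \<in> P" for i by (simp add: Sp_def P'_def)
    then have "set (map (\<lambda>i. coset (Sp a i)) [IX, IY, IZ]) \<subseteq> P" by auto
    then show "\<exists>xs. length xs = 3 \<and> regular_sequence Q xs \<and> set xs \<subseteq> P"
      using regular_Sp[of a] by (intro exI[of _ "map (\<lambda>i. coset (Sp a i)) [IX, IY, IZ]"]) auto
  qed
qed

end

section \<open>Generators of the kernel\<close>

lemma is_form_Var: "is_form 1 (Var i)" by (simp add: is_form_def Var_def)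
lemma is_form_Const: "is_form 0 (Const c)" by (auto simp: is_form_def Const_def split: if_splits)
lemma is_form_0 [simp]: "is_form d 0" by (simp add: is_form_def)
lemma is_form_add: "is_form d f \<Longrightarrow> is_form d g \<Longrightarrow> is_form d (f + g)"
  using keys_add[of f g] by (auto simp: is_form_def)
lemma is_form_uminus: "is_form d f \<Longrightarrow> is_form d (- f)" by (simp add: is_form_def)
lemma is_form_diff: "is_form d f \<Longrightarrow> is_form d g \<Longrightarrow> is_form d (f - g)"
  using is_form_add[of d f "- g"] by (simp add: is_form_uminus)
lemma is_form_Const_mult: "is_form d f \<Longrightarrow> is_form d (Const c * f)"
  using is_form_mult[OF is_form_Const, of d f c] by simp
lemma is_form_Var2: "is_form 2 (Var i * Var j)"
  using is_form_mult[OF is_form_Var is_form_Var, of i j] by (simp add: numeral_2_eq_2)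
lemma is_form_Var3: "is_form 3 (Var i * Var j * Var k)"
  using is_form_mult[OF is_form_Var2 is_form_Var, of i j k] by (simp add: numeral_3_eq_3)

lemma Const_numeral: "Const (numeral n) = numeral n"
proof -
  have "Const (of_nat k) = of_nat k" for k by (induction k) (simp_all add: Const_add)
  from this[of "numeral n"] show ?thesis by simp
qed

lemma card_exponents: "card {\<alpha>. sz \<alpha> = n} = (n + 2) choose n"
proof -
  let ?f = "\<lambda>\<alpha>. [\<alpha> IX, \<alpha> IY, \<alpha> IZ]"
  have "bij_betw ?f {\<alpha>. sz \<alpha> = n} {l. length l = 3 \<and> sum_list l = n}"
  proof (rule bij_betwI')
    fix \<alpha> \<beta> :: "xyz \<Rightarrow> nat"
    show "(?f \<alpha> = ?f \<beta>) = (\<alpha> = \<beta>)"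
      using all_cyc[of "\<lambda>i. \<alpha> i = \<beta> i" IX] by (auto simp: fun_eq_iff)
  next
    fix \<alpha> :: "xyz \<Rightarrow> nat" assume "\<alpha> \<in> {\<alpha>. sz \<alpha> = n}"
    then show "?f \<alpha> \<in> {l. length l = 3 \<and> sum_list l = n}" by (simp add: sz_def sum_cyc[of _ IX])
  next
    fix l :: "nat list" assume "l \<in> {l. length l = 3 \<and> sum_list l = n}"
    then obtain a b c where l: "l = [a, b, c]" "a + b + c = n"
      by (auto simp: numeral_3_eq_3 length_Suc_conv)
    then show "\<exists>\<alpha>\<in>{\<alpha>. sz \<alpha> = n}. l = ?f \<alpha>"
      by (intro bexI[of _ "\<lambda>i. case i of IX \<Rightarrow> a | IY \<Rightarrow> b | IZ \<Rightarrow> c"])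
        (simp_all add: sz_def sum_cyc[of _ IX])
  qed
  then have "card {\<alpha>. sz \<alpha> = n} = card {l. length l = 3 \<and> sum_list l = n}" by (rule bij_betw_same_card)
  also have "\<dots> = (n + 3 - 1) choose n" by (rule card_length_sum_list)
  finally show ?thesis by simp
qed

lemma finite_exponents: "finite {\<alpha>. sz \<alpha> = n}"
  by (rule card_ge_0_finite) (simp add: card_exponents)

context surf
begin

abbreviation X :: "(xyz \<Rightarrow> nat) \<Rightarrow> coordinate cpoly" where "X \<alpha> \<equiv> Var (Lc \<alpha>)"
abbreviation Y :: "xyz \<Rightarrow> coordinate cpoly" where "Y i \<equiv> Var (Gc i)"
definition pure :: "xyz \<Rightarrow> xyz \<Rightarrow> nat" where "pure i = (\<lambda>_. 0)(i := m - 1)"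

lemma sz_pure': "sz (pure i) = m - 1" by (simp add: pure_def sz_pure)

lemma mn_pure: "mn v (pure i) = v i ^ (m - 1)" by (simp add: pure_def mn_def prod_cyc[of _ i])

lemma hat_pure: "hat (X (pure i)) v = H i v"
  by (simp add: phi_L sz_pure' mn_pure H_def)

lemma Lc_pure: "Lam (m - 1) 0 0 = Lc (pure IX)" "Lam 0 (m - 1) 0 = Lc (pure IY)" "Lam 0 0 (m - 1) = Lc (pure IZ)"
  by (simp_all add: Lc_def pure_def)

lemma cubic_C_eq: "cubic_C m = (if odd m
    then 2 * X (pure IX) * X (pure IY) * X (pure IZ) + Y IX * X (pure IY) * X (pure IZ)
      + X (pure IX) * Y IY * X (pure IZ) + X (pure IX) * X (pure IY) * Y IZ - Y IX * Y IY * Y IZ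
    else Y IX * X (pure IY) * X (pure IZ)
      + X (pure IX) * Y IY * X (pure IZ) + X (pure IX) * X (pure IY) * Y IZ + Y IX * Y IY * Y IZ)"
  by (simp only: cubic_C_def Let_def Lc_pure Gc.simps)

lemma vars_XY [simp]: "sz \<alpha> = m - 1 \<Longrightarrow> vars (X \<alpha>) \<subseteq> J" "vars (Y i) \<subseteq> J" by simp_all

lemma vars_two: "vars (2 :: coordinate cpoly) \<subseteq> J"
  by (simp flip: Const_numeral)

lemma cubic_C_Ker: "cubic_C m \<in> Ker"
proof -
  have "vars (cubic_C m) \<subseteq> J" unfolding cubic_C_eq
    by (cases "odd m"; simp only: if_True if_False not_not simp_thms;
        intro vars_J_closed vars_XY sz_pure' vars_two)
  moreover have "hat (cubic_C m) v = 0" for v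
  proof -
    have "hat 2 v = 2" using hat_simps(3)[of 2 v] by (simp add: Const_numeral)
    then show ?thesis using cubic_relation[of v] cubic_relation_even[of v]
      unfolding cubic_C_eq
      by (auto simp: hat_pure[simplified] phi_G[of v IX, simplified] phi_G[of v IY, simplified]
          phi_G[of v IZ, simplified])
  qed
  ultimately show ?thesis by (simp add: Ker_def)
qed

lemma is_form_cubic_C: "is_form 3 (cubic_C m)"
proof -
  have "is_form 3 (2 * X (pure IX) * X (pure IY) * X (pure IZ))"
    using is_form_Const_mult[OF is_form_Var3, of 2] by (simp add: Const_numeral mult.assoc)
  then show ?thesis unfolding cubic_C_eq
    by (auto intro!: is_form_add is_form_diff is_form_Var3)
qed

definition sg :: complex where "sg = (- 1) ^ m"

text \<open>The identity v_i G_i = V (v_{i+1}^m - s v_{i+2}^m), multiplied by V v^delta and lifted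
  to the coordinates: a factor v_i in the monomial beside G_i allows G_i to be removed.\<close>

definition qG :: "xyz \<Rightarrow> (xyz \<Rightarrow> nat) \<Rightarrow> coordinate cpoly" where
  "qG i \<delta> = Y i * X (\<delta>(i := \<delta> i + 1)) -
    (X (pure (nxt i)) * X (\<delta>(nxt i := \<delta> (nxt i) + 1))
      - Const sg * (X (pure (nxt (nxt i))) * X (\<delta>(nxt (nxt i) := \<delta> (nxt (nxt i)) + 1))))"

lemma qG_Ker: "sz \<delta> = m - 2 \<Longrightarrow> qG i \<delta> \<in> Ker"
proof -
  assume d: "sz \<delta> = m - 2"
  have s: "sz (\<delta>(j := \<delta> j + 1)) = m - 1" for j using sz_upd[of \<delta> j 1] d m by simp
  have "vars (qG i \<delta>) \<subseteq> J" unfolding qG_def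
    by (intro vars_J_closed vars_XY s sz_pure') simp
  moreover have "hat (qG i \<delta>) v = 0" for v
  proof -
    have p: "(- x) ^ m = sg * x ^ m" for x :: complex unfolding sg_def by (rule power_minus)
    have m': "x ^ m = x * x ^ (m - 1)" for x :: complex using m by (simp add: power_eq_if)
    have mj: "mn v (\<delta>(j := \<delta> j + 1)) = v j * mn v \<delta>" for j using mn_upd[of v \<delta> j 1] by simp
    have "hat (qG i \<delta>) v = G i v * (V v * (v i * mn v \<delta>)) -
      (H (nxt i) v * (V v * (v (nxt i) * mn v \<delta>)) - sg * (H (nxt (nxt i)) v * (V v * (v (nxt (nxt i)) * mn v \<delta>))))"
      unfolding qG_def hat_simps hat_pure[unfolded hat_simps] phi_G phi_L[OF s] mj ..
    also have "\<dots> = 0"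
      unfolding G_def p unfolding H_def V_def prod_cyc[of _ i] m' by (simp add: algebra_simps)
    finally show ?thesis .
  qed
  ultimately show ?thesis by (simp add: Ker_def)
qed

lemma is_form_qG: "is_form 2 (qG i \<delta>)"
  unfolding qG_def by (intro is_form_diff is_form_Const_mult is_form_Var2)

text \<open>A vector with two coordinates equal to 1 and all others 0 isolates the leading product;
  each of the other products contains an \<open>H\<close> with index different from
  \<open>i\<close>. A nonzero value ensures that distinct scalar multiples are distinct
  forms.\<close>

lemma qG_nonzero: "\<exists>w. peval w (qG i \<delta>) \<noteq> 0"
proof -
  let ?w = "\<lambda>k. if k = Gc i \<or> k = Lc (\<delta>(i := \<delta> i + 1)) then 1 else 0 :: complex"
  have "pure (nxt j) \<noteq> \<delta>(i := \<delta> i + 1)" if "nxt j \<noteq> i" for j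
  proof
    assume eq: "pure (nxt j) = \<delta>(i := \<delta> i + 1)"
    have "pure (nxt j) i = 0" using that by (auto simp: pure_def)
    then show False unfolding eq by simp
  qed
  then have "peval ?w (qG i \<delta>) = 1"
    by (simp add: qG_def peval_diff peval_mult inj_Lc)
  then show ?thesis by (intro exI[of _ ?w]) simp
qed

section \<open>Counting the quadrics\<close>

definition AA :: "(xyz \<Rightarrow> nat) set" where "AA = {\<alpha>. sz \<alpha> = m - 1}"

text \<open>Two digits in base m, since exponents of total degree m - 1 have entries below m. It
  serves as a linear order that selects one of two factorisations differing by a swap.\<close>

definition code :: "(xyz \<Rightarrow> nat) \<Rightarrow> nat" where "code \<alpha> = \<alpha> IX + m * \<alpha> IY"

lemma inj_code: "inj_on code AA"
proof (rule inj_onI)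
  fix \<alpha> \<beta> assume a: "\<alpha> \<in> AA" "\<beta> \<in> AA" "code \<alpha> = code \<beta>"
  have lt: "\<alpha> i < m" "\<beta> i < m" for i
    using a(1,2) le_sz[of \<alpha> i] le_sz[of \<beta> i] m by (auto simp: AA_def)
  have "code \<alpha> mod m = code \<beta> mod m" "code \<alpha> div m = code \<beta> div m" using a(3) by simp_all
  then have x: "\<alpha> IX = \<beta> IX" and y: "\<alpha> IY = \<beta> IY" unfolding code_def using lt m by simp_all
  then have "\<alpha> IZ = \<beta> IZ" using a(1,2) by (simp add: AA_def sz_def sum_cyc[of _ IX])
  then show "\<alpha> = \<beta>" using x y all_cyc[of "\<lambda>i. \<alpha> i = \<beta> i" IX] by (simp add: fun_eq_iff)
qed

definition UU :: "((xyz \<Rightarrow> nat) \<times> (xyz \<Rightarrow> nat)) set" where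
  "UU = {(\<alpha>, \<beta>) \<in> AA \<times> AA. code \<alpha> \<le> code \<beta>}"

lemma finite_AA: "finite AA" unfolding AA_def by (rule finite_exponents)
lemma finite_UU: "finite UU"
  by (rule finite_subset[of _ "AA \<times> AA"]) (auto simp: UU_def finite_AA)

text \<open>\<open>UU\<close> and its mirror image cover \<open>AA \<times> AA\<close> and meet in
  the diagonal, where \<open>inj_code\<close> is used.\<close>

lemma card_UU: "2 * card UU = card AA * card AA + card AA"
proof -
  let ?W = "{(\<alpha>, \<beta>) \<in> AA \<times> AA. code \<beta> \<le> code \<alpha>}"
  have "?W = prod.swap ` UU" by (force simp: UU_def)
  then have W: "card ?W = card UU" by (simp add: card_image)
  have fW: "finite ?W" by (rule finite_subset[of _ "AA \<times> AA"]) (auto simp: finite_AA)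
  have "UU \<union> ?W = AA \<times> AA" by (auto simp: UU_def)
  moreover have "UU \<inter> ?W = (\<lambda>\<alpha>. (\<alpha>, \<alpha>)) ` AA"
  proof (intro equalityI subsetI)
    fix u assume u: "u \<in> UU \<inter> ?W"
    then have "fst u = snd u" by (intro inj_onD[OF inj_code]) (auto simp: UU_def)
    then show "u \<in> (\<lambda>\<alpha>. (\<alpha>, \<alpha>)) ` AA" using u by (intro image_eqI[of _ _ "fst u"]) (auto simp: UU_def)
  qed (auto simp: UU_def)
  moreover have "card ((\<lambda>\<alpha>. (\<alpha>, \<alpha>)) ` AA) = card AA" by (rule card_image) (simp add: inj_on_def)
  ultimately show ?thesis using card_Un_Int[OF finite_UU fW] W by (simp add: card_cartesian_product)
qed

definition GG :: "(xyz \<Rightarrow> nat) set" where "GG = {\<gamma>. sz \<gamma> = 2 * (m - 1)}"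

definition psum :: "(xyz \<Rightarrow> nat) \<times> (xyz \<Rightarrow> nat) \<Rightarrow> xyz \<Rightarrow> nat" where
  "psum u = (\<lambda>i. fst u i + snd u i)"

lemma psum_surj: "\<gamma> \<in> GG \<Longrightarrow> \<exists>u\<in>UU. psum u = \<gamma>"
proof -
  assume g: "\<gamma> \<in> GG"
  then have "m - 1 \<le> sz \<gamma>" by (simp add: GG_def)
  then obtain \<delta> where d: "\<forall>i. \<delta> i \<le> \<gamma> i" "sz \<delta> = m - 1" using exists_subexponent by blast
  define \<epsilon> where "\<epsilon> = (\<lambda>i. \<gamma> i - \<delta> i)"
  have "sz \<epsilon> = m - 1" using sz_diff[of \<delta> \<gamma>] d g by (simp add: \<epsilon>_def GG_def)
  moreover have "psum (\<delta>, \<epsilon>) = \<gamma>" "psum (\<epsilon>, \<delta>) = \<gamma>" using d(1) by (auto simp: psum_def \<epsilon>_def fun_eq_iff)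
  moreover have "(\<delta>, \<epsilon>) \<in> UU \<or> (\<epsilon>, \<delta>) \<in> UU"
    using d(2) \<open>sz \<epsilon> = m - 1\<close> by (auto simp: UU_def AA_def)
  ultimately show ?thesis by blast
qed

definition rep :: "(xyz \<Rightarrow> nat) \<Rightarrow> (xyz \<Rightarrow> nat) \<times> (xyz \<Rightarrow> nat)" where
  "rep \<gamma> = (SOME u. u \<in> UU \<and> psum u = \<gamma>)"

lemma rep: "\<gamma> \<in> GG \<Longrightarrow> rep \<gamma> \<in> UU" "\<gamma> \<in> GG \<Longrightarrow> psum (rep \<gamma>) = \<gamma>"
proof -
  assume "\<gamma> \<in> GG"
  then have "\<exists>u. u \<in> UU \<and> psum u = \<gamma>" using psum_surj by blast
  then have "rep \<gamma> \<in> UU \<and> psum (rep \<gamma>) = \<gamma>" unfolding rep_def by (rule someI_ex)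
  then show "rep \<gamma> \<in> UU" "psum (rep \<gamma>) = \<gamma>" by auto
qed

definition XX :: "(xyz \<Rightarrow> nat) \<times> (xyz \<Rightarrow> nat) \<Rightarrow> coordinate cpoly" where
  "XX u = X (fst u) * X (snd u)"

text \<open>The Veronese relations, one for each unordered pair that is not the chosen representative of
  its product, and the relations \<open>qG\<close>.\<close>

definition quadrics :: "coordinate cpoly set" where
  "quadrics = ((\<lambda>u. XX u - XX (rep (psum u))) ` (UU - rep ` GG)
     \<union> (\<lambda>(i, \<delta>). qG i \<delta>) ` (UNIV \<times> {\<delta>. sz \<delta> = m - 2})) - {0}"

lemma psum_GG: "fst u \<in> AA \<Longrightarrow> snd u \<in> AA \<Longrightarrow> psum u \<in> GG"
  by (simp add: AA_def GG_def psum_def sz_add)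

lemma UU_AA: "u \<in> UU \<Longrightarrow> fst u \<in> AA \<and> snd u \<in> AA" by (auto simp: UU_def)

lemma hat_XX: "fst u \<in> AA \<Longrightarrow> snd u \<in> AA \<Longrightarrow> hat (XX u) v = V v ^ 2 * mn v (psum u)"
  by (simp add: XX_def AA_def phi_L psum_def mn_add power2_eq_square mult_ac)

lemma finite_quadrics: "finite quadrics"
  unfolding quadrics_def using finite_UU finite_exponents by auto

lemma quadrics_Ker: "quadrics \<subseteq> Ker"
proof -
  have "XX u - XX (rep (psum u)) \<in> Ker" if u: "u \<in> UU" for u
  proof -
    note a = UU_AA[OF u]
    have g: "psum u \<in> GG" using a by (intro psum_GG) auto
    note b = UU_AA[OF rep(1)[OF g]]
    have "vars (XX w) \<subseteq> J" if "fst w \<in> AA" "snd w \<in> AA" for w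
      unfolding XX_def using that by (intro vars_J_closed vars_XY) (auto simp: AA_def)
    then have "vars (XX u - XX (rep (psum u))) \<subseteq> J" using a b by (intro vars_J_closed) auto
    then show ?thesis using a b rep(2)[OF g] by (simp add: Ker_def hat_XX)
  qed
  then show ?thesis unfolding quadrics_def using qG_Ker by auto
qed

lemma quadrics_form: "q \<in> quadrics \<Longrightarrow> is_form 2 q"
  unfolding quadrics_def XX_def by (auto intro!: is_form_diff is_form_Var2 is_form_qG)

lemma card_quadrics: "card quadrics \<le> 3 * ((m + 2) choose 4)"
proof -
  have inj: "inj_on rep GG" using rep(2) by (metis inj_onI)
  have "card quadrics \<le> card (UU - rep ` GG) + card ((UNIV :: xyz set) \<times> {\<delta>. sz \<delta> = m - 2})"
  proof -
    have "card quadrics \<le> card ((\<lambda>u. XX u - XX (rep (psum u))) ` (UU - rep ` GG)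
        \<union> (\<lambda>(i, \<delta>). qG i \<delta>) ` (UNIV \<times> {\<delta>. sz \<delta> = m - 2}))"
      unfolding quadrics_def using finite_UU finite_exponents by (intro card_mono) auto
    also have "\<dots> \<le> card ((\<lambda>u. XX u - XX (rep (psum u))) ` (UU - rep ` GG))
        + card ((\<lambda>(i, \<delta>). qG i \<delta>) ` ((UNIV :: xyz set) \<times> {\<delta>. sz \<delta> = m - 2}))" by (rule card_Un_le)
    also have "\<dots> \<le> card (UU - rep ` GG) + card ((UNIV :: xyz set) \<times> {\<delta>. sz \<delta> = m - 2})"
      using finite_UU finite_exponents by (intro add_mono card_image_le) auto
    finally show ?thesis .
  qed
  also have "card (UU - rep ` GG) = card UU - card GG"
    using rep(1) finite_UU by (subst card_Diff_subset) (auto simp: card_image[OF inj] intro: finite_subset)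
  also have "card ((UNIV :: xyz set) \<times> {\<delta>. sz \<delta> = m - 2}) = 3 * (m choose 2)"
  proof -
    have "card {\<delta>. sz \<delta> = m - 2} = m choose (m - 2)" 
    proof -
      have "m - 2 + 2 = m" using m by simp
      then show ?thesis using card_exponents[of "m - 2"] by (simp only:)
    qed
    also have "\<dots> = m choose 2" using m binomial_symmetric[of 2 m] by simp
    finally show ?thesis by (simp add: card_cartesian_product UNIV_xyz)
  qed
  finally have le: "card quadrics \<le> card UU - card GG + 3 * (m choose 2)" .
  note zip = of_nat_eq_iff[where 'a = int, symmetric] of_nat_mult of_nat_add of_nat_numeral of_nat_1
  \<comment> \<open>What remains is |UU| + 3 binom(m,2) = 3 binom(m+2,4) + |GG|, a polynomial
    identity in m. Writing m = k + 4 avoids subtraction of naturals; the denominators are cleared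
    and the identity is checked over the integers.\<close>
  obtain k where k: "m = k + 4" using m by (metis le_Suc_ex add.commute)
  have ch2: "2 * (Suc n choose 2) = Suc n * n" for n
    using choose_two[of "Suc n"] by (simp add: even_mult_iff)
  have a: "2 * card AA = (k + 5) * (k + 4)"
  proof -
    have "card AA = (k + 5) choose (k + 3)" unfolding AA_def card_exponents unfolding k by (simp add: add.commute)
    also have "\<dots> = (k + 5) choose 2" using binomial_symmetric[of 2 "k + 5"] by (simp add: add.commute)
    finally show ?thesis using ch2[of "k + 4"] by (simp add: add.commute)
  qed
  have g: "2 * card GG = (2 * k + 8) * (2 * k + 7)"
  proof -
    have "card GG = (2 * k + 8) choose (2 * k + 6)" unfolding GG_def card_exponents unfolding k by (simp add: add.commute)
    also have "\<dots> = (2 * k + 8) choose 2" using binomial_symmetric[of 2 "2 * k + 8"] by (simp add: add.commute)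
    finally show ?thesis using ch2[of "2 * k + 7"] by (simp add: add.commute)
  qed
  have t: "24 * ((m + 2) choose 4) = (k + 6) * (k + 5) * (k + 4) * (k + 3)"
  proof -
    have "Suc l * (Suc n choose Suc l) = Suc n * (n choose l)" for n l
      using Suc_times_binomial_eq[of n l] by (simp only: mult.commute)
    note abs = this
    have e: "Suc 3 = 4" "Suc 2 = 3" "Suc (k + 5) = k + 6" "Suc (k + 4) = k + 5" "Suc (k + 3) = k + 4" by simp_all
    have "4 * ((k + 6) choose 4) = (k + 6) * ((k + 5) choose 3)"
      using abs[of 3 "k + 5"] by (simp only: e)
    moreover have "3 * ((k + 5) choose 3) = (k + 5) * ((k + 4) choose 2)"
      using abs[of 2 "k + 4"] by (simp only: e)
    moreover have "2 * ((k + 4) choose 2) = (k + 4) * (k + 3)"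
      using ch2[of "k + 3"] by (simp only: e)
    ultimately have "24 * int ((k + 6) choose 4) = (int k + 6) * (int k + 5) * (int k + 4) * (int k + 3)"
      unfolding zip
    proof -
      fix A B C l :: int
      assume h: "4 * A = (l + 6) * B" "3 * B = (l + 5) * C" "2 * C = (l + 4) * (l + 3)"
      have "24 * A = 6 * (4 * A)" by simp
      also have "\<dots> = 2 * (l + 6) * (3 * B)" unfolding h(1) by simp
      also have "\<dots> = (l + 6) * (l + 5) * (2 * C)" unfolding h(2) by simp
      finally show "24 * A = (l + 6) * (l + 5) * (l + 4) * (l + 3)" unfolding h(3) by (simp only: mult.assoc)
    qed
    then have "24 * ((k + 6) choose 4) = (k + 6) * (k + 5) * (k + 4) * (k + 3)" unfolding zip .
    moreover have "m + 2 = k + 6" using k by simp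
    ultimately show ?thesis by (simp only:)
  qed
  have c: "2 * (m choose 2) = (k + 4) * (k + 3)" using ch2[of "k + 3"] unfolding k by (simp add: add.commute)
  have "8 * (int (card UU) + 3 * int (m choose 2)) = 8 * (3 * int ((m + 2) choose 4) + int (card GG))"
  proof -
    define u a' g' b t' where "u = int (card UU)" and "a' = int (card AA)" and "g' = int (card GG)"
      and "b = int (m choose 2)" and "t' = int ((m + 2) choose 4)"
    define l where "l = int k"
    have h: "2 * u = a' * a' + a'" "2 * a' = (l + 5) * (l + 4)" "2 * g' = (2 * l + 8) * (2 * l + 7)"
      "2 * b = (l + 4) * (l + 3)" "24 * t' = (l + 6) * (l + 5) * (l + 4) * (l + 3)"
      using card_UU a g c t unfolding zip u_def a'_def g'_def b_def t'_def l_def by simp_all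
    have "8 * u = (2 * a') * (2 * a') + 2 * (2 * a')" using h(1) by simp
    then have "8 * (u + 3 * b) = (2 * a') * (2 * a') + 2 * (2 * a') + 12 * (2 * b)" by simp
    also have "\<dots> = (l + 6) * (l + 5) * (l + 4) * (l + 3) + 4 * ((2 * l + 8) * (2 * l + 7))"
      unfolding h(2,4) by (simp add: algebra_simps)
    also have "\<dots> = 8 * (3 * t' + g')" unfolding h(3,5)[symmetric] by simp
    finally have "8 * (u + 3 * b) = 8 * (3 * t' + g')" .
    then show ?thesis by (simp only: u_def g'_def b_def t'_def)
  qed
  then have "8 * (card UU + 3 * (m choose 2)) = 8 * (3 * ((m + 2) choose 4) + card GG)" unfolding zip .
  then have "card UU + 3 * (m choose 2) = 3 * ((m + 2) choose 4) + card GG" by simp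
  \<comment> \<open>The subtraction of naturals in \<open>le\<close> is a genuine one, because
    \<open>rep\<close> embeds \<open>GG\<close> into \<open>UU\<close>.\<close>
  then show ?thesis using le card_mono[OF finite_UU, of "rep ` GG"] rep(1) card_image[OF inj] by fastforce
qed

section \<open>Rewriting to normal form modulo the generators\<close>

definition PL :: "(xyz \<Rightarrow> nat) list \<Rightarrow> coordinate cpoly" where "PL \<alpha>s = (\<Prod>\<alpha>\<leftarrow>\<alpha>s. X \<alpha>)"

lemma MP_PL: "MP e \<alpha>s = MP e [] * PL \<alpha>s" by (simp add: MP_def PL_def)
lemma PL_Cons: "PL (\<alpha> # \<alpha>s) = X \<alpha> * PL \<alpha>s" by (simp add: PL_def)

lemma vars_PL: "set \<alpha>s \<subseteq> AA \<Longrightarrow> vars (PL \<alpha>s) \<subseteq> J"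
  unfolding PL_def by (rule vars_prod_list) (auto simp: AA_def)

lemma vars_MP': "set \<alpha>s \<subseteq> AA \<Longrightarrow> vars (MP e \<alpha>s) \<subseteq> J"
  by (rule vars_MP) (auto simp: AA_def)

lemma sz_Lsum': "set \<alpha>s \<subseteq> AA \<Longrightarrow> sz (Lsum \<alpha>s) = (m - 1) * length \<alpha>s"
  by (rule sz_Lsum) (auto simp: AA_def)

definition lst :: "(xyz \<Rightarrow> nat) \<Rightarrow> (xyz \<Rightarrow> nat) list" where
  "lst \<sigma> = (SOME \<alpha>s. Lsum \<alpha>s = \<sigma> \<and> set \<alpha>s \<subseteq> AA)"

lemma lst:
  assumes "(m - 1) dvd sz \<sigma>"
  shows "Lsum (lst \<sigma>) = \<sigma>" "set (lst \<sigma>) \<subseteq> AA"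
proof -
  obtain k where "sz \<sigma> = (m - 1) * k" using assms by blast
  from exists_Lsum[OF this] have "\<exists>\<alpha>s. Lsum \<alpha>s = \<sigma> \<and> set \<alpha>s \<subseteq> AA" by (auto simp: AA_def)
  then have "Lsum (lst \<sigma>) = \<sigma> \<and> set (lst \<sigma>) \<subseteq> AA" unfolding lst_def by (rule someI_ex)
  then show "Lsum (lst \<sigma>) = \<sigma>" "set (lst \<sigma>) \<subseteq> AA" by auto
qed

text \<open>The rewriting terminates because the cubic and the relations \<open>qG\<close> both
  lower the number of factors \<open>G\<close>, while the Veronese quadrics only rearrange the other
  factors.\<close>

lemma Ker_generated:
  assumes L: "ideal L (poly_ring J)" "L \<subseteq> Ker" "quadrics \<subseteq> L" "cubic_C m \<in> L"
  shows "Ker \<subseteq> L"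
proof -
  note LI = poly_ideal[OF L(1)]
  have tr: "f - h \<in> L" if "f - g \<in> L" "g - h \<in> L" for f g h using LI(3)[OF that] by simp
  have sy: "g - f \<in> L" if "f - g \<in> L" for f g using LI(5)[OF that] by simp
  have mu: "h * f - h * g \<in> L" if "f - g \<in> L" "vars h \<subseteq> J" for f g h
    using LI(4)[OF that] by (simp add: right_diff_distrib)
  have QL: "q \<in> L" if "q \<in> quadrics \<or> q = 0" for q using that L(3) LI(1) by blast
  have XXr: "XX u - XX (rep (psum u)) \<in> L" if "u \<in> UU" for u
  proof (cases "u \<in> rep ` GG")
    case True
    then have "rep (psum u) = u" using rep(2) by force
    then show ?thesis using LI(1) by simp
  next
    case False
    then show ?thesis using that by (intro QL) (auto simp: quadrics_def)
  qed
  have XXr': "X \<alpha> * X \<beta> - XX (rep (\<lambda>i. \<alpha> i + \<beta> i)) \<in> L" if "\<alpha> \<in> AA" "\<beta> \<in> AA" for \<alpha> \<beta>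
  proof -
    have "(\<alpha>, \<beta>) \<in> UU \<or> (\<beta>, \<alpha>) \<in> UU" using that by (auto simp: UU_def)
    moreover have "psum (\<beta>, \<alpha>) = psum (\<alpha>, \<beta>)" by (simp add: psum_def add.commute)
    ultimately show ?thesis using XXr[of "(\<alpha>, \<beta>)"] XXr[of "(\<beta>, \<alpha>)"]
      by (auto simp: XX_def psum_def mult.commute)
  qed
  have ver: "X \<alpha> * X \<beta> - X \<gamma> * X \<delta> \<in> L"
    if "\<alpha> \<in> AA" "\<beta> \<in> AA" "\<gamma> \<in> AA" "\<delta> \<in> AA" "(\<lambda>i. \<alpha> i + \<beta> i) = (\<lambda>i. \<gamma> i + \<delta> i)" for \<alpha> \<beta> \<gamma> \<delta>
    using tr[OF XXr'[OF that(1,2)]] sy[OF XXr'[OF that(3,4)]] that(5) by simp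
  have qGL: "qG i \<delta> \<in> L" if "sz \<delta> = m - 2" for i \<delta>
    using that by (intro QL) (auto simp: quadrics_def)
  \<comment> \<open>Exchange argument: the part of \<open>\<delta>\<close> not supplied by the head
    \<open>\<alpha>\<close> is padded to an exponent \<open>\<zeta>\<close> of degree m - 1 that
    divides the product of the tail. Induction moves \<open>\<zeta>\<close> to the front of the
    tail, and one Veronese relation turns \<open>\<alpha>\<close>, \<open>\<zeta>\<close> into
    \<open>\<delta>\<close>, \<open>\<theta>\<close>.\<close>
  have pull: "\<exists>\<beta>s. set \<beta>s \<subseteq> AA \<and> Lsum (\<delta> # \<beta>s) = Lsum \<alpha>s \<and> PL \<alpha>s - PL (\<delta> # \<beta>s) \<in> L"
    if "set \<alpha>s \<subseteq> AA" "\<alpha>s \<noteq> []" "\<delta> \<in> AA" "\<forall>i. \<delta> i \<le> Lsum \<alpha>s i" for \<alpha>s \<delta>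
    using that
  proof (induction \<alpha>s arbitrary: \<delta>)
    case (Cons \<alpha> \<alpha>s)
    show ?case
    proof (cases "\<alpha>s = []")
      case True
      have a: "sz \<alpha> = m - 1" "sz \<delta> = m - 1" "\<forall>i. \<delta> i \<le> \<alpha> i" using Cons.prems True by (auto simp: AA_def Lsum_Cons Lsum_Nil)
      then have "sz (\<lambda>i. \<alpha> i - \<delta> i) = 0" using sz_diff[of \<delta> \<alpha>] by simp
      then have "\<alpha> i - \<delta> i = 0" for i unfolding sz_eq_0 by (rule fun_cong)
      then have "\<delta> = \<alpha>" using a(3) by (auto simp: fun_eq_iff intro: antisym)
      then show ?thesis using True LI(1) by (intro exI[of _ "[]"]) simp
    next
      case False
      have prems: "\<alpha> \<in> AA" "set \<alpha>s \<subseteq> AA" "\<delta> \<in> AA" "\<And>i. \<delta> i \<le> \<alpha> i + Lsum \<alpha>s i"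
        using Cons.prems by (auto simp: Lsum_Cons)
      define \<tau> where "\<tau> = Lsum \<alpha>s"
      define \<zeta>0 where "\<zeta>0 = (\<lambda>i. \<delta> i - \<alpha> i)"
      have z0: "\<zeta>0 i \<le> \<tau> i" for i using prems(4)[of i] by (simp add: \<zeta>0_def \<tau>_def)
      have sz0: "sz \<zeta>0 \<le> m - 1"
      proof -
        have "sz \<zeta>0 \<le> sz \<delta>" unfolding sz_def by (rule sum_mono) (simp add: \<zeta>0_def)
        then show ?thesis using prems(3) by (simp add: AA_def)
      qed
      have "sz \<tau> = (m - 1) * length \<alpha>s" unfolding \<tau>_def by (rule sz_Lsum'[OF prems(2)])
      then have szt: "m - 1 \<le> sz \<tau>" using False by (cases \<alpha>s) auto
      have "m - 1 - sz \<zeta>0 \<le> sz (\<lambda>i. \<tau> i - \<zeta>0 i)" using sz_diff[of \<zeta>0 \<tau>] z0 szt by simp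
      then obtain \<eta> where e: "\<forall>i. \<eta> i \<le> \<tau> i - \<zeta>0 i" "sz \<eta> = m - 1 - sz \<zeta>0" using exists_subexponent by blast
      define \<zeta> where "\<zeta> = (\<lambda>i. \<zeta>0 i + \<eta> i)"
      have zA: "\<zeta> \<in> AA" using e(2) sz0 by (simp add: \<zeta>_def AA_def sz_add)
      have zle: "\<forall>i. \<zeta> i \<le> Lsum \<alpha>s i"
      proof
        fix i show "\<zeta> i \<le> Lsum \<alpha>s i" using e(1)[rule_format, of i] z0[of i] by (simp add: \<zeta>_def \<tau>_def)
      qed
      obtain \<beta>s where b: "set \<beta>s \<subseteq> AA" "Lsum (\<zeta> # \<beta>s) = Lsum \<alpha>s" "PL \<alpha>s - PL (\<zeta> # \<beta>s) \<in> L"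
        using Cons.IH[OF prems(2) False zA zle] by blast
      define \<theta> where "\<theta> = (\<lambda>i. \<alpha> i + \<zeta> i - \<delta> i)"
      have dle: "\<delta> i \<le> \<alpha> i + \<zeta> i" for i by (simp add: \<zeta>_def \<zeta>0_def)
      have th: "(\<lambda>i. \<alpha> i + \<zeta> i) = (\<lambda>i. \<delta> i + \<theta> i)" using dle by (auto simp: \<theta>_def fun_eq_iff)
      have "sz \<alpha> + sz \<zeta> = sz \<delta> + sz \<theta>" using th sz_add by metis
      then have tA: "\<theta> \<in> AA" using prems zA by (simp add: AA_def)
      have "X \<alpha> * PL \<alpha>s - X \<alpha> * (X \<zeta> * PL \<beta>s) \<in> L"
        using mu[OF b(3), of "X \<alpha>"] prems(1) by (simp add: PL_Cons AA_def)
      moreover have "X \<alpha> * (X \<zeta> * PL \<beta>s) - X \<delta> * (X \<theta> * PL \<beta>s) \<in> L"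
        using mu[OF ver[OF prems(1) zA prems(3) tA th] vars_PL[OF b(1)]] by (simp add: mult_ac)
      ultimately have "PL (\<alpha> # \<alpha>s) - PL (\<delta> # \<theta> # \<beta>s) \<in> L" unfolding PL_Cons by (rule tr)
      moreover have "Lsum (\<delta> # \<theta> # \<beta>s) = Lsum (\<alpha> # \<alpha>s)"
      proof
        fix i
        have "Lsum \<alpha>s i = \<zeta> i + Lsum \<beta>s i" using b(2) by (metis Lsum_Cons)
        then show "Lsum (\<delta> # \<theta> # \<beta>s) i = Lsum (\<alpha> # \<alpha>s) i" using fun_cong[OF th, of i] by (simp add: Lsum_Cons)
      qed
      ultimately show ?thesis using tA b(1) by (intro exI[of _ "\<theta> # \<beta>s"]) auto
    qed
  qed simp
  \<comment> \<open>Modulo \<open>L\<close> a product of the \<open>X \<alpha>\<close> depends only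
    on the sum of its exponents: the factors of the second list are pulled to the front one after
    another.\<close>
  have same: "PL \<alpha>s - PL \<beta>s \<in> L" if "set \<alpha>s \<subseteq> AA" "set \<beta>s \<subseteq> AA" "Lsum \<alpha>s = Lsum \<beta>s" for \<alpha>s \<beta>s
    using that
  proof (induction \<beta>s arbitrary: \<alpha>s)
    case Nil
    then have "sz (Lsum \<alpha>s) = 0" by (simp add: Lsum_Nil sz_def)
    then have "\<alpha>s = []" using sz_Lsum'[OF Nil(1)] m by simp
    then show ?case using LI(1) by simp
  next
    case (Cons \<beta> \<beta>s)
    have b: "\<beta> \<in> AA" "set \<beta>s \<subseteq> AA" using Cons.prems by auto
    have ne: "\<alpha>s \<noteq> []"
    proof
      assume "\<alpha>s = []"
      then have "Lsum (\<beta> # \<beta>s) = (\<lambda>_. 0)" using Cons.prems(3) by (simp only: Lsum_Nil)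
      then have "sz (Lsum (\<beta> # \<beta>s)) = 0" by (simp only: sz_eq_0)
      then show False using sz_Lsum'[OF Cons.prems(2)] m by simp
    qed
    have "\<forall>i. \<beta> i \<le> Lsum \<alpha>s i" unfolding Cons.prems(3) by (simp add: Lsum_Cons)
    from pull[OF Cons.prems(1) ne b(1) this] obtain \<gamma>s where g: "set \<gamma>s \<subseteq> AA"
      "Lsum (\<beta> # \<gamma>s) = Lsum \<alpha>s" "PL \<alpha>s - PL (\<beta> # \<gamma>s) \<in> L" by blast
    have "Lsum \<gamma>s = Lsum \<beta>s"
    proof
      fix i
      have "\<beta> i + Lsum \<gamma>s i = \<beta> i + Lsum \<beta>s i" using g(2) Cons.prems(3) by (metis Lsum_Cons)
      then show "Lsum \<gamma>s i = Lsum \<beta>s i" by simp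
    qed
    then have "PL \<gamma>s - PL \<beta>s \<in> L" by (rule Cons.IH[OF g(1) b(2)])
    then have "X \<beta> * PL \<gamma>s - X \<beta> * PL \<beta>s \<in> L" using b(1) by (intro mu) (simp_all add: AA_def)
    then show ?case using tr[OF g(3)] by (simp add: PL_Cons)
  qed
  define NF where "NF j = MP (fst j) (lst (snd j))" for j
  define red where "red f \<longleftrightarrow> (\<exists>A c. finite A \<and> A \<subseteq> nf \<and> f - (\<Sum>j\<in>A. Const (c j) * NF j) \<in> L)" for f
  have red_L: "red f" if "f - g \<in> L" "red g" for f g
  proof -
    obtain A c where A: "finite A" "A \<subseteq> nf" "g - (\<Sum>j\<in>A. Const (c j) * NF j) \<in> L"
      using \<open>red g\<close> unfolding red_def by (elim exE conjE)
    show ?thesis unfolding red_def using A(1,2) tr[OF \<open>f - g \<in> L\<close> A(3)]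
      by (intro exI conjI)
  qed
  have red_0: "red 0" unfolding red_def using LI(1) by (intro exI[of _ "{}"]) simp
  have red_add: "red (f + g)" if fg: "red f" "red g" for f g
  proof -
    obtain A c B d where A: "finite A" "A \<subseteq> nf" "f - (\<Sum>j\<in>A. Const (c j) * NF j) \<in> L"
      and B: "finite B" "B \<subseteq> nf" "g - (\<Sum>j\<in>B. Const (d j) * NF j) \<in> L" using fg unfolding red_def by blast
    define c' where "c' j = (if j \<in> A then c j else 0)" for j
    define d' where "d' j = (if j \<in> B then d j else 0)" for j
    have "(\<Sum>j\<in>A. Const (c j) * NF j) = (\<Sum>j\<in>A \<union> B. Const (c' j) * NF j)"
      by (rule sum.mono_neutral_cong_left) (use A B in \<open>auto simp: c'_def\<close>)
    moreover have "(\<Sum>j\<in>B. Const (d j) * NF j) = (\<Sum>j\<in>A \<union> B. Const (d' j) * NF j)"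
      by (rule sum.mono_neutral_cong_left) (use A B in \<open>auto simp: d'_def\<close>)
    ultimately have "(\<Sum>j\<in>A \<union> B. Const (c' j + d' j) * NF j) =
        (\<Sum>j\<in>A. Const (c j) * NF j) + (\<Sum>j\<in>B. Const (d j) * NF j)"
      by (simp add: Const_add distrib_right sum.distrib)
    then have "(f + g) - (\<Sum>j\<in>A \<union> B. Const (c' j + d' j) * NF j) \<in> L"
      using LI(3)[OF A(3) B(3)] by (simp add: algebra_simps)
    then show ?thesis unfolding red_def using A B by (intro exI[of _ "A \<union> B"] exI[of _ "\<lambda>j. c' j + d' j"]) simp
  qed
  have red_scale: "red (Const k * f)" if f: "red f" for k f
  proof -
    obtain A c where A: "finite A" "A \<subseteq> nf" "f - (\<Sum>j\<in>A. Const (c j) * NF j) \<in> L" using f unfolding red_def by blast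
    have "Const k * f - (\<Sum>j\<in>A. Const (k * c j) * NF j) \<in> L"
      using LI(4)[OF A(3), of "Const k"] by (simp add: right_diff_distrib sum_distrib_left Const_mult mult.assoc)
    then show ?thesis unfolding red_def using A by (intro exI[of _ A] exI[of _ "\<lambda>j. k * c j"]) simp
  qed
  have red_diff: "red (f - g)" if "red f" "red g" for f g
    using red_add[OF that(1) red_scale[OF that(2), of "-1"]] by (simp add: Const_uminus)
  have pA: "pure i \<in> AA" for i by (simp add: AA_def sz_pure')
  have red_MP: "red (MP e \<alpha>s)" if "set \<alpha>s \<subseteq> AA" for e \<alpha>s
    using that
  proof (induction "sz e" arbitrary: e \<alpha>s rule: less_induct)
    case less
    \<comment> \<open>A monomial fails to be normal either because all three \<open>G\<close> occur,
      where the cubic applies, or because some G_i stands beside a monomial divisible by v_i, where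
      \<open>qG\<close> applies.\<close>
    consider "\<forall>i. e i > 0" | i where "e i > 0" "Lsum \<alpha>s i > 0"
      | "\<exists>i. e i = 0" "\<forall>i. e i = 0 \<or> Lsum \<alpha>s i = 0" by (meson gr0I)
    then show ?case
    proof cases
      case 1
      define e' where "e' i = e i - 1" for i
      have e: "e i = e' i + 1" for i using 1[rule_format, of i] by (simp add: e'_def)
      have sze: "sz e = sz e' + 3" by (simp add: sz_def e sum_cyc[of _ IX])
      let ?P = "MP e' \<alpha>s"
      have vP: "vars ?P \<subseteq> J" by (rule vars_MP'[OF less.prems])
      have top: "Y IX * Y IY * Y IZ * ?P = MP e \<alpha>s"
        by (simp add: MP_def prod_cyc[of _ IX] e mult_ac)
      have HHH: "red (X (pure IX) * X (pure IY) * X (pure IZ) * ?P)"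
      proof -
        have "red (MP e' (pure IX # pure IY # pure IZ # \<alpha>s))" using less.prems pA sze by (intro less.hyps) auto
        then show ?thesis by (simp add: MP_L mult_ac)
      qed
      have GHH: "red (Y i * X (pure j) * X (pure k) * ?P)" for i j k
      proof -
        have "red (MP (e'(i := e' i + 1)) (pure j # pure k # \<alpha>s))"
          using less.prems pA sze sz_upd[of e' i 1] by (intro less.hyps) auto
        then show ?thesis unfolding MP_G MP_L by (simp add: mult_ac)
      qed
      have CL: "?P * cubic_C m \<in> L" by (rule LI(4)[OF L(4) vP])
      show ?thesis
      proof (cases "odd m")
        case True
        have "MP e \<alpha>s - (Const 2 * (X (pure IX) * X (pure IY) * X (pure IZ) * ?P) + Y IX * X (pure IY) * X (pure IZ) * ?P
          + Y IY * X (pure IX) * X (pure IZ) * ?P + Y IZ * X (pure IX) * X (pure IY) * ?P) = - (?P * cubic_C m)"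
          unfolding top[symmetric] cubic_C_eq Const_numeral using True by (simp add: algebra_simps)
        then have "MP e \<alpha>s - (Const 2 * (X (pure IX) * X (pure IY) * X (pure IZ) * ?P) + Y IX * X (pure IY) * X (pure IZ) * ?P
          + Y IY * X (pure IX) * X (pure IZ) * ?P + Y IZ * X (pure IX) * X (pure IY) * ?P) \<in> L"
          using LI(5)[OF CL] by simp
        then show ?thesis by (rule red_L) (intro red_add red_scale HHH GHH)
      next
        case False
        have "MP e \<alpha>s - Const (-1) * (Y IX * X (pure IY) * X (pure IZ) * ?P
          + Y IY * X (pure IX) * X (pure IZ) * ?P + Y IZ * X (pure IX) * X (pure IY) * ?P) = ?P * cubic_C m"
          unfolding top[symmetric] cubic_C_eq using False by (simp add: algebra_simps Const_uminus)
        then have "MP e \<alpha>s - Const (-1) * (Y IX * X (pure IY) * X (pure IZ) * ?P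
          + Y IY * X (pure IX) * X (pure IZ) * ?P + Y IZ * X (pure IX) * X (pure IY) * ?P) \<in> L"
          using CL by simp
        then show ?thesis by (rule red_L) (intro red_add red_scale GHH)
      qed
    next
      case (2 i)
      define e' where "e' = e(i := e i - 1)"
      have e: "e = e'(i := e' i + 1)" unfolding e'_def using 2(1) by (rule upd_decr)
      have sze: "sz e = sz e' + 1" by (subst e) (rule sz_upd)
      have ne: "\<alpha>s \<noteq> []" using 2(2) by (auto simp: Lsum_Nil)
      define \<tau> where "\<tau> = (Lsum \<alpha>s)(i := Lsum \<alpha>s i - 1)"
      have t: "Lsum \<alpha>s = \<tau>(i := \<tau> i + 1)" unfolding \<tau>_def using 2(2) by (rule upd_decr)
      have "sz (Lsum \<alpha>s) = sz \<tau> + 1" by (subst t) (rule sz_upd)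
      moreover have "sz (Lsum \<alpha>s) \<ge> m - 1" using sz_Lsum'[OF less.prems] ne by (cases \<alpha>s) auto
      ultimately have "m - 2 \<le> sz \<tau>" by simp
      \<comment> \<open>One factor v_i has been set aside in \<open>\<tau>\<close>. Degree m - 2 is
        right because restoring v_i makes \<open>\<delta>\<close> the exponent of a
        coordinate.\<close>
      then obtain \<delta> where d: "\<forall>j. \<delta> j \<le> \<tau> j" "sz \<delta> = m - 2" using exists_subexponent by blast
      have dA: "\<delta>(j := \<delta> j + 1) \<in> AA" for j using sz_upd[of \<delta> j 1] d(2) m by (simp add: AA_def)
      have dle: "\<forall>j. (\<delta>(i := \<delta> i + 1)) j \<le> Lsum \<alpha>s j" unfolding t using d(1) by auto
      obtain \<beta>s where b: "set \<beta>s \<subseteq> AA" "PL \<alpha>s - PL (\<delta>(i := \<delta> i + 1) # \<beta>s) \<in> L"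
        using pull[OF less.prems ne dA dle] by blast
      let ?P = "MP e' \<beta>s"
      have vP: "vars ?P \<subseteq> J" by (rule vars_MP'[OF b(1)])
      have XXP: "red (X (pure j) * X (\<delta>(k := \<delta> k + 1)) * ?P)" for j k
      proof -
        have "red (MP e' (pure j # (\<delta>(k := \<delta> k + 1)) # \<beta>s))" using b(1) pA dA sze by (intro less.hyps) auto
        then show ?thesis by (simp add: MP_L mult_ac)
      qed
      have "MP e [] * PL \<alpha>s - MP e [] * PL (\<delta>(i := \<delta> i + 1) # \<beta>s) \<in> L"
        by (rule mu[OF b(2)]) (rule vars_MP', simp)
      then have 1: "MP e \<alpha>s - MP e (\<delta>(i := \<delta> i + 1) # \<beta>s) \<in> L" by (simp only: MP_PL[symmetric])
      have "MP e (\<delta>(i := \<delta> i + 1) # \<beta>s) = Y i * X (\<delta>(i := \<delta> i + 1)) * ?P"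
        by (subst e) (simp only: MP_G MP_L mult_ac)
      then have "MP e (\<delta>(i := \<delta> i + 1) # \<beta>s) - (X (pure (nxt i)) * X (\<delta>(nxt i := \<delta> (nxt i) + 1)) * ?P
        - Const sg * (X (pure (nxt (nxt i))) * X (\<delta>(nxt (nxt i) := \<delta> (nxt (nxt i)) + 1)) * ?P)) = ?P * qG i \<delta>"
        by (simp only: qG_def left_diff_distrib right_diff_distrib mult_ac)
      moreover have "?P * qG i \<delta> \<in> L" by (rule LI(4)[OF qGL[OF d(2)] vP])
      ultimately have 2: "MP e (\<delta>(i := \<delta> i + 1) # \<beta>s) - (X (pure (nxt i)) * X (\<delta>(nxt i := \<delta> (nxt i) + 1)) * ?P
        - Const sg * (X (pure (nxt (nxt i))) * X (\<delta>(nxt (nxt i) := \<delta> (nxt (nxt i)) + 1)) * ?P)) \<in> L" by simp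
      show ?thesis by (rule red_L[OF tr[OF 1 2]]) (intro red_diff red_scale XXP)
    next
      case 3
      let ?j = "(e, Lsum \<alpha>s)"
      have dv: "(m - 1) dvd sz (Lsum \<alpha>s)" by (simp add: sz_Lsum'[OF less.prems])
      then have j: "?j \<in> nf" using 3 by (auto simp: nf_def)
      have "PL \<alpha>s - PL (lst (Lsum \<alpha>s)) \<in> L"
        using lst[OF dv] less.prems by (intro same) auto
      then have "MP e [] * PL \<alpha>s - MP e [] * PL (lst (Lsum \<alpha>s)) \<in> L" by (rule mu) (rule vars_MP', simp)
      then have "MP e \<alpha>s - (\<Sum>j\<in>{?j}. Const 1 * NF j) \<in> L" by (simp add: NF_def MP_PL[symmetric])
      then show ?thesis unfolding red_def using j by (intro exI[of _ "{?j}"] exI[of _ "\<lambda>_. 1"]) simp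
    qed
  qed
  show ?thesis
  proof
    fix f assume f: "f \<in> Ker"
    have "red f"
    proof (rule poly_MP_induct[where D = "\<lambda>_. True"])
      show "vars f \<subseteq> J" using f by (simp add: Ker_def)
      show "red (Const c * MP e \<alpha>s)" if "\<forall>\<alpha>\<in>set \<alpha>s. sz \<alpha> = m - 1" for c e \<alpha>s
        using that by (intro red_scale red_MP) (auto simp: AA_def)
    qed (simp_all add: red_0 red_add)
    then obtain A c where A: "finite A" "A \<subseteq> nf" "f - (\<Sum>j\<in>A. Const (c j) * NF j) \<in> L" unfolding red_def by blast
    have hNF: "hat (NF j) v = mf (fst j) (snd j) v" if "j \<in> nf" for j v
    proof -
      have dv: "(m - 1) dvd sz (snd j)" using that by (auto simp: nf_def)
      show ?thesis unfolding NF_def using lst[OF dv] by (subst hat_MP) (auto simp: AA_def)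
    qed
    have "(\<Sum>j\<in>A. c j * mf (fst j) (snd j) v) = 0" for v
    proof -
      have "hat (f - (\<Sum>j\<in>A. Const (c j) * NF j)) v = 0" using A(3) L(2) by (auto simp: Ker_def)
      then have "(\<Sum>j\<in>A. c j * hat (NF j) v) = 0" using f by (simp add: Ker_def)
      moreover have "(\<Sum>j\<in>A. c j * hat (NF j) v) = (\<Sum>j\<in>A. c j * mf (fst j) (snd j) v)"
        using A(2) hNF by (intro sum.cong) auto
      ultimately show ?thesis by simp
    qed
    then have "c j = 0" if "j \<in> A" for j using nf_independent[OF A(1,2)] that by blast
    then have "(\<Sum>j\<in>A. Const (c j) * NF j) = 0" by simp
    then show "f \<in> L" using A(3) by simp
  qed
qed

text \<open>Only \<open>\<le>\<close> was proved for the number of quadrics, so scalar multiples of one of them make up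
  the exact number.\<close>

lemma Ker_generators:
  "\<exists>Q \<subseteq> carrier (poly_ring J). finite Q \<and> card Q = 3 * ((m + 2) choose 4) \<and>
     (\<forall>q\<in>Q. q \<noteq> 0 \<and> is_form 2 q) \<and> Ker = genideal (poly_ring J) (insert (cubic_C m) Q)"
proof -
  obtain \<delta> :: "xyz \<Rightarrow> nat" where d: "sz \<delta> = m - 2" using sz_pure by blast
  define g where "g = qG IX \<delta>"
  have g: "g \<in> Ker" "is_form 2 g" unfolding g_def using qG_Ker[OF d] is_form_qG by auto
  obtain w where w: "peval w g \<noteq> 0" unfolding g_def using qG_nonzero by blast
  define M where "M = (\<lambda>k. Const k * g) ` {k. k \<noteq> 0}"
  have injM: "inj_on (\<lambda>k. Const k * g) {k. k \<noteq> 0}"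
  proof (rule inj_onI)
    fix k l assume "Const k * g = Const l * g"
    then have "peval w (Const k * g) = peval w (Const l * g)" by simp
    then show "k = l" using w by (simp add: peval_mult)
  qed
  have "infinite {k :: complex. k \<noteq> 0}"
    using infinite_UNIV_char_0[where 'a = complex] by (simp add: Collect_neg_eq finite_Diff2 Compl_eq_Diff_UNIV)
  then have "infinite M" unfolding M_def using injM finite_imageD by blast
  then have "infinite (M - quadrics)" using finite_quadrics by simp
  from infinite_arbitrarily_large[OF this] obtain P where
    P: "finite P" "card P = 3 * ((m + 2) choose 4) - card quadrics" "P \<subseteq> M - quadrics" by blast
  define Q where "Q = quadrics \<union> P"
  have M: "q \<noteq> 0 \<and> is_form 2 q \<and> q \<in> Ker" if qM: "q \<in> M" for q
  proof -
    obtain k where k: "k \<noteq> 0" "q = Const k * g" using qM by (auto simp: M_def)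
    have "peval w q \<noteq> 0" using k w by (simp add: peval_mult)
    then have "q \<noteq> 0" by auto
    then show ?thesis using k g poly_ideal(4)[OF ideal_Ker g(1), of "Const k"] is_form_Const_mult by auto
  qed
  have QK: "Q \<subseteq> Ker" unfolding Q_def using quadrics_Ker P(3) M by blast
  then have iQ: "insert (cubic_C m) Q \<subseteq> carrier (poly_ring J)" using cubic_C_Ker by (auto simp: Ker_def)
  have "card Q = 3 * ((m + 2) choose 4)"
    unfolding Q_def using P card_quadrics finite_quadrics by (subst card_Un_disjoint) auto
  moreover have "\<forall>q\<in>Q. q \<noteq> 0 \<and> is_form 2 q"
  proof -
    have "0 \<notin> quadrics" by (simp add: quadrics_def)
    then show ?thesis unfolding Q_def using M P(3) quadrics_form by blast
  qed
  moreover have "Ker = genideal (poly_ring J) (insert (cubic_C m) Q)"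
  proof
    show "genideal (poly_ring J) (insert (cubic_C m) Q) \<subseteq> Ker"
      using QK cubic_C_Ker by (intro PR.genideal_minimal ideal_Ker) auto
    then show "Ker \<subseteq> genideal (poly_ring J) (insert (cubic_C m) Q)"
      using PR.genideal_self[OF iQ] by (intro Ker_generated PR.genideal_ideal iQ) (auto simp: Q_def)
  qed
  ultimately show ?thesis using iQ P(1) finite_quadrics by (intro exI[of _ Q]) (auto simp: Q_def)
qed

end

section \<open>The surface\<close>

definition edeg :: "('i \<Rightarrow>\<^sub>0 nat) \<Rightarrow> nat" where
  "edeg E = (\<Sum>k\<in>Poly_Mapping.keys E. Poly_Mapping.lookup E k)"

definition hcomp :: "nat \<Rightarrow> 'i cpoly \<Rightarrow> 'i cpoly" where
  "hcomp d f = (\<Sum>E | E \<in> Poly_Mapping.keys f \<and> edeg E = d. Poly_Mapping.single E (Poly_Mapping.lookup f E))"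

lemma is_form_sum: "(\<And>x. x \<in> A \<Longrightarrow> is_form d (f x)) \<Longrightarrow> is_form d (sum f A)"
  by (induction A rule: infinite_finite_induct) (auto intro: is_form_add)

lemma is_form_hcomp: "is_form d (hcomp d f)"
  unfolding hcomp_def by (rule is_form_sum) (auto simp: is_form_def edeg_def split: if_splits)

lemma vars_hcomp: "vars (hcomp d f) \<subseteq> vars f"
  unfolding hcomp_def
proof (rule vars_sum)
  fix E assume "E \<in> {E. E \<in> Poly_Mapping.keys f \<and> edeg E = d}"
  then have "Poly_Mapping.keys E \<subseteq> vars f" by (auto simp: vars_def)
  then show "vars (Poly_Mapping.single E (Poly_Mapping.lookup f E)) \<subseteq> vars f"
    using vars_single by (rule order_trans[rotated])
qed

lemma sum_hcomp: "f = (\<Sum>d\<in>edeg ` Poly_Mapping.keys f. hcomp d f)"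
proof -
  have "(\<Sum>E\<in>Poly_Mapping.keys f. Poly_Mapping.single E (Poly_Mapping.lookup f E)) =
    (\<Sum>d\<in>edeg ` Poly_Mapping.keys f. hcomp d f)"
    unfolding hcomp_def by (rule sum.image_gen) simp
  then show ?thesis using sum_single_lookup[of f] by simp
qed

lemma hcomp_eq_0: "d \<notin> edeg ` Poly_Mapping.keys f \<Longrightarrow> hcomp d f = 0"
  unfolding hcomp_def by (rule sum.neutral) auto

lemma peval_scale: "peval (\<lambda>i. t * v i) f = (\<Sum>d\<in>edeg ` Poly_Mapping.keys f. peval v (hcomp d f) * t ^ d)"
proof -
  have "peval (\<lambda>i. t * v i) f = (\<Sum>d\<in>edeg ` Poly_Mapping.keys f. peval (\<lambda>i. t * v i) (hcomp d f))"
    by (subst sum_hcomp[of f]) (simp add: peval_sum)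
  then show ?thesis by (simp add: peval_scale_form[OF is_form_hcomp] mult.commute)
qed

text \<open>Along the multiples t v of a vector, \<open>f\<close> is a polynomial in t whose
  coefficients are the values at v of its homogeneous components.\<close>

lemma hcomp_vanish:
  assumes "infinite {t. peval (\<lambda>i. t * v i) f = 0}"
  shows "peval v (hcomp d f) = 0"
proof (cases "d \<in> edeg ` Poly_Mapping.keys f")
  case True
  show ?thesis
    by (rule power_sum_eq_0[where n = id and A = "edeg ` Poly_Mapping.keys f" and j = d and
          c = "\<lambda>d. peval v (hcomp d f)", OF _ _ assms])
      (use True in \<open>auto simp: peval_scale\<close>)
qed (simp add: hcomp_eq_0)

lemma proj_space_scale:
  assumes "P \<in> proj_space J" "u \<in> P" "t \<noteq> 0"
  shows "(\<lambda>i. t * u i) \<in> P"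
proof -
  obtain w where P: "P = proportional J `` {w}" using assms(1) by (auto simp: proj_space_def quotient_def)
  then have "(w, u) \<in> proportional J" using assms(2) by simp
  then obtain c where c: "w \<in> nonzero_vecs J" "u \<in> nonzero_vecs J" "c \<noteq> 0" "u = (\<lambda>i. c * w i)"
    by (auto simp: proportional_def)
  have "(\<lambda>i. t * u i) \<in> nonzero_vecs J" using c(2) assms(3) by (auto simp: nonzero_vecs_def)
  then have "(w, \<lambda>i. t * u i) \<in> proportional J"
    using c assms(3) by (auto simp: proportional_def intro!: exI[of _ "t * c"])
  then show ?thesis using P by simp
qed

lemma proj_space_mem: "P \<in> proj_space J \<Longrightarrow> v \<in> P \<Longrightarrow> v \<in> nonzero_vecs J"
  by (auto simp: proj_space_def quotient_def proportional_def)

lemma proj_point: "v \<in> nonzero_vecs J \<Longrightarrow> proj_point J v \<in> proj_space J \<and> v \<in> proj_point J v"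
  unfolding proj_point_def proj_space_def
  using equiv_class_self[OF equiv_proportional] by (auto intro: quotientI)

lemma vanishes_at_proj_point:
  assumes "v \<in> nonzero_vecs J" "f \<in> forms J"
  shows "vanishes_at f (proj_point J v) \<longleftrightarrow> peval v f = 0"
  using vanishes_at_form_iff[OF assms(2)] proj_point[OF assms(1)] by blast

text \<open>The ideal of the affine cone over \<open>c\<close>. It admits all polynomials and not
  just forms, because the bound on chains concerns primes of the polynomial ring.\<close>

definition cone_ideal :: "'i set \<Rightarrow> ('i \<Rightarrow> complex) set set \<Rightarrow> 'i cpoly set" where
  "cone_ideal J c = {f. vars f \<subseteq> J \<and> (\<forall>P\<in>c. \<forall>v\<in>P. peval v f = 0)}"

lemma ideal_cone_ideal: "ideal (cone_ideal J c) (poly_ring J)"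
  by (rule poly_idealI)
    (simp_all add: cone_ideal_def peval_add peval_mult order_trans[OF vars_add] order_trans[OF vars_mult])

lemma closedin_zariski_form:
  assumes "closedin (zariski J) c" "P \<in> proj_space J" "P \<notin> c"
  shows "\<exists>f\<in>forms J. (\<forall>Q\<in>c. vanishes_at f Q) \<and> \<not> vanishes_at f P"
  using assms unfolding closedin_zariski by (auto simp: zero_locus_def)

text \<open>If \<open>f\<close> and \<open>g\<close> are outside, some component of each is not
  identically zero on \<open>c\<close>, and by irreducibility both components are nonzero at a
  common point. On the line over this point \<open>f\<close> and \<open>g\<close> have finitely many
  zeros each, so their product does not vanish on the cone.\<close>

lemma primeideal_cone_ideal:
  assumes c: "irreducible_space (subtopology (zariski J) c)" "c \<subseteq> proj_space J"
  shows "primeideal (cone_ideal J c) (poly_ring J)"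
proof (rule primeidealI)
  show "ideal (cone_ideal J c) (poly_ring J)" by (rule ideal_cone_ideal)
  show "cring (poly_ring J)" by (rule cring_poly_ring)
  have top: "topspace (subtopology (zariski J) c) = c" using c(2) by (auto simp: topspace_zariski)
  then have ne: "c \<noteq> {}" using c(1) by (simp add: irreducible_space_def)
  then obtain P v where "P \<in> c" "v \<in> P" using proj_space_nonempty c(2) by blast
  then have "1 \<notin> cone_ideal J c" by (auto simp: cone_ideal_def)
  then show "carrier (poly_ring J) \<noteq> cone_ideal J c" by auto
  fix f g assume f: "f \<in> carrier (poly_ring J)" and g: "g \<in> carrier (poly_ring J)"
    and fg: "f \<otimes>\<^bsub>poly_ring J\<^esub> g \<in> cone_ideal J c"
  have comp: "\<exists>d. hcomp d h \<in> forms J \<and> \<not> (\<forall>P\<in>c. vanishes_at (hcomp d h) P)"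
    if h: "vars h \<subseteq> J" "h \<notin> cone_ideal J c" for h
  proof -
    obtain P v where Pv: "P \<in> c" "v \<in> P" "peval v h \<noteq> 0" using h by (auto simp: cone_ideal_def)
    have "\<exists>d. peval v (hcomp d h) \<noteq> 0"
    proof (rule ccontr)
      assume "\<nexists>d. peval v (hcomp d h) \<noteq> 0"
      then have "peval (\<lambda>i. 1 * v i) h = 0" unfolding peval_scale by simp
      then show False using Pv(3) by simp
    qed
    then obtain d where d: "peval v (hcomp d h) \<noteq> 0" by blast
    have "hcomp d h \<in> forms J" using is_form_hcomp[of d h] vars_hcomp[of d h] h(1) by (auto simp: forms_def)
    then show ?thesis using d Pv by (auto simp: vanishes_at_def)
  qed
  show "f \<in> cone_ideal J c \<or> g \<in> cone_ideal J c"
  proof (rule ccontr)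
    assume "\<not> ?thesis"
    then obtain d e where d: "hcomp d f \<in> forms J" "\<not> (\<forall>P\<in>c. vanishes_at (hcomp d f) P)"
      and e: "hcomp e g \<in> forms J" "\<not> (\<forall>P\<in>c. vanishes_at (hcomp e g) P)"
      using comp f g by (metis mem_Collect_eq poly_ring_simps(1))
    have closed: "closedin (subtopology (zariski J) c) {P \<in> c. vanishes_at h P}" if "h \<in> forms J" for h
      unfolding closedin_subtopology closedin_zariski
      using that c(2) by (intro exI[of _ "zero_locus J {h}"]) (auto simp: zero_locus_def)
    have "c \<noteq> {P \<in> c. vanishes_at (hcomp d f) P} \<union> {P \<in> c. vanishes_at (hcomp e g) P}"
    proof
      assume "c = {P \<in> c. vanishes_at (hcomp d f) P} \<union> {P \<in> c. vanishes_at (hcomp e g) P}"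
      then have "{P \<in> c. vanishes_at (hcomp d f) P} = c \<or> {P \<in> c. vanishes_at (hcomp e g) P} = c"
        using c(1) closed[OF d(1)] closed[OF e(1)] unfolding irreducible_space_def top by blast
      then show False using d(2) e(2) by blast
    qed
    then obtain P where P: "P \<in> c" "\<not> vanishes_at (hcomp d f) P" "\<not> vanishes_at (hcomp e g) P" by blast
    have PJ: "P \<in> proj_space J" using P(1) c(2) by blast
    obtain u where u: "u \<in> P" using proj_space_nonempty[OF PJ] by blast
    have "peval u (hcomp d f) \<noteq> 0" "peval u (hcomp e g) \<noteq> 0"
      using P(2,3) vanishes_at_form_iff[OF d(1) PJ u] vanishes_at_form_iff[OF e(1) PJ u] by simp_all
    then have "finite {t. peval (\<lambda>i. t * u i) f = 0}" "finite {t. peval (\<lambda>i. t * u i) g = 0}"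
      using hcomp_vanish by blast+
    then have "finite ({t. peval (\<lambda>i. t * u i) f = 0} \<union> {t. peval (\<lambda>i. t * u i) g = 0} \<union> {0})" by simp
    from ex_new_if_finite[OF infinite_UNIV_char_0 this]
    obtain t where t: "t \<notin> {t. peval (\<lambda>i. t * u i) f = 0} \<union> {t. peval (\<lambda>i. t * u i) g = 0} \<union> {0}" ..
    then have "(\<lambda>i. t * u i) \<in> P" using proj_space_scale[OF PJ u] by simp
    then have "peval (\<lambda>i. t * u i) (f * g) = 0" using fg P(1) by (auto simp: cone_ideal_def)
    then show False using t by (simp add: peval_mult)
  qed
qed

lemma primeideal_irrelevant: "primeideal {f. vars f \<subseteq> J \<and> peval (\<lambda>_. 0) f = 0} (poly_ring J)"
proof (rule primeidealI)
  show "ideal {f. vars f \<subseteq> J \<and> peval (\<lambda>_. 0) f = 0} (poly_ring J)"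
    by (rule poly_idealI) (simp_all add: peval_add peval_mult order_trans[OF vars_add] order_trans[OF vars_mult])
  show "cring (poly_ring J)" by (rule cring_poly_ring)
  have "1 \<in> carrier (poly_ring J) - {f. vars f \<subseteq> J \<and> peval (\<lambda>_. 0) f = 0}" by simp
  then show "carrier (poly_ring J) \<noteq> {f. vars f \<subseteq> J \<and> peval (\<lambda>_. 0) f = 0}" by blast
qed (auto simp: peval_mult)

text \<open>The vertex of the cone supplies one more prime above every cone ideal, which accounts
  for the difference of one between affine and projective dimension.\<close>

lemma cone_ideal_irrelevant:
  assumes "P \<in> c" "c \<subseteq> proj_space J"
  shows "cone_ideal J c \<subset> {f. vars f \<subseteq> J \<and> peval (\<lambda>_. 0) f = 0}"
proof -
  have PJ: "P \<in> proj_space J" using assms by blast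
  obtain v where v: "v \<in> P" using proj_space_nonempty[OF PJ] by blast
  have "peval (\<lambda>_. 0) f = 0" if f: "f \<in> cone_ideal J c" for f
  proof -
    have "- {0} \<subseteq> {t. peval (\<lambda>i. t * v i) f = 0}"
      using f assms(1) proj_space_scale[OF PJ v] by (auto simp: cone_ideal_def)
    moreover have "infinite (- {0::complex})" using infinite_UNIV_char_0 by (simp add: Compl_eq_Diff_UNIV)
    ultimately have "infinite {t. peval (\<lambda>i. t * v i) f = 0}" using infinite_super by blast
    from hcomp_vanish[OF this] have "peval (\<lambda>i. 0 * v i) f = 0" unfolding peval_scale by simp
    then show ?thesis by simp
  qed
  then have sub: "cone_ideal J c \<subseteq> {f. vars f \<subseteq> J \<and> peval (\<lambda>_. 0) f = 0}" by (auto simp: cone_ideal_def)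
  obtain k where "v k \<noteq> 0" "k \<in> J" using proj_space_mem[OF PJ v] by (auto simp: nonzero_vecs_def)
  then have "Var k \<notin> cone_ideal J c" "Var k \<in> {f. vars f \<subseteq> J \<and> peval (\<lambda>_. 0) f = 0}"
    using v assms(1) by (auto simp: cone_ideal_def)
  then show ?thesis using sub by blast
qed

lemma cone_ideal_strict:
  assumes "closedin (zariski J) c" "c \<subset> c'" "c' \<subseteq> proj_space J"
  shows "cone_ideal J c' \<subset> cone_ideal J c"
proof -
  obtain P where P: "P \<in> c'" "P \<notin> c" using assms(2) by blast
  obtain f where f: "f \<in> forms J" "\<forall>Q\<in>c. vanishes_at f Q" "\<not> vanishes_at f P"
    using closedin_zariski_form[OF assms(1) _ P(2)] P(1) assms(3) by blast
  then have "f \<in> cone_ideal J c" "f \<notin> cone_ideal J c'" using P(1)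
    by (auto simp: cone_ideal_def forms_def vanishes_at_def)
  moreover have "cone_ideal J c' \<subseteq> cone_ideal J c" using assms(2) by (auto simp: cone_ideal_def)
  ultimately show ?thesis by blast
qed

lemma peval_line_poly: "\<exists>p. \<forall>t. poly p t = peval (\<lambda>k. poly (q k) t) f"
  by (rule exI[of _ "\<Sum>E\<in>Poly_Mapping.keys f. Polynomial.smult (Poly_Mapping.lookup f E)
      (\<Prod>k\<in>Poly_Mapping.keys E. q k ^ Poly_Mapping.lookup E k)"])
    (simp add: peval_def poly_sum poly_prod)

section \<open>The closure of the image and its dimension\<close>

context surf
begin

lemma phi_scale: "phi m (\<lambda>i. t * v i) k = t ^ (m + 2) * phi m v k"
proof (cases "k \<in> J")
  case True
  then consider i where "k = Gc i" | \<alpha> where "k = Lc \<alpha>" "sz \<alpha> = m - 1" by (auto simp: coords_eq)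
  then show ?thesis
  proof cases
    case (1 i)
    let ?e = "(\<lambda>_. 0)(i := (\<lambda>_. 0) i + 1) :: xyz \<Rightarrow> nat"
    have "mf ?e (\<lambda>_. 0) v = G i v" for v using mf_G[of "\<lambda>_. 0" i "\<lambda>_. 0" v] mf_00 by simp
    moreover have "deg2 (?e, \<lambda>_. 0) = 1" using sz_upd[of "\<lambda>_. 0" i 1] by (simp add: deg2_def sz_def)
    ultimately show ?thesis using mf_scale[of "\<lambda>_. 0" ?e t v] by (simp add: 1 phi_G sz_def)
  next
    case (2 \<alpha>)
    have "mf (\<lambda>_. 0) \<alpha> v = V v * mn v \<alpha>" for v using 2 m by (simp add: mf_def)
    moreover have "deg2 (\<lambda>_. 0, \<alpha>) = 1" using 2 m by (simp add: deg2_def sz_def[of "\<lambda>_. 0"])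
    ultimately show ?thesis using mf_scale[of \<alpha> "\<lambda>_. 0" t v] 2 by (simp add: phi_L)
  qed
qed (simp add: phi_def)

text \<open>All basis forms have degree m + 2, so scaling v by t multiplies the pullback of the
  degree d component by t^((m+2) d); the components are separated by this.\<close>

lemma hcomp_Ker: "f \<in> Ker \<Longrightarrow> hcomp d f \<in> Ker"
proof -
  assume f: "f \<in> Ker"
  have "hat (hcomp d f) v = 0" for v unfolding hat_def
  proof (cases "d \<in> edeg ` Poly_Mapping.keys f")
    case True
    show "peval (phi m v) (hcomp d f) = 0"
    proof (rule power_sum_eq_0[where n = "\<lambda>d. (m + 2) * d" and A = "edeg ` Poly_Mapping.keys f" and j = d and
          c = "\<lambda>d. peval (phi m v) (hcomp d f)", OF _ _ infinite_UNIV_char_0])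
      show "inj_on (\<lambda>d. (m + 2) * d) (edeg ` Poly_Mapping.keys f)"
      proof (rule inj_onI)
        fix x y assume "(m + 2) * x = (m + 2) * y"
        moreover have "m + 2 > 0" by simp
        ultimately show "x = y" by (metis nat_mult_eq_cancel1)
      qed
      fix t
      have "phi m (\<lambda>i. t * v i) = (\<lambda>k. t ^ (m + 2) * phi m v k)" by (rule ext) (rule phi_scale)
      then have "hat f (\<lambda>i. t * v i) =
          (\<Sum>d\<in>edeg ` Poly_Mapping.keys f. peval (phi m v) (hcomp d f) * t ^ ((m + 2) * d))"
        unfolding hat_def by (simp only: peval_scale power_mult)
      then show "(\<Sum>d\<in>edeg ` Poly_Mapping.keys f. peval (phi m v) (hcomp d f) * t ^ ((m + 2) * d)) = 0"
        using f by (simp add: Ker_def)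
    qed (use True in auto)
  qed (simp add: hcomp_eq_0)
  moreover have "vars (hcomp d f) \<subseteq> J" using f vars_hcomp[of d f] by (auto simp: Ker_def)
  ultimately show ?thesis by (simp add: Ker_def)
qed

text \<open>The set \<open>W\<close> of parameters is kept variable so that the point and the curve
  needed inside X arise by the same construction as X itself.\<close>

definition img :: "(xyz \<Rightarrow> complex) set \<Rightarrow> (coordinate \<Rightarrow> complex) set set" where
  "img W = {proj_point J (phi m v) | v. v \<in> W \<and> phi m v \<noteq> (\<lambda>_. 0)}"

lemma phi_nonzero: "phi m v \<in> nonzero_vecs J \<longleftrightarrow> phi m v \<noteq> (\<lambda>_. 0)"
  by (auto simp: nonzero_vecs_def phi_def fun_eq_iff)

lemma phi_image_eq: "phi_image m = img UNIV"
proof -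
  have "\<exists>P. P \<in> proj_space UNIV \<and> v \<in> P" if "phi m v \<noteq> (\<lambda>_. 0)" for v
  proof -
    have "v \<noteq> (\<lambda>_. 0)"
    proof
      assume "v = (\<lambda>_. 0)"
      then have "phi m v k = 0" for k using phi_scale[of 0 "\<lambda>_. 0" k] by simp
      then show False using that by auto
    qed
    then have "v \<in> nonzero_vecs UNIV" by (auto simp: nonzero_vecs_def fun_eq_iff)
    from proj_point[OF this] show ?thesis by blast
  qed
  then show ?thesis unfolding phi_image_def img_def phi_nonzero by blast
qed

abbreviation Z :: "(coordinate \<Rightarrow> complex) set topology" where "Z \<equiv> zariski J"

definition cl :: "(xyz \<Rightarrow> complex) set \<Rightarrow> (coordinate \<Rightarrow> complex) set set" where
  "cl W = Z closure_of img W"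

lemma surface_X_eq: "surface_X m = cl UNIV"
  by (simp add: surface_X_def cl_def phi_image_eq)

lemma img_proj: "img W \<subseteq> proj_space J"
  using proj_point phi_nonzero by (auto simp: img_def)

lemma closedin_cl: "closedin Z (cl W)" unfolding cl_def by (rule closedin_closure_of)
lemma img_cl: "img W \<subseteq> cl W" unfolding cl_def
  by (rule closure_of_subset) (simp add: topspace_zariski img_proj)
lemma cl_proj: "cl W \<subseteq> proj_space J" using closedin_subset[OF closedin_cl] by (simp add: topspace_zariski)
lemma cl_minimal: "img W \<subseteq> A \<Longrightarrow> closedin Z A \<Longrightarrow> cl W \<subseteq> A"
  unfolding cl_def by (rule closure_of_minimal)

lemma vanishes_img:
  assumes "f \<in> forms J" "phi m v \<noteq> (\<lambda>_. 0)"
  shows "vanishes_at f (proj_point J (phi m v)) \<longleftrightarrow> hat f v = 0"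
  using vanishes_at_proj_point[OF _ assms(1)] assms(2) phi_nonzero by (simp add: hat_def)

lemma vanishes_cl:
  assumes f: "f \<in> forms J"
  shows "(\<forall>P\<in>cl W. vanishes_at f P) \<longleftrightarrow> (\<forall>v\<in>W. phi m v \<noteq> (\<lambda>_. 0) \<longrightarrow> hat f v = 0)"
proof
  assume *: "\<forall>P\<in>cl W. vanishes_at f P"
  show "\<forall>v\<in>W. phi m v \<noteq> (\<lambda>_. 0) \<longrightarrow> hat f v = 0"
  proof (intro ballI impI)
    fix v assume v: "v \<in> W" "phi m v \<noteq> (\<lambda>_. 0)"
    then have "proj_point J (phi m v) \<in> cl W" using img_cl by (auto simp: img_def)
    then show "hat f v = 0" using * vanishes_img[OF f v(2)] by blast
  qed
next
  assume *: "\<forall>v\<in>W. phi m v \<noteq> (\<lambda>_. 0) \<longrightarrow> hat f v = 0"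
  have "cl W \<subseteq> zero_locus J {f}"
  proof (rule cl_minimal)
    show "closedin Z (zero_locus J {f})" unfolding closedin_zariski using f by auto
    show "img W \<subseteq> zero_locus J {f}"
    proof
      fix P assume "P \<in> img W"
      then obtain v where "v \<in> W" "phi m v \<noteq> (\<lambda>_. 0)" "P = proj_point J (phi m v)" by (auto simp: img_def)
      then show "P \<in> zero_locus J {f}" using * vanishes_img[OF f, of v] proj_point[of "phi m v" J] phi_nonzero
        by (auto simp: zero_locus_def)
    qed
  qed
  then show "\<forall>P\<in>cl W. vanishes_at f P" by (auto simp: zero_locus_def)
qed

lemma phi_ones: "phi m (\<lambda>_. 1) \<noteq> (\<lambda>_. 0)"
proof
  assume "phi m (\<lambda>_. 1) = (\<lambda>_. 0)"
  then have "phi m (\<lambda>_. 1) (Lc (pure IX)) = 0" by simp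
  then show False by (simp add: phi_L sz_pure' V_def mn_def)
qed

lemma form_Ker_iff:
  assumes f: "f \<in> forms J"
  shows "(\<forall>P\<in>cl UNIV. vanishes_at f P) \<longleftrightarrow> f \<in> Ker"
proof -
  obtain d where d: "is_form d f" and v: "vars f \<subseteq> J" using f by (auto simp: forms_def)
  have "hat f v = 0" if "\<And>v. phi m v \<noteq> (\<lambda>_. 0) \<Longrightarrow> hat f v = 0" for v
  proof (cases "phi m v = (\<lambda>_. 0)")
    \<comment> \<open>A base point is not seen by the image. For d > 0 the pullback vanishes there;
      for d = 0 the factor \<open>0 ^ d\<close> is 1 and the pullback is the same constant as at (1,
      1, 1), where the map is defined.\<close>
    case True
    have "hat f v = peval (\<lambda>k. 0 * phi m (\<lambda>_. 1) k) f" by (simp add: hat_def True)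
    also have "\<dots> = 0 ^ d * hat f (\<lambda>_. 1)" unfolding peval_scale_form[OF d] hat_def ..
    finally show ?thesis using that[OF phi_ones] by simp
  qed (rule that)
  then show ?thesis unfolding vanishes_cl[OF f] using v by (auto simp: Ker_def)
qed

lemma homogeneous_ideal_surface: "homogeneous_ideal J (surface_X m) = Ker"
proof -
  let ?F = "{f \<in> forms J. \<forall>P\<in>surface_X m. vanishes_at f P}"
  have F: "?F = forms J \<inter> Ker" using form_Ker_iff unfolding surface_X_eq by auto
  have sub: "?F \<subseteq> carrier (poly_ring J)" by (auto simp: forms_def)
  show ?thesis unfolding homogeneous_ideal_def
  proof
    show "genideal (poly_ring J) ?F \<subseteq> Ker" unfolding F by (intro PR.genideal_minimal ideal_Ker) auto
    show "Ker \<subseteq> genideal (poly_ring J) ?F"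
    proof
      fix f assume f: "f \<in> Ker"
      have "hcomp d f \<in> ?F" for d unfolding F
        using hcomp_Ker[OF f, of d] is_form_hcomp[of d f] by (auto simp: forms_def Ker_def)
      then have "hcomp d f \<in> genideal (poly_ring J) ?F" for d using PR.genideal_self[OF sub] by blast
      then have "(\<Sum>d\<in>edeg ` Poly_Mapping.keys f. hcomp d f) \<in> genideal (poly_ring J) ?F"
        by (intro poly_ideal_sum[OF PR.genideal_ideal[OF sub]])
      then show "f \<in> genideal (poly_ring J) ?F" using sum_hcomp[of f] by simp
    qed
  qed
qed

text \<open>Proper closed subsets \<open>A\<close> and \<open>B\<close> are each missed by an image
  point, with a form as witness. On the line joining the two parameters the witnesses are nonzero
  polynomials in t, so some parameter on it avoids both \<open>A\<close> and
  \<open>B\<close>.\<close>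

lemma irreducible_cl:
  assumes line: "\<And>v w t. v \<in> W \<Longrightarrow> w \<in> W \<Longrightarrow> (\<lambda>i. v i + t * (w i - v i)) \<in> W"
    and ne: "\<exists>v\<in>W. phi m v \<noteq> (\<lambda>_. 0)"
  shows "irreducible_space (subtopology Z (cl W))"
  unfolding irreducible_space_def
proof (intro conjI allI impI)
  have top: "topspace (subtopology Z (cl W)) = cl W" using cl_proj by (auto simp: topspace_zariski)
  have "img W \<noteq> {}" using ne by (auto simp: img_def)
  then show "topspace (subtopology Z (cl W)) \<noteq> {}" using img_cl unfolding top by blast
  fix A B
  assume "closedin (subtopology Z (cl W)) A \<and> closedin (subtopology Z (cl W)) B \<and>
    topspace (subtopology Z (cl W)) = A \<union> B"
  then have A: "closedin Z A" "A \<subseteq> cl W" and B: "closedin Z B" "B \<subseteq> cl W" and AB: "cl W = A \<union> B"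
    unfolding closedin_closed_subtopology[OF closedin_cl] top by auto
  have sep: "\<exists>f v. f \<in> forms J \<and> (\<forall>Q\<in>C. vanishes_at f Q) \<and> v \<in> W \<and> phi m v \<noteq> (\<lambda>_. 0) \<and> hat f v \<noteq> 0"
    if C: "closedin Z C" "C \<subseteq> cl W" "C \<noteq> cl W" for C
  proof -
    have "\<not> img W \<subseteq> C" using cl_minimal[of W C] C by blast
    then obtain v where v: "v \<in> W" "phi m v \<noteq> (\<lambda>_. 0)" "proj_point J (phi m v) \<notin> C" by (auto simp: img_def)
    moreover have "proj_point J (phi m v) \<in> proj_space J" using proj_point phi_nonzero v(2) by blast
    ultimately show ?thesis using closedin_zariski_form[OF C(1)] vanishes_img by metis
  qed
  show "A = topspace (subtopology Z (cl W)) \<or> B = topspace (subtopology Z (cl W))"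
    unfolding top
  proof (rule ccontr)
    assume "\<not> (A = cl W \<or> B = cl W)"
    then obtain f v g w where f: "f \<in> forms J" "\<forall>Q\<in>A. vanishes_at f Q" "v \<in> W" "phi m v \<noteq> (\<lambda>_. 0)" "hat f v \<noteq> 0"
      and g: "g \<in> forms J" "\<forall>Q\<in>B. vanishes_at g Q" "w \<in> W" "hat g w \<noteq> 0"
      using sep[OF A] sep[OF B] by metis
    obtain k where k: "phi m v k \<noteq> 0" using f(4) by auto
    define l where "l t = (\<lambda>i. v i + t * (w i - v i))" for t
    have "\<exists>p. \<forall>t. poly p t = hat h (l t)" for h
    proof -
      have "\<exists>p. \<forall>t. poly p t = phi m (l t) k" for k
      proof (cases "k \<in> J")
        case True
        obtain p where "\<forall>t. poly p t = peval (\<lambda>i. poly [:v i, w i - v i:] t) (basis_form m k)"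
          using peval_line_poly[of "\<lambda>i. [:v i, w i - v i:]" "basis_form m k"] by (rule exE)
        moreover have "(\<lambda>i. poly [:v i, w i - v i:] t) = l t" for t by (simp add: l_def fun_eq_iff)
        ultimately show ?thesis using True by (auto simp: phi_def)
      next
        case False
        then show ?thesis by (intro exI[of _ 0]) (simp add: phi_def)
      qed
      then obtain q where q: "\<And>k t. poly (q k) t = phi m (l t) k" by metis
      obtain p where "\<forall>t. poly p t = peval (\<lambda>k. poly (q k) t) h"
        using peval_line_poly[of q h] by (rule exE)
      then show ?thesis unfolding q hat_def by blast
    qed
    then obtain P where P: "\<And>h t. poly (P h) t = hat h (l t)" by metis
    have l: "l 0 = v" "l 1 = w" by (simp_all add: l_def)
    \<comment> \<open>The third polynomial, a coordinate nonzero at \<open>v\<close>, keeps the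
      parameter to be chosen away from points where the map is undefined.\<close>
    have "poly (P f) 0 \<noteq> 0" "poly (P g) 1 \<noteq> 0" "poly (P (Var k)) 0 \<noteq> 0"
      unfolding P l using f g k by simp_all
    then have "P f \<noteq> 0" "P g \<noteq> 0" "P (Var k) \<noteq> 0" by auto
    then have "P f * P g * P (Var k) \<noteq> 0" by simp
    from ex_new_if_finite[OF infinite_UNIV_char_0 poly_roots_finite[OF this]]
    obtain t where "poly (P f * P g * P (Var k)) t \<noteq> 0" by auto
    then have t: "hat f (l t) \<noteq> 0" "hat g (l t) \<noteq> 0" "phi m (l t) k \<noteq> 0" by (simp_all add: P)
    then have nz: "phi m (l t) \<noteq> (\<lambda>_. 0)" by auto
    have "l t \<in> W" unfolding l_def using f(3) g(3) by (rule line)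
    then have "proj_point J (phi m (l t)) \<in> A \<union> B" using img_cl nz unfolding AB[symmetric] by (auto simp: img_def)
    then show False using f(2) g(2) vanishes_img[OF f(1) nz] vanishes_img[OF g(1) nz] t by blast
  qed
qed

lemma sub_sub: "closedin (subtopology Z (cl UNIV)) c \<longleftrightarrow> closedin Z c \<and> c \<subseteq> cl UNIV"
  by (rule closedin_closed_subtopology[OF closedin_cl])

lemma cl_strict:
  assumes "W \<subseteq> W'" "f \<in> forms J" "\<And>v. v \<in> W \<Longrightarrow> hat f v = 0" "w \<in> W'" "hat f w \<noteq> 0" "phi m w \<noteq> (\<lambda>_. 0)"
  shows "cl W \<subset> cl W'"
proof -
  have "cl W \<subseteq> cl W'" unfolding cl_def using assms(1) by (intro closure_of_mono) (auto simp: img_def)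
  moreover have "cl W \<noteq> cl W'" using vanishes_cl[OF assms(2), of W] vanishes_cl[OF assms(2), of W'] assms by auto
  ultimately show ?thesis by blast
qed

theorem projective_surface_X: "projective_surface J (surface_X m)"
  unfolding projective_surface_def surface_X_eq
proof (intro conjI)
  show "closedin Z (cl UNIV)" by (rule closedin_cl)
  have irrU: "irreducible_space (subtopology Z (cl UNIV))" using phi_ones by (intro irreducible_cl) auto
  then show "irreducible_space (subtopology Z (cl UNIV))" .
  have "krull_dim_space (subtopology Z (cl UNIV)) = enat 2"
    unfolding krull_dim_space_def
  proof (rule antisym)
    show "Sup {enat n |n. \<exists>c. (\<forall>i\<le>n. closedin (subtopology Z (cl UNIV)) (c i) \<and>
      irreducible_space (subtopology (subtopology Z (cl UNIV)) (c i))) \<and> (\<forall>i<n. c i \<subset> c (Suc i))} \<le> enat 2"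
    proof (rule Sup_least, clarify)
      fix n c assume c: "\<forall>i\<le>n. closedin (subtopology Z (cl UNIV)) (c i) \<and>
        irreducible_space (subtopology (subtopology Z (cl UNIV)) (c i))" and st: "\<forall>i<n. c i \<subset> c (Suc i)"
      have cl: "closedin Z (c i)" "c i \<subseteq> cl UNIV" "c i \<subseteq> proj_space J" if "i \<le> n" for i
        using c that cl_proj unfolding sub_sub by blast+
      have irr: "irreducible_space (subtopology Z (c i))" if "i \<le> n" for i
      proof -
        have "irreducible_space (subtopology Z (cl UNIV \<inter> c i))"
          using c that by (simp add: subtopology_subtopology)
        moreover have "cl UNIV \<inter> c i = c i" using cl(2)[OF that] by blast
        ultimately show ?thesis by (simp only:)
      qed
      \<comment> \<open>Passing to ideals reverses the chain, and the irrelevant ideal is put on top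
        at index n + 1. The bound 4 for the affine chain thus gives n at most 2.\<close>
      define p where "p i = (if i \<le> n then cone_ideal J (c (n - i)) else {f. vars f \<subseteq> J \<and> peval (\<lambda>_. 0) f = 0})" for i
      have "Suc n < 4"
      proof (rule PR.chain_length_less[where I = Ker and p = p])
        show "lombardi (poly_ring J) xs \<inter> Ker \<noteq> {}" if "set xs \<subseteq> carrier (poly_ring J)" "length xs = 4" for xs
          by (rule lombardi_meets[OF ideal_Ker growth_Ker that])
        show "\<forall>i\<le>Suc n. primeideal (p i) (poly_ring J)"
        proof (intro allI impI)
          fix i assume "i \<le> Suc n"
          show "primeideal (p i) (poly_ring J)"
          proof (cases "i \<le> n")
            case True
            then show ?thesis unfolding p_def if_P[OF True]
              by (intro primeideal_cone_ideal irr cl(3)) simp_all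
          next
            case False
            then show ?thesis unfolding p_def if_not_P[OF False] by (intro primeideal_irrelevant)
          qed
        qed
        show "\<forall>i<Suc n. p i \<subset> p (Suc i)"
        proof (intro allI impI)
          fix i assume i: "i < Suc n"
          show "p i \<subset> p (Suc i)"
          proof (cases "i = n")
            case True
            have "topspace (subtopology Z (c 0)) \<noteq> {}" using irr[of 0] by (simp add: irreducible_space_def)
            then obtain P where "P \<in> c 0" by auto
            then show ?thesis using cone_ideal_irrelevant[OF _ cl(3)[of 0]] True by (simp add: p_def)
          next
            case False
            then have "c (n - Suc i) \<subset> c (Suc (n - Suc i))" using st i by simp
            then have "c (n - Suc i) \<subset> c (n - i)" using False i by (simp add: Suc_diff_Suc)
            then show ?thesis using cone_ideal_strict[OF cl(1) _ cl(3)] False i by (simp add: p_def)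
          qed
        qed
        show "Ker \<subseteq> p 0"
        proof
          fix f assume f: "f \<in> Ker"
          have van: "vanishes_at (hcomp d f) P" if "P \<in> cl UNIV" for d P
            using form_Ker_iff[of "hcomp d f"] hcomp_Ker[OF f, of d] is_form_hcomp[of d f] that
            by (auto simp: forms_def Ker_def)
          have "peval v f = 0" if "P \<in> c n" "v \<in> P" for P v
          proof -
            have "peval v (hcomp d f) = 0" for d using van[of P d] that cl(2)[of n] by (auto simp: vanishes_at_def)
            then have "peval (\<lambda>i. 1 * v i) f = 0" unfolding peval_scale by simp
            then show ?thesis by simp
          qed
          then show "f \<in> p 0" using f by (auto simp: p_def cone_ideal_def Ker_def)
        qed
      qed
      then show "enat n \<le> enat 2" by simp
    qed
    \<comment> \<open>A point, a line through it and the whole space. Each contains the line through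
      any two of its points, as \<open>irreducible_cl\<close> requires.\<close>
    define W :: "nat \<Rightarrow> (xyz \<Rightarrow> complex) set"
      where "W i = (if i = 0 then {\<lambda>_. 1} else if i = Suc 0 then {v. v IX = 1 \<and> v IZ = 1} else UNIV)"
      for i :: nat
    have W: "(\<lambda>_. 1) \<in> W i" "\<And>v w t. v \<in> W i \<Longrightarrow> w \<in> W i \<Longrightarrow> (\<lambda>j. v j + t * (w j - v j)) \<in> W i" for i
      by (auto simp: W_def)
    have fm: "X (pure i) - X (pure j) \<in> forms J" for i j
    proof -
      have "vars (X (pure i) - X (pure j)) \<subseteq> J" by (intro vars_J_closed vars_XY sz_pure')
      then show ?thesis using is_form_diff[OF is_form_Var is_form_Var, of "Lc (pure i)" "Lc (pure j)"]
        by (auto simp: forms_def)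
    qed
    have h: "hat (X (pure i) - X (pure j)) v = V v * (v i ^ (m - 1) - v j ^ (m - 1))" for i j v
      using hat_pure[of i v] hat_pure[of j v] by (simp add: H_def right_diff_distrib)
    have p2: "(2::complex) ^ (m - 1) \<noteq> 1"
    proof
      assume "(2::complex) ^ (m - 1) = 1"
      then have "norm ((2::complex) ^ (m - 1)) = 1" by simp
      then have "(2::real) ^ (m - 1) = 1" by (simp add: norm_power)
      moreover have "(2::real) ^ (m - 1) > 1" using m by (intro one_less_power) auto
      ultimately show False by simp
    qed
    have nz: "phi m v \<noteq> (\<lambda>_. 0)" if "hat (X (pure i) - X (pure j)) v \<noteq> 0" for i j v
      using that by auto
    have s0: "cl (W 0) \<subset> cl (W (Suc 0))"
    proof (rule cl_strict[OF _ fm[of IX IY]])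
      show "hat (X (pure IX) - X (pure IY)) ((\<lambda>_. 1)(IY := 2)) \<noteq> 0"
        using p2 unfolding h V_def prod_cyc[of _ IX] by simp
      then show "phi m ((\<lambda>_. 1)(IY := 2)) \<noteq> (\<lambda>_. 0)" by (rule nz)
      show "hat (X (pure IX) - X (pure IY)) v = 0" if "v \<in> W 0" for v using that unfolding h by (simp add: W_def)
    qed (auto simp: W_def)
    have s1: "cl (W (Suc 0)) \<subset> cl (W (Suc (Suc 0)))"
    proof (rule cl_strict[OF _ fm[of IX IZ]])
      show "hat (X (pure IX) - X (pure IZ)) ((\<lambda>_. 1)(IX := 2)) \<noteq> 0"
        using p2 unfolding h V_def prod_cyc[of _ IX] by simp
      then show "phi m ((\<lambda>_. 1)(IX := 2)) \<noteq> (\<lambda>_. 0)" by (rule nz)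
      show "hat (X (pure IX) - X (pure IZ)) v = 0" if "v \<in> W (Suc 0)" for v using that unfolding h by (simp add: W_def)
    qed (auto simp: W_def)
    have "\<forall>i\<le>2. closedin (subtopology Z (cl UNIV)) (cl (W i)) \<and>
      irreducible_space (subtopology (subtopology Z (cl UNIV)) (cl (W i)))"
    proof (intro allI impI conjI)
      fix i :: nat
      have sub: "cl (W i) \<subseteq> cl UNIV" unfolding cl_def by (intro closure_of_mono) (auto simp: img_def)
      then show "closedin (subtopology Z (cl UNIV)) (cl (W i))" unfolding sub_sub using closedin_cl by blast
      have "irreducible_space (subtopology Z (cl (W i)))" 
        
      proof (rule irreducible_cl)
        show "\<exists>v\<in>W i. phi m v \<noteq> (\<lambda>_. 0)" by (intro bexI[of _ "\<lambda>_. 1"] phi_ones W(1))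
      qed (rule W(2))
      then show "irreducible_space (subtopology (subtopology Z (cl UNIV)) (cl (W i)))"
        using sub by (simp add: subtopology_subtopology Int_absorb1)
    qed
    moreover have "\<forall>i<2. cl (W i) \<subset> cl (W (Suc i))" using s0 s1 by (auto simp: less_Suc_eq numeral_2_eq_2)
    ultimately have "\<exists>c. (\<forall>i\<le>2. closedin (subtopology Z (cl UNIV)) (c i) \<and>
      irreducible_space (subtopology (subtopology Z (cl UNIV)) (c i))) \<and> (\<forall>i<2. c i \<subset> c (Suc i))"
      by (intro exI[of _ "\<lambda>i. cl (W i)"] conjI)
    then show "enat 2 \<le> Sup {enat n |n. \<exists>c. (\<forall>i\<le>n. closedin (subtopology Z (cl UNIV)) (c i) \<and>
      irreducible_space (subtopology (subtopology Z (cl UNIV)) (c i))) \<and> (\<forall>i<n. c i \<subset> c (Suc i))}"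
      by (intro Sup_upper CollectI exI[of _ 2] conjI refl)
  qed
  then show "krull_dim_space (subtopology Z (cl UNIV)) = 2" by (simp add: numeral_eq_enat)
qed

end

section \<open>The basis of forms\<close>

lemma is_form_power: "is_form d f \<Longrightarrow> is_form (n * d) (f ^ n)"
proof (induction n)
  case 0
  show ?case using is_form_Const[of 1] by simp
next
  case (Suc n)
  then show ?case using is_form_mult[of d f "n * d" "f ^ n"] by simp
qed

lemma Var_power: "Var i ^ n = Poly_Mapping.single (Poly_Mapping.single i n) 1"
proof (induction n)
  case (Suc n)
  have "Var i * Poly_Mapping.single (Poly_Mapping.single i n) 1 =
    Poly_Mapping.single (Poly_Mapping.single i 1 + Poly_Mapping.single i n) 1"
    by (simp add: Var_def mult_single)
  also have "Poly_Mapping.single i 1 + Poly_Mapping.single i n = Poly_Mapping.single i (Suc n)"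
    by (simp flip: single_add)
  finally show ?case using Suc by simp
qed simp

lemma monomial_xyz:
  "Poly_Mapping.single E (1::complex) =
    xv ^ Poly_Mapping.lookup E IX * yv ^ Poly_Mapping.lookup E IY * zv ^ Poly_Mapping.lookup E IZ"
proof -
  have "E = Poly_Mapping.single IX (Poly_Mapping.lookup E IX) + Poly_Mapping.single IY (Poly_Mapping.lookup E IY)
    + Poly_Mapping.single IZ (Poly_Mapping.lookup E IZ)"
  proof (rule poly_mapping_eqI)
    fix i show "Poly_Mapping.lookup E i = Poly_Mapping.lookup (Poly_Mapping.single IX (Poly_Mapping.lookup E IX) +
      Poly_Mapping.single IY (Poly_Mapping.lookup E IY) + Poly_Mapping.single IZ (Poly_Mapping.lookup E IZ)) i"
      by (cases i) (simp_all add: lookup_add lookup_single)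
  qed
  then show ?thesis by (simp add: Var_power mult_single)
qed

lemma edeg_xyz: "edeg E = Poly_Mapping.lookup E i + Poly_Mapping.lookup E (nxt i) + Poly_Mapping.lookup E (nxt (nxt i))"
  for E :: "xyz \<Rightarrow>\<^sub>0 nat"
proof -
  have "edeg E = (\<Sum>j\<in>UNIV. Poly_Mapping.lookup E j)"
    unfolding edeg_def by (rule sum.mono_neutral_left) (auto simp: in_keys_iff)
  then show ?thesis by (simp add: sum_cyc[of _ i])
qed

text \<open>Parametrises the side v_i = 0 of the coordinate triangle, except the corner where
  v_{i+1} = 0 as well.\<close>

definition edge :: "xyz \<Rightarrow> complex \<Rightarrow> xyz \<Rightarrow> complex" where
  "edge i t = (\<lambda>_. 0)(nxt i := 1, nxt (nxt i) := t)"

lemma peval_edge: "peval (edge i t) f =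
  (\<Sum>E | E \<in> Poly_Mapping.keys f \<and> Poly_Mapping.lookup E i = 0.
     Poly_Mapping.lookup f E * t ^ Poly_Mapping.lookup E (nxt (nxt i)))"
proof -
  have "(\<Prod>k\<in>Poly_Mapping.keys E. edge i t k ^ Poly_Mapping.lookup E k) =
    0 ^ Poly_Mapping.lookup E i * t ^ Poly_Mapping.lookup E (nxt (nxt i))" for E
    by (subst prod_exponent_superset[of UNIV]) (auto simp: prod_cyc[of _ i] edge_def)
  then have "peval (edge i t) f = (\<Sum>E\<in>Poly_Mapping.keys f. Poly_Mapping.lookup f E *
      (0 ^ Poly_Mapping.lookup E i * t ^ Poly_Mapping.lookup E (nxt (nxt i))))"
    by (simp add: peval_def)
  also have "\<dots> = (\<Sum>E | E \<in> Poly_Mapping.keys f \<and> Poly_Mapping.lookup E i = 0.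
     Poly_Mapping.lookup f E * t ^ Poly_Mapping.lookup E (nxt (nxt i)))"
    by (rule sum.mono_neutral_cong_right) (auto simp: zero_power)
  finally show ?thesis .
qed

lemma edge_injective:
  assumes f: "is_form d f"
  shows "inj_on (\<lambda>E. Poly_Mapping.lookup E (nxt (nxt i))) {E \<in> Poly_Mapping.keys f. Poly_Mapping.lookup E i = 0}"
proof (rule inj_onI)
  fix E E' assume E: "E \<in> {E \<in> Poly_Mapping.keys f. Poly_Mapping.lookup E i = 0}"
    "E' \<in> {E \<in> Poly_Mapping.keys f. Poly_Mapping.lookup E i = 0}"
    "Poly_Mapping.lookup E (nxt (nxt i)) = Poly_Mapping.lookup E' (nxt (nxt i))"
  have "edeg E = d" "edeg E' = d" using f E by (auto simp: is_form_def edeg_def)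
  then have "Poly_Mapping.lookup E (nxt i) = Poly_Mapping.lookup E' (nxt i)"
    using E edeg_xyz[of E i] edeg_xyz[of E' i] by simp
  then have "\<forall>k. Poly_Mapping.lookup E k = Poly_Mapping.lookup E' k"
    unfolding all_cyc[of _ i] using E by simp
  then show "E = E'" by (simp add: poly_mapping_eq_iff fun_eq_iff)
qed

text \<open>Monomials of a form that survive on the side v_i = 0 have distinct exponents in t. A
  form vanishing on this side therefore has only monomials divisible by v_i.\<close>

lemma edge_vanish:
  assumes f: "is_form d f" and 0: "\<And>t. peval (edge i t) f = 0" and E: "E \<in> Poly_Mapping.keys f"
  shows "Poly_Mapping.lookup E i > 0"
proof (rule ccontr)
  assume "\<not> Poly_Mapping.lookup E i > 0"
  then have E': "E \<in> {E. E \<in> Poly_Mapping.keys f \<and> Poly_Mapping.lookup E i = 0}" using E by simp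
  have "Poly_Mapping.lookup f E = 0"
    by (rule power_sum_eq_0[OF _ edge_injective[OF f] infinite_UNIV_char_0 _ E'])
      (simp_all add: 0 flip: peval_edge)
  then show False using E by (simp add: in_keys_iff)
qed

context surf
begin

text \<open>The restriction is a polynomial p in t of degree at most m + 2. The corners remove its
  extreme coefficients, and p has the m + 1 roots of r = c (t^(m+1) - s t), where c is its
  coefficient at t^(m+1). So p - r has degree at most m but m + 1 roots.\<close>

lemma edge_form:
  assumes f: "is_form (m + 2) f"
    and corner: "peval ((\<lambda>_. 0)(nxt i := 1)) f = 0" "peval ((\<lambda>_. 0)(nxt (nxt i) := 1)) f = 0"
    and roots: "\<And>t. t ^ m = (- 1) ^ m \<Longrightarrow> peval (edge i t) f = 0"
  shows "\<exists>c. \<forall>t. peval (edge i t) f = c * G i (edge i t)"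
proof -
  let ?K = "{E. E \<in> Poly_Mapping.keys f \<and> Poly_Mapping.lookup E i = 0}"
  let ?o = "nxt (nxt i)"
  define s :: complex where "s = (- 1) ^ m"
  have ss: "s * s = 1" unfolding s_def by (simp flip: power_mult_distrib)
  have deg: "edeg E = m + 2" if "E \<in> ?K" for E using f that by (auto simp: is_form_def edeg_def)
  have le: "Poly_Mapping.lookup E ?o \<le> m + 2" if "E \<in> ?K" for E using deg[OF that] edeg_xyz[of E i] by simp
  define p where "p = (\<Sum>E\<in>?K. Polynomial.monom (Poly_Mapping.lookup f E) (Poly_Mapping.lookup E ?o))"
  have p: "poly p t = peval (edge i t) f" for t by (simp add: p_def poly_sum poly_monom peval_edge)
  have cp: "Polynomial.coeff p k = (\<Sum>E\<in>?K. if Poly_Mapping.lookup E ?o = k then Poly_Mapping.lookup f E else 0)" for k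
    by (simp add: p_def coeff_sum)
  have big: "Polynomial.coeff p k = 0" if "k > m + 2" for k
    unfolding cp using le that by (intro sum.neutral) fastforce
  \<comment> \<open>The second corner is the point at infinity of this parametrisation. Seen from
    the adjacent side as \<open>edge (nxt i) 0\<close>, it yields the coefficient of
    t^(m+2).\<close>
  have top: "Polynomial.coeff p (m + 2) = 0"
  proof -
    have "peval ((\<lambda>_. 0)(?o := 1)) f = peval (edge (nxt i) 0) f"
      by (intro arg_cong[of _ _ "\<lambda>v. peval v f"]) (simp add: edge_def fun_eq_iff)
    also have "\<dots> = (\<Sum>E\<in>{E. E \<in> Poly_Mapping.keys f \<and> Poly_Mapping.lookup E (nxt i) = 0}.
        Poly_Mapping.lookup f E * 0 ^ Poly_Mapping.lookup E i)" by (simp add: peval_edge)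
    also have "\<dots> = (\<Sum>E\<in>{E \<in> ?K. Poly_Mapping.lookup E ?o = m + 2}. Poly_Mapping.lookup f E)"
    proof (rule sum.mono_neutral_cong)
      fix E assume "E \<in> {E. E \<in> Poly_Mapping.keys f \<and> Poly_Mapping.lookup E (nxt i) = 0} -
          {E \<in> ?K. Poly_Mapping.lookup E ?o = m + 2}"
      then have E: "E \<in> Poly_Mapping.keys f" "Poly_Mapping.lookup E (nxt i) = 0"
        "\<not> (Poly_Mapping.lookup E i = 0 \<and> Poly_Mapping.lookup E ?o = m + 2)" by auto
      have "edeg E = m + 2" using f E(1) by (auto simp: is_form_def edeg_def)
      then have "Poly_Mapping.lookup E i > 0" using E edeg_xyz[of E i] by auto
      then show "Poly_Mapping.lookup f E * 0 ^ Poly_Mapping.lookup E i = 0" by (simp add: zero_power)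
    next
      fix E assume "E \<in> {E \<in> ?K. Poly_Mapping.lookup E ?o = m + 2} -
          {E. E \<in> Poly_Mapping.keys f \<and> Poly_Mapping.lookup E (nxt i) = 0}"
      then show "Poly_Mapping.lookup f E = 0" using deg[of E] edeg_xyz[of E i] by auto
    qed auto
    also have "\<dots> = Polynomial.coeff p (m + 2)" unfolding cp
      by (rule sum.mono_neutral_cong_left) auto
    finally show ?thesis using corner(2) by simp
  qed
  define c where "c = Polynomial.coeff p (m + 1)"
  define r where "r = Polynomial.monom c (m + 1) - Polynomial.monom (c * s) 1"
  have "p - r = 0"
  proof (rule ccontr)
    assume ne: "p - r \<noteq> 0"
    have "degree (p - r) \<le> m"
    proof (rule degree_le, intro allI impI)
      fix k assume k: "m < k"
      then consider "k = m + 1" | "k = m + 2" | "k > m + 2" by linarith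
      then show "Polynomial.coeff (p - r) k = 0"
      proof cases
        case 1
        then show ?thesis using m by (simp add: r_def c_def)
      next
        case 2
        then show ?thesis using m top by (simp add: r_def)
      next
        case 3
        then show ?thesis using m big by (simp add: r_def)
      qed
    qed
    moreover have "card {t. poly (p - r) t = 0} \<le> degree (p - r)" by (rule card_poly_roots_bound[OF ne])
    moreover have "insert 0 {t. t ^ m = s} \<subseteq> {t. poly (p - r) t = 0}"
    proof
      fix t assume t: "t \<in> insert 0 {t. t ^ m = s}"
      have "edge i 0 = (\<lambda>_. 0)(nxt i := 1)" by (simp add: edge_def fun_eq_iff)
      then have "poly p t = 0" using t corner(1) roots unfolding p s_def by auto
      moreover have "poly r t = 0" using t m by (auto simp: r_def poly_monom algebra_simps)
      ultimately show "t \<in> {t. poly (p - r) t = 0}" by simp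
    qed
    then have "card (insert 0 {t. t ^ m = s}) \<le> card {t. poly (p - r) t = 0}"
      by (intro card_mono poly_roots_finite ne)
    moreover have "card {t. t ^ m = s} = m" using m unfolding s_def by (intro card_nth_roots) auto
    moreover have "finite {t. t ^ m = s}" using calculation(4) m by (intro card_ge_0_finite) simp
    moreover have "0 \<notin> {t. t ^ m = s}" using m unfolding s_def by (simp add: power_0_left)
    ultimately show False by simp
  qed
  then have pr: "p = r" by simp
  \<comment> \<open>G_i restricts to t (1 - s t^m), which is -s times t^(m+1) - s t because s^2 =
    1.\<close>
  have "peval (edge i t) f = (- s * c) * G i (edge i t)" for t
  proof -
    have "G i (edge i t) = t * (1 - s * t ^ m)"
      unfolding G_def s_def edge_def using power_minus[of t m] by simp
    moreover have "poly r t = c * t ^ (m + 1) - c * s * t" by (simp add: r_def poly_monom)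
    moreover have "(- s * c) * (t * (1 - s * t ^ m)) = (s * s) * (c * t ^ (m + 1)) - c * s * t"
      by (simp add: algebra_simps)
    ultimately show ?thesis unfolding p[symmetric] pr ss by simp
  qed
  then show ?thesis by blast
qed

section \<open>The points dual to the linear factors\<close>

definition line :: "(xyz \<Rightarrow> complex) \<Rightarrow> xyz cpoly" where
  "line v = Const (v IX) * xv + Const (v IY) * yv + Const (v IZ) * zv"

lemma peval_line: "peval u (line v) = (\<Sum>j\<in>UNIV. v j * u j)"
  by (simp add: line_def peval_add peval_mult sum_cyc[of _ IX])

lemma peval_F3: "peval u (F3 m) = (\<Prod>j\<in>UNIV. u j) * (\<Prod>j\<in>UNIV. u j ^ m - u (nxt j) ^ m)"
  by (simp add: F3_def peval_mult peval_diff peval_power prod_cyc[of _ IX])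

lemma dual_pointI:
  assumes w: "w \<in> nonzero_vecs UNIV" and dvd: "line w dvd F3 m"
  shows "proj_point UNIV w \<in> dual_points (F3 m)" "w \<in> proj_point UNIV w"
proof -
  show "w \<in> proj_point UNIV w" using proj_point[OF w] by blast
  have "line v dvd F3 m" if "v \<in> proj_point UNIV w" for v
  proof -
    have "(w, v) \<in> proportional UNIV" using that by (simp add: proj_point_def)
    then obtain c where c: "c \<noteq> 0" "v = (\<lambda>i. c * w i)" by (auto simp: proportional_def)
    have lv: "line v = Const c * line w" by (simp add: c(2) line_def Const_mult algebra_simps)
    obtain k where k: "F3 m = line w * k" using dvd by blast
    have "line v * (Const (inverse c) * k) = (Const c * Const (inverse c)) * (line w * k)"
      unfolding lv by (simp only: mult_ac)
    also have "Const c * Const (inverse c) = (1 :: xyz cpoly)" using c(1) by (simp flip: Const_mult)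
    finally show ?thesis using k by (metis dvd_triv_left mult_1)
  qed
  then show "proj_point UNIV w \<in> dual_points (F3 m)"
    using proj_point[OF w] by (simp add: dual_points_def line_def)
qed

lemma F3_cyc: "F3 m = Var i * Var (nxt i) * Var (nxt (nxt i)) *
   (Var (nxt i) ^ m - Var (nxt (nxt i)) ^ m) * (Var i ^ m - Var (nxt i) ^ m) * (Var (nxt (nxt i)) ^ m - Var i ^ m)"
  unfolding F3_def by (cases i) (simp_all add: mult_ac)

lemma line_cyc: "line w = Const (w i) * Var i + Const (w (nxt i)) * Var (nxt i) + Const (w (nxt (nxt i))) * Var (nxt (nxt i))"
  unfolding line_def by (cases i) (simp_all add: add_ac)

lemma corner_dual: "proj_point UNIV ((\<lambda>_. 0)(i := 1)) \<in> dual_points (F3 m)"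
  "(\<lambda>_. 0)(i := 1) \<in> proj_point UNIV ((\<lambda>_. 0)(i := 1))"
proof -
  have "line ((\<lambda>_. 0)(i := 1)) dvd F3 m"
    unfolding line_cyc[of _ i] F3_cyc[of i] by (simp add: mult.assoc)
  moreover have "((\<lambda>_. 0)(i := 1)) \<in> nonzero_vecs UNIV" by (auto simp: nonzero_vecs_def)
  ultimately show "proj_point UNIV ((\<lambda>_. 0)(i := 1)) \<in> dual_points (F3 m)"
    "(\<lambda>_. 0)(i := 1) \<in> proj_point UNIV ((\<lambda>_. 0)(i := 1))" by (rule dual_pointI[rotated])+
qed

text \<open>With w = -t the dual line v_{i+1} + t v_{i+2} is v_{i+1} - w v_{i+2} with w^m = 1, a
  factor of v_{i+1}^m - v_{i+2}^m.\<close>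

lemma edge_dual:
  assumes t: "t ^ m = (- 1) ^ m"
  shows "proj_point UNIV (edge i t) \<in> dual_points (F3 m)" "edge i t \<in> proj_point UNIV (edge i t)"
proof -
  define w where "w = - t"
  have w: "w ^ m = 1" unfolding w_def power_minus[of t] t by (simp flip: power_mult_distrib)
  let ?y = "Var (nxt i) :: xyz cpoly" and ?z = "Var (nxt (nxt i)) :: xyz cpoly"
  have "Const w ^ n = (Const (w ^ n) :: xyz cpoly)" for n by (induction n) (simp_all add: Const_mult)
  then have "?y ^ m - ?z ^ m = ?y ^ m - (Const w * ?z) ^ m" using w by (simp add: power_mult_distrib)
  moreover have "(?y - Const w * ?z) dvd (?y ^ m - (Const w * ?z) ^ m)"
    by (subst power_diff_sumr2) (rule dvd_triv_left)
  moreover have "line (edge i t) = ?y - Const w * ?z"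
    unfolding line_cyc[of _ i] by (simp add: edge_def w_def Const_uminus)
  ultimately have "line (edge i t) dvd ?y ^ m - ?z ^ m" by simp
  then have "line (edge i t) dvd F3 m" unfolding F3_cyc[of i] 
    by (rule dvd_mult2[OF dvd_mult2[OF dvd_mult]])
  moreover have "edge i t \<in> nonzero_vecs UNIV" by (auto simp: nonzero_vecs_def edge_def intro!: exI[of _ "nxt i"])
  ultimately show "proj_point UNIV (edge i t) \<in> dual_points (F3 m)" "edge i t \<in> proj_point UNIV (edge i t)"
    by (rule dual_pointI[rotated])+
qed

text \<open>A linear factor makes \<open>F3 m\<close> vanish along the whole dual line, so it
  suffices to evaluate at well-chosen points there. This gives what is needed of the points of Z(F)
  without listing the factors.\<close>

lemma line_dvd_F3:
  assumes dvd: "line v dvd F3 m"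
  shows "V v = 0" "G i v = 0"
proof -
  have F0: "peval u (F3 m) = 0" if "(\<Sum>j\<in>UNIV. v j * u j) = 0" for u
  proof -
    obtain k where "F3 m = line v * k" using dvd by blast
    then show ?thesis using that by (simp add: peval_mult peval_line)
  qed
  show V0: "V v = 0"
  proof (rule ccontr)
    assume "V v \<noteq> 0"
    then have nz: "v j \<noteq> 0" for j by (auto simp: V_def)
    \<comment> \<open>A parametrisation of the line by x = 1, y = t, with z solved for.
      \<open>F3 m\<close> would become the zero polynomial along it, although none of its factors
      does.\<close>
    define q where "q j = (case j of IX \<Rightarrow> [:1:] | IY \<Rightarrow> [:0, 1:] | IZ \<Rightarrow> [:- v IX / v IZ, - v IY / v IZ:])" for j
    define P where "P = (\<Prod>j\<in>UNIV. q j) * (\<Prod>j\<in>UNIV. q j ^ m - q (nxt j) ^ m)"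
    have "poly P t = 0" for t
    proof -
      have "(\<Sum>j\<in>UNIV. v j * poly (q j) t) = 0"
        using nz[of IZ] by (simp add: sum_cyc[of _ IX] q_def field_simps)
      from F0[OF this] show ?thesis unfolding peval_F3 P_def by (simp add: poly_prod)
    qed
    then have "P = 0" using poly_all_0_iff_0 by blast
    moreover have "q j \<noteq> 0" for j using nz by (cases j) (auto simp: q_def)
    moreover have "q j ^ m - q (nxt j) ^ m \<noteq> 0" for j
    proof -
      have m0: "m \<noteq> 0" using m by simp
      \<comment> \<open>Each difference of m-th powers is tested where exactly one of its two
        coordinates is zero: at t = 0 for the first two, at the zero of the third coordinate for the
        last.\<close>
      have "poly (q IX ^ m - q IY ^ m) 0 \<noteq> 0" using m0 by (simp add: q_def power_0_left)
      moreover have "poly (q IY ^ m - q IZ ^ m) 0 \<noteq> 0" using m0 nz by (simp add: q_def power_0_left)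
      moreover have "poly (q IZ ^ m - q IX ^ m) (- v IX / v IY) \<noteq> 0" using m0 nz by (simp add: q_def power_0_left)
      ultimately have "q IX ^ m - q IY ^ m \<noteq> 0" "q IY ^ m - q IZ ^ m \<noteq> 0" "q IZ ^ m - q IX ^ m \<noteq> 0"
        by (metis poly_0)+
      then show ?thesis by (cases j) simp_all
    qed
    ultimately show False by (simp add: P_def)
  qed
  show "G i v = 0"
  proof (cases "v (nxt i) = 0 \<or> v (nxt (nxt i)) = 0")
    case False
    then have vi: "v i = 0" using V0 by (simp add: V_def prod_cyc[of _ i])
    let ?a = "v (nxt i)" and ?b = "v (nxt (nxt i))"
    \<comment> \<open>The size of s makes s^m differ from the m-th powers of ?b and -?a. At the
      point (s, ?b, -?a) of the line the only factor that can vanish is then ?b^m - (-?a)^m.\<close>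
    define s :: complex where "s = of_real (norm ?a + norm ?b + 1)"
    have ns: "norm s = norm ?a + norm ?b + 1" unfolding s_def by (simp only: norm_of_real) simp
    have m0: "0 < m" using m by simp
    have big: "s ^ m \<noteq> x ^ m" if "norm x < norm s" for x
    proof
      assume "s ^ m = x ^ m"
      then have "norm s ^ m = norm x ^ m" by (metis norm_power)
      moreover have "norm x ^ m < norm s ^ m" using that m0 by (intro power_strict_mono) auto
      ultimately show False by simp
    qed
    let ?u = "(\<lambda>_. 0)(i := s, nxt i := ?b, nxt (nxt i) := - ?a)"
    have "(\<Sum>j\<in>UNIV. v j * ?u j) = 0" by (simp add: sum_cyc[of _ i] vi)
    from F0[OF this] have "s * ?b * (- ?a) * ((s ^ m - ?b ^ m) * (?b ^ m - (- ?a) ^ m) * ((- ?a) ^ m - s ^ m)) = 0"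
      unfolding peval_F3 prod_cyc[of _ i] by simp
    moreover have "s ^ m \<noteq> ?b ^ m" "s ^ m \<noteq> (- ?a) ^ m" 
    proof -
      have "norm ?b < norm s" "norm (- ?a) < norm s"
        unfolding ns norm_minus_cancel using norm_ge_zero[of ?a] norm_ge_zero[of ?b] by linarith+
      then show "s ^ m \<noteq> ?b ^ m" "s ^ m \<noteq> (- ?a) ^ m" by (simp_all only: big not_False_eq_True)
    qed
    moreover have "s \<noteq> 0"
    proof -
      have "norm s > 0" unfolding ns using norm_ge_zero[of ?a] norm_ge_zero[of ?b] by linarith
      then show ?thesis by auto
    qed
    ultimately have "?b ^ m = (- ?a) ^ m" using False by auto
    then have "(- ?b) ^ m = ?a ^ m"
      unfolding power_minus[of ?b] power_minus[of ?a] by (simp flip: mult.assoc power_mult_distrib)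
    then show ?thesis by (simp add: G_def)
  qed (auto simp: G_def)
qed

lemma basis_form_coords: "k \<in> J \<Longrightarrow> peval v (basis_form m k) = phi m v k"
  by (simp add: phi_def)

lemma is_form_basis: "k \<in> J \<Longrightarrow> is_form (m + 2) (basis_form m k)"
proof -
  assume "k \<in> J"
  have V: "is_form (n * 1) (Var i ^ n)" "is_form (n * 1) ((- Var i) ^ n)" for i :: xyz and n
    by (intro is_form_power is_form_Var is_form_uminus)+
  have two: "is_form 2 (Var i * Var j)" for i j :: xyz by (rule is_form_Var2)
  have Gf: "is_form (2 + m * 1) (Var i * Var j * (Var i ^ m - (- Var j) ^ m))" for i j :: xyz
    by (intro is_form_mult two is_form_diff V)
  from \<open>k \<in> J\<close> consider a b c where "k = Lam a b c" "a + b + c = m - 1" | "k = Gx" | "k = Gy" | "k = Gz"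
    by (auto simp: coords_def)
  then show ?thesis
  proof cases
    case (1 a b c)
    have "is_form (3 + (a * 1 + b * 1 + c * 1)) (xv * yv * zv * (xv ^ a * yv ^ b * zv ^ c))"
      by (intro is_form_mult is_form_Var3 V)
    moreover have "3 + (a * 1 + b * 1 + c * 1) = m + 2" using 1 m by simp
    ultimately show ?thesis unfolding 1(1) basis_form.simps by (simp only:)
  qed (use Gf[of IY IZ] Gf[of IZ IX] Gf[of IX IY] in \<open>simp_all add: add.commute\<close>)
qed

text \<open>Basis forms are normal forms of degree one, so their independence is an instance of
  \<open>nf_independent\<close>.\<close>

fun expo :: "coordinate \<Rightarrow> (xyz \<Rightarrow> nat) \<times> (xyz \<Rightarrow> nat)" where
  "expo (Lam a b c) = ((\<lambda>_. 0), (\<lambda>i. case i of IX \<Rightarrow> a | IY \<Rightarrow> b | IZ \<Rightarrow> c))"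
| "expo Gx = ((\<lambda>_. 0)(IX := 1), (\<lambda>_. 0))"
| "expo Gy = ((\<lambda>_. 0)(IY := 1), (\<lambda>_. 0))"
| "expo Gz = ((\<lambda>_. 0)(IZ := 1), (\<lambda>_. 0))"

lemma expo_simps: "expo (Lc \<alpha>) = ((\<lambda>_. 0), \<alpha>)" "expo (Gc i) = ((\<lambda>_. 0)(i := 1), (\<lambda>_. 0))"
proof -
  have "(case i of IX \<Rightarrow> \<alpha> IX | IY \<Rightarrow> \<alpha> IY | IZ \<Rightarrow> \<alpha> IZ) = \<alpha> i" for i by (cases i) simp_all
  then show "expo (Lc \<alpha>) = ((\<lambda>_. 0), \<alpha>)" by (simp add: Lc_def fun_eq_iff)
qed (cases i; simp)

lemma phi_expo: "k \<in> J \<Longrightarrow> phi m v k = mf (fst (expo k)) (snd (expo k)) v"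
proof -
  assume "k \<in> J"
  then consider i where "k = Gc i" | \<alpha> where "k = Lc \<alpha>" "sz \<alpha> = m - 1" by (auto simp: coords_eq)
  then show ?thesis
  proof cases
    case (1 i)
    then show ?thesis using mf_G[of "\<lambda>_. 0" i "\<lambda>_. 0" v] by (simp add: expo_simps phi_G mf_00)
  next
    case (2 \<alpha>)
    then show ?thesis using m by (simp add: expo_simps phi_L mf_def)
  qed
qed

lemma expo_nf: "expo ` J \<subseteq> nf"
proof -
  have "\<exists>j. j \<noteq> i" for i :: xyz by (rule exI[of _ "nxt i"]) simp
  then show ?thesis by (auto simp: coords_eq expo_simps nf_def sz_def[of "\<lambda>_. 0"])
qed

lemma inj_expo: "inj_on expo J"
proof (rule inj_onI)
  fix k l assume kl: "k \<in> J" "l \<in> J" "expo k = expo l"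
  have ne: "(\<lambda>_. 0)(i := Suc 0) \<noteq> (\<lambda>_. 0)" "(\<lambda>_. 0) \<noteq> (\<lambda>_. 0)(i := Suc 0)" for i :: xyz
    by (simp_all add: fun_eq_iff)
  have ne2: "(\<lambda>_. 0)(i := Suc 0) = (\<lambda>_. 0)(j := Suc 0) \<longleftrightarrow> i = j" for i j :: xyz
    by (auto simp: fun_eq_iff split: if_splits)
  show "k = l" using kl by (auto simp: coords_eq expo_simps ne ne2)
qed

lemma phi_independent:
  assumes "T \<subseteq> J" "\<And>v. (\<Sum>k\<in>T. c k * phi m v k) = 0" "k \<in> T"
  shows "c k = 0"
proof -
  have fT: "finite T" using assms(1) finite_J by (rule finite_subset)
  have inj: "inj_on expo T" using inj_expo assms(1) by (rule inj_on_subset)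
  have "c (the_inv_into T expo (expo k)) = 0"
  proof (rule nf_independent[where A = "expo ` T"])
    show "finite (expo ` T)" using fT by simp
    show "expo ` T \<subseteq> nf" using expo_nf assms(1) by blast
    show "expo k \<in> expo ` T" using assms(3) by simp
    fix v
    have "(\<Sum>j\<in>expo ` T. c (the_inv_into T expo j) * mf (fst j) (snd j) v) =
      (\<Sum>k\<in>T. c k * mf (fst (expo k)) (snd (expo k)) v)"
      using inj by (simp add: sum.reindex the_inv_into_f_f)
    also have "\<dots> = (\<Sum>k\<in>T. c k * phi m v k)" using phi_expo assms(1) by (intro sum.cong) auto
    finally show "(\<Sum>j\<in>expo ` T. c (the_inv_into T expo j) * mf (fst j) (snd j) v) = 0" using assms(2) by simp
  qed
  then show ?thesis using inj assms(3) by (simp add: the_inv_into_f_f)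
qed

theorem family_basis: "is_family_basis (basis_form m) J (forms_vanishing_on (m + 2) (dual_points (F3 m)))"
proof -
  interpret vs: vector_space "\<lambda>c (f :: xyz cpoly). Const c * f" by (rule vector_space_cpoly)
  let ?b = "basis_form m" and ?V = "forms_vanishing_on (m + 2) (dual_points (F3 m))"
  have indep: "c k = 0" if T: "T \<subseteq> J" "(\<Sum>k\<in>T. Const (c k) * ?b k) = 0" "k \<in> T" for T c k
  proof (rule phi_independent[OF T(1) _ T(3)])
    fix v
    have "(\<Sum>k\<in>T. c k * phi m v k) = peval v (\<Sum>k\<in>T. Const (c k) * ?b k)"
      unfolding peval_sum using T(1) by (intro sum.cong) (auto simp: peval_mult basis_form_coords)
    then show "(\<Sum>k\<in>T. c k * phi m v k) = 0" unfolding T(2) by simp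
  qed
  have inj: "inj_on ?b J"
  proof (rule inj_onI, rule ccontr)
    fix k l assume kl: "k \<in> J" "l \<in> J" "?b k = ?b l" "k \<noteq> l"
    have "(\<lambda>j. if j = k then 1 else - 1 :: complex) k = 0"
      using kl by (intro indep[where T = "{k, l}"]) (auto simp: Const_uminus)
    then show False by simp
  qed
  have "\<not> vs.dependent (?b ` J)"
  proof
    assume "vs.dependent (?b ` J)"
    then obtain t u where t: "finite t" "t \<subseteq> ?b ` J" "(\<Sum>f\<in>t. Const (u f) * f) = 0" "\<exists>f\<in>t. u f \<noteq> 0"
      unfolding vs.dependent_explicit by blast
    obtain T where T: "T \<subseteq> J" "t = ?b ` T" using t(2) by (meson subset_imageE)
    have "(\<Sum>k\<in>T. Const (u (?b k)) * ?b k) = 0"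
      using t(3) inj_on_subset[OF inj T(1)] unfolding T(2) by (simp add: sum.reindex)
    then have "u (?b k) = 0" if "k \<in> T" for k using indep[OF T(1), of "\<lambda>k. u (?b k)"] that by blast
    then show False using t(4) T(2) by blast
  qed
  moreover have "vs.span (?b ` J) = ?V"
  proof
    show "vs.span (?b ` J) \<subseteq> ?V"
    proof (rule vs.span_minimal)
      show "vs.subspace ?V"
        by (rule vs.subspaceI)
          (auto simp: forms_vanishing_on_def vanishes_at_def peval_add peval_mult intro: is_form_add is_form_Const_mult)
      show "?b ` J \<subseteq> ?V"
      proof
        fix f assume "f \<in> ?b ` J"
        then obtain k where k: "k \<in> J" "f = ?b k" by blast
        have "peval v f = 0" if "P \<in> dual_points (F3 m)" "v \<in> P" for P v
        proof -
          have "line v dvd F3 m" using that by (simp add: dual_points_def line_def)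
          note z = line_dvd_F3[OF this]
          from k(1) consider i where "k = Gc i" | \<alpha> where "k = Lc \<alpha>" "sz \<alpha> = m - 1" by (auto simp: coords_eq)
          then have "phi m v k = 0" by cases (simp_all add: phi_G phi_L z)
          then show ?thesis using basis_form_coords[OF k(1)] k(2) by simp
        qed
        then show "f \<in> ?V" using is_form_basis[OF k(1)] k(2) by (auto simp: forms_vanishing_on_def vanishes_at_def)
      qed
    qed
    show "?V \<subseteq> vs.span (?b ` J)"
    proof
      fix f assume "f \<in> ?V"
      then have f: "is_form (m + 2) f" and van: "\<And>P v. P \<in> dual_points (F3 m) \<Longrightarrow> v \<in> P \<Longrightarrow> peval v f = 0"
        by (auto simp: forms_vanishing_on_def vanishes_at_def)
      have "\<forall>i. \<exists>c. \<forall>t. peval (edge i t) f = c * G i (edge i t)"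
        using van[OF corner_dual] van[OF edge_dual] by (intro allI edge_form f) blast+
      then obtain c where c: "\<And>i t. peval (edge i t) f = c i * G i (edge i t)" by metis
      \<comment> \<open>On the side v_i = 0 only G_i among the three \<open>G\<close> can be
        nonzero, so one subtraction clears all three sides. Every monomial of \<open>h\<close> is
        then divisible by x y z.\<close>
      define h where "h = f - (\<Sum>j\<in>UNIV. Const (c j) * ?b (Gc j))"
      have fh: "is_form (m + 2) h" unfolding h_def
        by (intro is_form_diff f is_form_sum is_form_Const_mult is_form_basis) simp
      have h0: "peval (edge i t) h = 0" for i t
      proof -
        have "G (nxt i) (edge i t) = 0" "G (nxt (nxt i)) (edge i t) = 0" by (simp_all add: G_def edge_def)
        then have "(\<Sum>j\<in>UNIV. c j * G j (edge i t)) = c i * G i (edge i t)" by (simp add: sum_cyc[of _ i])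
        then show ?thesis
          by (simp add: h_def peval_diff peval_sum peval_mult basis_form_coords phi_G c)
      qed
      have "h \<in> vs.span (?b ` J)"
      proof (subst sum_single_lookup, rule vs.span_sum)
        fix E assume E: "E \<in> Poly_Mapping.keys h"
        have pos: "Poly_Mapping.lookup E i > 0" for i by (rule edge_vanish[OF fh h0 E])
        have dE: "edeg E = m + 2" using fh E by (auto simp: is_form_def edeg_def)
        let ?a = "\<lambda>i. Poly_Mapping.lookup E i - 1"
        have k: "Lam (?a IX) (?a IY) (?a IZ) \<in> J"
          using dE edeg_xyz[of E IX] pos[of IX] pos[of IY] pos[of IZ] by (auto simp: coords_def)
        have S: "Poly_Mapping.lookup E i = Suc (?a i)" for i using pos[of i] by simp
        have "Poly_Mapping.single E (1::complex) = ?b (Lam (?a IX) (?a IY) (?a IZ))"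
          unfolding monomial_xyz by (subst (1 2 3) S) (simp add: mult_ac)
        moreover have "Poly_Mapping.single E (Poly_Mapping.lookup h E) =
            Const (Poly_Mapping.lookup h E) * Poly_Mapping.single E 1" by (simp add: Const_def mult_single)
        ultimately show "Poly_Mapping.single E (Poly_Mapping.lookup h E) \<in> vs.span (?b ` J)"
          using vs.span_scale[OF vs.span_base[OF imageI[OF k]]] by (simp only:)
      qed
      moreover have "(\<Sum>j\<in>UNIV. Const (c j) * ?b (Gc j)) \<in> vs.span (?b ` J)"
        by (intro vs.span_sum vs.span_scale vs.span_base) simp
      ultimately have "h + (\<Sum>j\<in>UNIV. Const (c j) * ?b (Gc j)) \<in> vs.span (?b ` J)" by (rule vs.span_add)
      then show "f \<in> vs.span (?b ` J)" by (simp add: h_def)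
    qed
  qed
  ultimately show ?thesis using inj by (simp add: is_family_basis_def)
qed

lemma card_coords: "card J = (m ^ 2 + m) div 2 + 3"
proof -
  have "card J = card (Lc ` {\<alpha>. sz \<alpha> = m - 1}) + card (range Gc)"
    unfolding coords_eq by (intro card_Un_disjoint) (auto simp: finite_exponents)
  also have "card (Lc ` {\<alpha>. sz \<alpha> = m - 1}) = (m - 1 + 2) choose (m - 1)"
    by (subst card_image) (auto simp: inj_on_def inj_Lc card_exponents)
  also have "card (range Gc) = 3" by (subst card_image) (auto simp: inj_on_def inj_Gc UNIV_xyz)
  also have "(m - 1 + 2) choose (m - 1) = (m + 1) choose 2"
    using binomial_symmetric[of 2 "m + 1"] m by simp
  also have "\<dots> = (m ^ 2 + m) div 2"
    using choose_two[of "m + 1"] by (simp add: power2_eq_square algebra_simps)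
  finally show ?thesis .
qed

end

theorem proposition5p7:
  fixes m N :: nat
  assumes "m \<ge> 4" and "N = (m ^ 2 + m) div 2 + 2"
  shows
    "card (coords m) = N + 1 \<and>
     is_family_basis (basis_form m) (coords m)
       (forms_vanishing_on (m + 2) (dual_points (F3 m))) \<and>
     (let J = coords m; I = homogeneous_ideal J (surface_X m) in
       projective_surface J (surface_X m) \<and>
       arithmetically_cohen_macaulay J (surface_X m) \<and>
       (\<exists>B \<subseteq> carrier (poly_ring J).
          (\<forall>f \<in> B. \<exists>d \<le> 3. is_form d f) \<and> I = genideal (poly_ring J) B) \<and>
       (\<exists>Q \<subseteq> carrier (poly_ring J).
          finite Q \<and> card Q = 3 * ((m + 2) choose 4) \<and>
          (\<forall>q \<in> Q. q \<noteq> 0 \<and> is_form 2 q) \<and>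
          I = genideal (poly_ring J) (insert (cubic_C m) Q)))"
proof -
  interpret surf m by unfold_locales (rule assms(1))
  have I: "homogeneous_ideal (coords m) (surface_X m) = Ker" by (rule homogeneous_ideal_surface)
  obtain Q where Q: "Q \<subseteq> carrier (poly_ring (coords m))" "finite Q" "card Q = 3 * ((m + 2) choose 4)"
    "\<forall>q\<in>Q. q \<noteq> 0 \<and> is_form 2 q" "Ker = genideal (poly_ring (coords m)) (insert (cubic_C m) Q)"
    using Ker_generators by blast
  have "card (coords m) = N + 1" unfolding card_coords assms(2) by simp
  moreover note family_basis projective_surface_X
  moreover have "arithmetically_cohen_macaulay (coords m) (surface_X m)"
    unfolding arithmetically_cohen_macaulay_def homogeneous_coordinate_ring_def I
    by (rule cohen_macaulay_Q)
  moreover have "\<exists>B\<subseteq>carrier (poly_ring (coords m)). (\<forall>f\<in>B. \<exists>d\<le>3. is_form d f) \<and>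
      Ker = genideal (poly_ring (coords m)) B"
  proof (intro exI[of _ "insert (cubic_C m) Q"] conjI ballI)
    show "insert (cubic_C m) Q \<subseteq> carrier (poly_ring (coords m))"
      using Q(1) cubic_C_Ker by (auto simp: Ker_def)
    fix f assume "f \<in> insert (cubic_C m) Q"
    then have "is_form 3 f \<or> is_form 2 f" using is_form_cubic_C Q(4) by blast
    then show "\<exists>d\<le>3. is_form d f" by (elim disjE) (rule exI[of _ 3], simp, rule exI[of _ 2], simp)
  qed (rule Q(5))
  moreover have "\<exists>Q\<subseteq>carrier (poly_ring (coords m)). finite Q \<and> card Q = 3 * ((m + 2) choose 4) \<and>
      (\<forall>q\<in>Q. q \<noteq> 0 \<and> is_form 2 q) \<and> Ker = genideal (poly_ring (coords m)) (insert (cubic_C m) Q)"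
    using Q by blast
  ultimately show ?thesis unfolding Let_def I by (intro conjI)
qed

end
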